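(* Let $f\colon[0,\infty)\times\mathbb R\times\mathbb R^n\to\mathbb R^n$ satisfy: (a) for every $r>0$, $f$ is bounded and continuous when restricted to $[0,\infty)\times\mathbb R\times\{x\in\mathbb R^n: |x|\le r\}$; (b) for every $r>0$ there exist a modulus of continuity $\theta_r$ and a constant $L_r>0$ such that $|f(\tau,t_1,x_1)-f(\tau,t_2,x_2)|\le\theta_r(|t_1-t_2|)+L_r|x_1-x_2|$ for all $\tau\ge 0$, $t_1,t_2\in\mathbb R$ and $|x_1|,|x_2|\le r$; (c) for every $(t,x)\in\mathbb R\times\mathbb R^n$ the limit $\hat f(t,x):=\lim_{T\to\infty}\frac1T\int_0^T f(s,t,x)\,ds$ exists; (d) for every $r>0$, $\hat f(t,x)=\lim_{T\to\infty}\frac1T\int_\tau^{T+\tau} f(s,t,x)\,ds$ uniformly for $(\tau,t,x)\in[0,\infty)\times\mathbb R\times\{|x|\le r\}$. Let $\Omega$ be the hull of $\hat f$ and $\pi$ the skewproduct flow on $\Omega\times\mathbb R^n$ associated with $\hat f$. Assume the existence of a local attractor $\mathcal A$ for $\pi$ with $\Omega_{\mathcal A}=\Omega$, and let $\hat x\in\mathbb R^n$ be such that $(\hat f,\hat x)\in\mathcal U_{\mathcal A}$, the basin of attraction of $\mathcal A$. Assume also that $\Omega$ is minimal for the flow $\sigma_{\hat f}$. Let $\Omega^{\rm cont}_{\mathcal A}\subseteq\Omega$ be the set of continuity points of the map $\Omega\to\mathcal P_c(\mathbb R^n)$, $\omega\mapsto\mathcal A_\omega$. Then: (i) Given $\bar\omega\in\Omega^{\rm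 cont}_{\mathcal A}$ and $\sigma>0$, there exist $\bar\varepsilon=\bar\varepsilon(\bar\omega,\sigma)>0$ and a set $\mathcal D=\mathcal D(\bar\omega,\sigma)\subseteq[0,\infty)$ which is relatively dense and has positive lower density such that, if $0<\varepsilon<\bar\varepsilon$, then $$\operatorname{dist}_{\mathbb R^n}\big(\tilde x_\varepsilon(t;0,\hat x),\mathcal A_{\bar\omega}\big)\le 2\sigma/3\quad\text{and}\quad \operatorname{dist}_{\mathbb R^n}\big(\tilde x_\varepsilon(t;0,\hat x),\mathcal A_{\hat f\cdot t}\big)\le \sigma\quad\text{for all } t\in\mathcal D.$$ (ii) Assume that, in addition, $\Omega^{\rm cont}_{\mathcal A}$ has complete measure. Given $\sigma>0$ and $\rho\in(0,1)$, there exist $\varepsilon^*=\varepsilon^*(\sigma,\rho)>0$ and a set $\mathcal D^*=\mathcal D^*(\sigma,\rho)\subseteq[0,\infty)$ which is relatively dense and has lower density $d_l(\mathcal D^* )\ge1-\rho$ such that, if $0<\varepsilon<\varepsilon^*$, then $\operatorname{dist}_{\mathbb R^n}\big(\tilde x_\varepsilon(t;0,\hat x),\mathcal A_{\hat f\cdot t}\big)\le \sigma$ for all $t\in\mathcal D^*$.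
   Context: A modulus of continuity is a nondecreasing map $\theta\colon[0,\infty)\to[0,\infty]$ with $\lim_{r\to0^+}\theta(r)=0$. $|\cdot|$ is the Euclidean norm. For $\varepsilon>0$, $\tilde x_\varepsilon(t;t^*,x^* )$ is the maximal solution of $dx/dt=f(t/\varepsilon,t,x)$ with value $x^*$ at $t=t^*\ge 0$. Hull and skewproduct flow: for $h\in C(\mathbb R\times\mathbb R^n,\mathbb R^n)$ and $s\in\mathbb R$, let $(h\cdot s)(t,x):=h(t+s,x)$. The hull $\Omega$ of $\hat f$ is the closure of $\{\hat f\cdot s: s\in\mathbb R\}$ in $C(\mathbb R\times\mathbb R^n,\mathbb R^n)$ for the compact-open topology; under (a)–(c) it is a compact metric space, for a fixed distance $d_\Omega$ inducing this topology, and $\sigma_{\hat f}(t,\omega):=\omega\cdot t$ is a continuous global flow on $\Omega$. Minimality of $\Omega$ means that every $\sigma_{\hat f}$-orbit is dense in $\Omega$. Put $\mathfrak f(\omega,x):=\omega(0,x)$, and let $t\mapsto v(t;\omega,x)$ be the maximal solution of $dz/dt=\mathfrak f(\omega\cdot t,z)=\omega(t,z)$ with $v(0;\omega,x)=x$. The (possibly local) continuous skewproduct flow is $\pi(t;\omega,x):=(\omega\cdot t,v(t;\omega,x))$, defined on an open set $\mathcal O_\pi\subseteq\mathbb R\times\Omega\times\mathbb R^n$; write $\pi_t(\mathcal C):=\{\pi(t;\omega,x):(\omega,x)\in\mathcal C,\ (t,\omega,x)\in\mathcal O_\pi\}$. A set $\mathcal C\subseteq\Omega\times\mathbb R^n$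 is $\pi$-invariant if $\mathbb R\times\mathcal C\subseteq\mathcal O_\pi$ and $\pi_t(\mathcal C)=\mathcal C$ for all $t\in\mathbb R$. Distances: in a metric space $Y$, $\operatorname{dist}_Y(y,\mathcal C)=\inf_{c\in\mathcal C}d_Y(y,c)$ and $\operatorname{dist}_Y(\mathcal C_1,\mathcal C_2)=\sup_{y\in\mathcal C_1}\operatorname{dist}_Y(y,\mathcal C_2)$ (Hausdorff semidistance). On $\Omega\times\mathbb R^n$ use $\max(d_\Omega(\omega_1,\omega_2),|x_1-x_2|)$. $\mathcal P_c(\mathbb R^n)$ is the set of nonempty compact subsets of $\mathbb R^n$ with the Hausdorff distance. $\bar{\mathcal B}_\mu(\mathcal C)$ is the closure of $\mathcal B_\mu(\mathcal C)=\{y:\operatorname{dist}(y,\mathcal C)<\mu\}$. Local attractor: a nonempty compact $\pi$-invariant set $\mathcal A\subset\Omega\times\mathbb R^n$ for which there is $\mu>0$ with $[0,\infty)\times\bar{\mathcal B}_\mu(\mathcal A)\subseteq\mathcal O_\pi$ and $\lim_{t\to\infty}\operatorname{dist}_{\Omega\times\mathbb R^n}(\pi_t(\bar{\mathcal B}_\mu(\mathcal A)),\mathcal A)=0$. Its fibers are $\mathcal A_\omega:=\{x:(\omega,x)\in\mathcal A\}$ and its projection is $\Omega_{\mathcal A}:=\{\omega\in\Omega:\mathcal A_\omega\ne\emptyset\}$. Basin of attraction: an open set $\mathcal U\subseteq\Omega\times\mathbb R^n$ is an attraction open set for $\mathcal A$ if $[0,\infty)\times\mathcal U\subset\mathcal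 O_\pi$ and $\lim_{t\to\infty}\operatorname{dist}_{\Omega\times\mathbb R^n}(\pi_t(\mathcal K),\mathcal A)=0$ for every compact $\mathcal K\subset\mathcal U$. The basin of attraction $\mathcal U_{\mathcal A}$ is the union of all attraction open sets for $\mathcal A$. A set $\mathcal S\subseteq\Omega$ has complete measure if $m(\mathcal S)=1$ for every $\sigma_{\hat f}$-invariant (complete regular Borel) normalized measure $m$ on $\Omega$. A set $\mathcal C\subseteq[0,\infty)$ is relatively dense if there is $d_{\mathcal C}>0$ with $\mathcal C\cap[b,b+d_{\mathcal C}]\neq\emptyset$ for all $b\ge0$; its lower density is $d_l(\mathcal C):=\liminf_{t\to\infty}\frac1t\int_0^t\chi_{\mathcal C}(s)\,ds$, with $\chi_{\mathcal C}$ the characteristic function of $\mathcal C$. *)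

theory Defs
  imports "HOL-Probability.Probability"
begin

subsection \<open>Moduli of continuity and subsets of the half-line\<close>

definition modulus_of_continuity :: "(real \<Rightarrow> ennreal) \<Rightarrow> bool" where
  "modulus_of_continuity \<theta> \<longleftrightarrow> mono_on {0..} \<theta> \<and> (\<theta> \<longlongrightarrow> 0) (at_right 0)"

definition relatively_dense :: "real set \<Rightarrow> bool" where
  "relatively_dense C \<longleftrightarrow> (\<exists>d>0. \<forall>b\<ge>0. C \<inter> {b..b + d} \<noteq> {})"

text \<open>For a set that is not Lebesgue measurable the integrals vanish for all large \<open>t\<close> by
  convention, so a set with positive lower density is automatically measurable.\<close>

definition lower_density :: "real set \<Rightarrow> ereal" where
  "lower_density C = Liminf at_top (\<lambda>t. ereal (1 / t * integral {0..t} (indicator C :: real \<Rightarrow> real)))"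


subsection \<open>Distances between points and sets\<close>

text \<open>With values in \<^typ>\<open>ennreal\<close>, so that the supremum over the empty set is \<open>0\<close> and
  suprema over unbounded sets are infinite.\<close>

definition pt_dist :: "('a \<Rightarrow> 'a \<Rightarrow> real) \<Rightarrow> 'a \<Rightarrow> 'a set \<Rightarrow> ennreal" where
  "pt_dist d y C = (INF c\<in>C. ennreal (d y c))"

definition semidist :: "('a \<Rightarrow> 'a \<Rightarrow> real) \<Rightarrow> 'a set \<Rightarrow> 'a set \<Rightarrow> ennreal" where
  "semidist d C1 C2 = (SUP y\<in>C1. pt_dist d y C2)"

definition hausdorff_dist :: "('a \<Rightarrow> 'a \<Rightarrow> real) \<Rightarrow> 'a set \<Rightarrow> 'a set \<Rightarrow> ennreal" where
  "hausdorff_dist d C1 C2 = max (semidist d C1 C2) (semidist d C2 C1)"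

definition max_dist :: "('a \<Rightarrow> 'a \<Rightarrow> real) \<Rightarrow> 'a \<times> 'b::metric_space \<Rightarrow> 'a \<times> 'b \<Rightarrow> real" where
  "max_dist d p q = max (d (fst p) (fst q)) (dist (snd p) (snd q))"


subsection \<open>Maximal solutions of ordinary differential equations\<close>

text \<open>\<open>u\<close> solves \<open>dx/dt = F(t,x)\<close>, \<open>u(t0) = x0\<close>, on the interval \<open>I\<close>. The set \<open>J\<close> contains the times
  at which the right-hand side is defined.\<close>

definition ivp_solution ::
  "real set \<Rightarrow> (real \<Rightarrow> 'a \<Rightarrow> 'a) \<Rightarrow> real \<Rightarrow> 'a \<Rightarrow> real set \<Rightarrow> (real \<Rightarrow> 'a::real_normed_vector) \<Rightarrow> bool" where
  "ivp_solution J F t0 x0 I u \<longleftrightarrow>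
     is_interval I \<and> I \<subseteq> J \<and> t0 \<in> I \<and> u t0 = x0 \<and>
     (\<forall>t\<in>I. (u has_vector_derivative F t (u t)) (at t within I))"

definition maximal_solution ::
  "real set \<Rightarrow> (real \<Rightarrow> 'a \<Rightarrow> 'a) \<Rightarrow> real \<Rightarrow> 'a \<Rightarrow> real set \<Rightarrow> (real \<Rightarrow> 'a::real_normed_vector) \<Rightarrow> bool" where
  "maximal_solution J F t0 x0 I u \<longleftrightarrow>
     ivp_solution J F t0 x0 I u \<and>
     (\<forall>I' v. ivp_solution J F t0 x0 I' v \<and> I \<subseteq> I' \<and> (\<forall>t\<in>I. v t = u t) \<longrightarrow> I' = I)"

text \<open>For right-hand sides that are continuous and locally Lipschitz in the state, the interval of
  definition, and the values on it, do not depend on the choice made here.\<close>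

definition max_sol_pair ::
  "real set \<Rightarrow> (real \<Rightarrow> 'a \<Rightarrow> 'a) \<Rightarrow> real \<Rightarrow> 'a \<Rightarrow> real set \<times> (real \<Rightarrow> 'a::real_normed_vector)" where
  "max_sol_pair J F t0 x0 = (SOME p. maximal_solution J F t0 x0 (fst p) (snd p))"

definition sol_dom ::
  "real set \<Rightarrow> (real \<Rightarrow> 'a \<Rightarrow> 'a) \<Rightarrow> real \<Rightarrow> 'a::real_normed_vector \<Rightarrow> real set" where
  "sol_dom J F t0 x0 = fst (max_sol_pair J F t0 x0)"

definition sol ::
  "real set \<Rightarrow> (real \<Rightarrow> 'a \<Rightarrow> 'a) \<Rightarrow> real \<Rightarrow> 'a::real_normed_vector \<Rightarrow> real \<Rightarrow> 'a" where
  "sol J F t0 x0 = snd (max_sol_pair J F t0 x0)"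

text \<open>The right-hand side \<open>f(t/\<epsilon>,t,x)\<close> only makes sense for \<open>t \<ge> 0\<close>.\<close>

definition eps_dom ::
  "(real \<Rightarrow> real \<Rightarrow> 'a \<Rightarrow> 'a) \<Rightarrow> real \<Rightarrow> real \<Rightarrow> 'a::real_normed_vector \<Rightarrow> real set" where
  "eps_dom f \<epsilon> t0 x0 = sol_dom {0..} (\<lambda>t x. f (t / \<epsilon>) t x) t0 x0"

definition eps_sol ::
  "(real \<Rightarrow> real \<Rightarrow> 'a \<Rightarrow> 'a) \<Rightarrow> real \<Rightarrow> real \<Rightarrow> real \<Rightarrow> 'a::real_normed_vector \<Rightarrow> 'a" where
  "eps_sol f \<epsilon> t t0 x0 = sol {0..} (\<lambda>t x. f (t / \<epsilon>) t x) t0 x0 t"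


subsection \<open>The hull and its shift flow\<close>

definition compact_open_topology :: "('a::topological_space \<Rightarrow> 'b::topological_space) topology" where
  "compact_open_topology = topology_generated_by
     {{h. continuous_on UNIV h \<and> h ` K \<subseteq> U} | K U. compact K \<and> open U}"

type_synonym 'n vfield = "real \<times> (real ^ 'n) \<Rightarrow> real ^ 'n"

definition vf_shift :: "'n::finite vfield \<Rightarrow> real \<Rightarrow> 'n vfield" where
  "vf_shift h s = (\<lambda>(t, x). h (t + s, x))"

definition vf_hull :: "'n::finite vfield \<Rightarrow> 'n vfield set" where
  "vf_hull h = compact_open_topology closure_of (range (vf_shift h))"

definition hull_topology :: "'n::finite vfield \<Rightarrow> 'n vfield topology" where
  "hull_topology h = subtopology compact_open_topology (vf_hull h)"

definition minimal_hull :: "'n::finite vfield \<Rightarrow> bool" where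
  "minimal_hull h \<longleftrightarrow> (\<forall>\<omega>\<in>vf_hull h. hull_topology h closure_of (range (vf_shift \<omega>)) = vf_hull h)"

text \<open>The \<open>\<sigma>\<close>-algebra of \<open>m\<close> contains the Borel sets; as \<open>m\<close> is complete and regular it is then the
  completion of the Borel \<open>\<sigma>\<close>-algebra.\<close>

definition invariant_hull_measure :: "'n::finite vfield \<Rightarrow> 'n vfield measure \<Rightarrow> bool" where
  "invariant_hull_measure h m \<longleftrightarrow>
     prob_space m \<and> complete_measure m \<and> space m = vf_hull h \<and>
     (\<forall>U. openin (hull_topology h) U \<longrightarrow> U \<in> sets m) \<and>
     (\<forall>B\<in>sets m.
        emeasure m B = (INF U\<in>{U. openin (hull_topology h) U \<and> B \<subseteq> U}. emeasure m U) \<and>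
        emeasure m B = (SUP K\<in>{K. compactin (hull_topology h) K \<and> K \<subseteq> B}. emeasure m K)) \<and>
     (\<forall>t. \<forall>B\<in>sets m. (\<lambda>\<omega>. vf_shift \<omega> t) ` B \<in> sets m \<and>
        emeasure m ((\<lambda>\<omega>. vf_shift \<omega> t) ` B) = emeasure m B)"

definition complete_measure_set :: "'n::finite vfield \<Rightarrow> 'n vfield set \<Rightarrow> bool" where
  "complete_measure_set h S \<longleftrightarrow>
     (\<forall>m. invariant_hull_measure h m \<longrightarrow> S \<in> sets m \<and> emeasure m S = 1)"


subsection \<open>The skewproduct flow, attractors and their basins\<close>

definition skew_domain :: "'n::finite vfield \<Rightarrow> (real \<times> 'n vfield \<times> (real ^ 'n)) set" where
  "skew_domain h =
     {(t, \<omega>, x). \<omega> \<in> vf_hull h \<and> t \<in> sol_dom UNIV (\<lambda>s z. \<omega> (s, z)) 0 x}"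

definition skew_flow :: "real \<Rightarrow> 'n::finite vfield \<times> (real ^ 'n) \<Rightarrow> 'n vfield \<times> (real ^ 'n)" where
  "skew_flow t = (\<lambda>(\<omega>, x). (vf_shift \<omega> t, sol UNIV (\<lambda>s z. \<omega> (s, z)) 0 x t))"

definition skew_image ::
  "'n::finite vfield \<Rightarrow> real \<Rightarrow> ('n vfield \<times> (real ^ 'n)) set \<Rightarrow> ('n vfield \<times> (real ^ 'n)) set" where
  "skew_image h t C = {skew_flow t p | p. p \<in> C \<and> (t, p) \<in> skew_domain h}"

definition skew_invariant :: "'n::finite vfield \<Rightarrow> ('n vfield \<times> (real ^ 'n)) set \<Rightarrow> bool" where
  "skew_invariant h C \<longleftrightarrow> UNIV \<times> C \<subseteq> skew_domain h \<and> (\<forall>t. skew_image h t C = C)"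

definition skew_topology :: "'n::finite vfield \<Rightarrow> ('n vfield \<times> (real ^ 'n)) topology" where
  "skew_topology h = prod_topology (hull_topology h) euclidean"

text \<open>In the following, \<open>d\<close> is the distance on the hull.\<close>

definition skew_cball ::
  "'n::finite vfield \<Rightarrow> ('n vfield \<Rightarrow> 'n vfield \<Rightarrow> real) \<Rightarrow> real \<Rightarrow>
   ('n vfield \<times> (real ^ 'n)) set \<Rightarrow> ('n vfield \<times> (real ^ 'n)) set" where
  "skew_cball h d \<mu> C =
     skew_topology h closure_of {y \<in> vf_hull h \<times> UNIV. pt_dist (max_dist d) y C < ennreal \<mu>}"

definition local_attractor ::
  "'n::finite vfield \<Rightarrow> ('n vfield \<Rightarrow> 'n vfield \<Rightarrow> real) \<Rightarrow> ('n vfield \<times> (real ^ 'n)) set \<Rightarrow> bool" where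
  "local_attractor h d A \<longleftrightarrow>
     A \<noteq> {} \<and> compactin (skew_topology h) A \<and> skew_invariant h A \<and>
     (\<exists>\<mu>>0. {0..} \<times> skew_cball h d \<mu> A \<subseteq> skew_domain h \<and>
        ((\<lambda>t. semidist (max_dist d) (skew_image h t (skew_cball h d \<mu> A)) A) \<longlongrightarrow> 0) at_top)"

definition attraction_open_set ::
  "'n::finite vfield \<Rightarrow> ('n vfield \<Rightarrow> 'n vfield \<Rightarrow> real) \<Rightarrow> ('n vfield \<times> (real ^ 'n)) set \<Rightarrow>
   ('n vfield \<times> (real ^ 'n)) set \<Rightarrow> bool" where
  "attraction_open_set h d A U \<longleftrightarrow>
     openin (skew_topology h) U \<and> {0..} \<times> U \<subseteq> skew_domain h \<and>
     (\<forall>K. compactin (skew_topology h) K \<and> K \<subseteq> U \<longrightarrow>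
        ((\<lambda>t. semidist (max_dist d) (skew_image h t K) A) \<longlongrightarrow> 0) at_top)"

definition basin ::
  "'n::finite vfield \<Rightarrow> ('n vfield \<Rightarrow> 'n vfield \<Rightarrow> real) \<Rightarrow> ('n vfield \<times> (real ^ 'n)) set \<Rightarrow>
   ('n vfield \<times> (real ^ 'n)) set" where
  "basin h d A = \<Union>{U. attraction_open_set h d A U}"

definition fiber :: "('w \<times> 'x) set \<Rightarrow> 'w \<Rightarrow> 'x set" where
  "fiber A \<omega> = {x. (\<omega>, x) \<in> A}"

definition base_projection ::
  "'n::finite vfield \<Rightarrow> ('n vfield \<times> (real ^ 'n)) set \<Rightarrow> 'n vfield set" where
  "base_projection h A = {\<omega> \<in> vf_hull h. fiber A \<omega> \<noteq> {}}"

definition fiber_continuity_points ::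
  "'n::finite vfield \<Rightarrow> ('n vfield \<Rightarrow> 'n vfield \<Rightarrow> real) \<Rightarrow> ('n vfield \<times> (real ^ 'n)) set \<Rightarrow>
   'n vfield set" where
  "fiber_continuity_points h d A =
     {\<omega>0 \<in> vf_hull h. \<forall>e>0. \<exists>\<delta>>0. \<forall>\<omega>\<in>vf_hull h.
        d \<omega> \<omega>0 < \<delta> \<longrightarrow> hausdorff_dist dist (fiber A \<omega>) (fiber A \<omega>0) < ennreal e}"

end

theory Submission
  imports Defs
begin

text \<open>Condition (d) gives, by freezing the slow variables on a grid, an averaging estimate on time windows of
  fixed length that is uniform in the initial time of the window. As the attractor pulls a whole neighbourhood
  into a smaller one within a fixed time, these estimates can be concatenated without loss: from some time on,
  and for all small \<open>\<epsilon>\<close>, the pair (shifted averaged field, solution) stays within a prescribed distance of the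
  attractor. Passing from this to the fibre over the current base point requires the fibres to vary little
  near that point. For (i) this holds whenever the orbit of the averaged field visits a small ball around a
  continuity point, and minimality makes these visits relatively dense, with positive lower density. For (ii)
  it holds on open sets that increase to a neighbourhood of the set of continuity points. If none of them were
  visited with lower density at least \<open>1 - \<rho>\<close>, a limit of occupation measures of the orbit along suitable times
  would be an invariant measure giving their union mass at most \<open>1 - \<rho>\<close>.\<close>

subsection \<open>Initial value problems\<close>

text \<open>Two obstacles lie between (d) and an estimate for solutions. The fields
  \<open>f (t / \<epsilon>) t\<close> do not converge pointwise, so a perturbation is measured by
  the norm of the integral of the field difference along the averaged solution. And nothing bounds
  the perturbed solution in advance: it is replaced by the global solution of a field truncated
  outside a ball and, once it is known never to leave that ball, identified with the maximal
  solution picked by \<open>SOME\<close>. The distance on the hull is known only through its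
  topology; members of the hull are compared through uniform continuity of evaluations and a common
  modulus. Compactness of the hull comes from \<open>A\<close>, whose compact projection is the
  whole hull. The limit of occupation measures is taken set by set, which preserves only finite
  (sub- and super-) additivity on open sets. A Caratheodory construction restores countable
  additivity and yields the completeness and regularity that \<open>invariant_hull_measure\<close>
  demands. It can only lower the values on open sets, which is the direction required for
  (ii).\<close>

lemma gronwall_integral:
  fixes w :: "real \<Rightarrow> real"
  assumes w: "continuous_on {a..b} w" and L: "0 \<le> L"
    and le: "\<And>t. t \<in> {a..b} \<Longrightarrow> w t \<le> C + L * integral {a..t} w"
    and t: "t \<in> {a..b}"
  shows "w t \<le> C * exp (L * (t - a))"
proof -
  \<comment> \<open>\<open>W\<close> dominates \<open>w\<close> and has derivative
    \<open>L * w\<close>, at most \<open>L * W\<close>; the integrating factor therefore gives a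
    nonincreasing \<open>V\<close> with \<open>V a = C\<close>.\<close>
  define W where "W t = C + L * integral {a..t} w" for t
  define V where "V t = W t * exp (- (L * (t - a)))" for t
  have dW: "(W has_real_derivative L * w s) (at s within {a..b})" if "s \<in> {a..b}" for s
    unfolding W_def
    using DERIV_add[OF DERIV_const[of C] DERIV_cmult[OF integral_has_real_derivative[OF w that], of L]]
    by simp
  have dV: "(V has_real_derivative (L * w s - L * W s) * exp (- (L * (s - a)))) (at s within {a..b})"
    if "s \<in> {a..b}" for s
    unfolding V_def
    by (rule derivative_eq_intros dW[OF that] refl | simp add: algebra_simps)+
  have "V t \<le> V a"
  proof (rule DERIV_nonpos_imp_decreasing_open[of a t V])
    show "a \<le> t" using t by simp
    show "continuous_on {a..t} V"
      using t by (intro continuous_on_subset[OF DERIV_continuous_on[OF dV]]) auto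
    fix s assume s: "a < s" "s < t"
    then have sab: "s \<in> {a..b}" using t by auto
    have "at s within {a..b} = at s"
      using s t by (intro at_within_Icc_at) auto
    then have "(V has_real_derivative (L * w s - L * W s) * exp (- (L * (s - a)))) (at s)"
      using dV[OF sab] by simp
    moreover have "(L * w s - L * W s) * exp (- (L * (s - a))) \<le> 0"
      using le[OF sab] L unfolding W_def by (intro mult_nonpos_nonneg) (auto intro: mult_left_mono)
    ultimately show "\<exists>y. DERIV V s :> y \<and> y \<le> 0" by blast
  qed
  then have "W t * exp (- (L * (t - a))) \<le> C" by (simp add: V_def W_def)
  then have "W t * exp (- (L * (t - a))) * exp (L * (t - a)) \<le> C * exp (L * (t - a))"
    by (rule mult_right_mono) simp
  then have "W t \<le> C * exp (L * (t - a))"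
    by (simp add: mult.assoc flip: exp_add)
  with le[OF t] show ?thesis unfolding W_def by linarith
qed

text \<open>Split \<open>G t (y t) - H t (z t)\<close> at \<open>G t (z t)\<close> and leave the
  first part to Gronwall. The second enters through the norm of its integral, not the integral of
  its norm: oscillating fields cancel over time without being close at any instant.\<close>

lemma ode_perturbation:
  fixes y z :: "real \<Rightarrow> 'a::euclidean_space"
  assumes y: "\<And>t. t \<in> {a..b} \<Longrightarrow> (y has_vector_derivative G t (y t)) (at t within {a..b})"
    and z: "\<And>t. t \<in> {a..b} \<Longrightarrow> (z has_vector_derivative H t (z t)) (at t within {a..b})"
    and int: "(\<lambda>s. G s (z s) - H s (z s)) integrable_on {a..b}"
    and lip: "\<And>t. t \<in> {a..b} \<Longrightarrow> norm (G t (y t) - G t (z t)) \<le> L * norm (y t - z t)"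
    and c: "\<And>t. t \<in> {a..b} \<Longrightarrow> norm (integral {a..t} (\<lambda>s. G s (z s) - H s (z s))) \<le> c"
    and L: "0 \<le> L" and t: "t \<in> {a..b}"
  shows "norm (y t - z t) \<le> (norm (y a - z a) + c) * exp (L * (t - a))"
proof (rule gronwall_integral[OF _ L _ t])
  have cy: "continuous_on {a..b} y" and cz: "continuous_on {a..b} z"
    by (rule continuous_on_vector_derivative, erule y, rule continuous_on_vector_derivative, erule z)
  show cw: "continuous_on {a..b} (\<lambda>t. norm (y t - z t))"
    by (intro continuous_intros cy cz)
  fix t assume t: "t \<in> {a..b}"
  then have sub: "{a..t} \<subseteq> {a..b}" by auto
  let ?D = "\<lambda>s. G s (z s) - H s (z s)"
  have "((\<lambda>s. G s (y s)) has_integral (y t - y a)) {a..t}"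
    by (rule fundamental_theorem_of_calculus)
       (use t sub in \<open>auto intro!: has_vector_derivative_within_subset[OF y]\<close>)
  moreover have "((\<lambda>s. H s (z s)) has_integral (z t - z a)) {a..t}"
    by (rule fundamental_theorem_of_calculus)
       (use t sub in \<open>auto intro!: has_vector_derivative_within_subset[OF z]\<close>)
  moreover have D: "(?D has_integral integral {a..t} ?D) {a..t}"
    using integrable_on_subinterval[OF int sub] by (rule integrable_integral)
  ultimately have *: "((\<lambda>s. G s (y s) - H s (z s) - ?D s) has_integral
      (y t - y a - (z t - z a) - integral {a..t} ?D)) {a..t}"
    by (intro has_integral_diff)
  have **: "((\<lambda>s. G s (y s) - G s (z s)) has_integral
      (y t - y a - (z t - z a) - integral {a..t} ?D)) {a..t}"
    using * by (simp add: algebra_simps)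
  have iw: "(\<lambda>s. L * norm (y s - z s)) integrable_on {a..t}"
    by (intro integrable_continuous_real continuous_intros continuous_on_subset[OF cy sub]
        continuous_on_subset[OF cz sub])
  have "norm (integral {a..t} (\<lambda>s. G s (y s) - G s (z s))) \<le> integral {a..t} (\<lambda>s. L * norm (y s - z s))"
    by (rule integral_norm_bound_integral) (use ** iw lip sub in auto)
  then have "norm (y t - y a - (z t - z a) - integral {a..t} ?D) \<le> L * integral {a..t} (\<lambda>s. norm (y s - z s))"
    using ** by (simp add: integral_unique)
  moreover have "norm (y t - z t) \<le> norm (y t - y a - (z t - z a) - integral {a..t} ?D)
      + norm (y a - z a) + norm (integral {a..t} ?D)"
  proof -
    have "y t - z t = (y t - y a - (z t - z a) - integral {a..t} ?D) + (y a - z a) + integral {a..t} ?D"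
      by simp
    then have "norm (y t - z t) = norm ((y t - y a - (z t - z a) - integral {a..t} ?D) + (y a - z a) + integral {a..t} ?D)"
      by (rule arg_cong)
    also have "\<dots> \<le> norm (y t - y a - (z t - z a) - integral {a..t} ?D) + norm (y a - z a) + norm (integral {a..t} ?D)"
      by (intro norm_triangle_le add_right_mono norm_triangle_ineq)
    finally show ?thesis .
  qed
  ultimately show "norm (y t - z t) \<le> norm (y a - z a) + c + L * integral {a..t} (\<lambda>s. norm (y s - z s))"
    using c[OF t] by linarith
qed

text \<open>For Lipschitz constants that are only local: up to the first time \<open>u\<close> at
  which the distance equals 1 the Lipschitz bound is available, and \<open>ode_perturbation\<close>
  then puts the distance at \<open>u\<close> below 1.\<close>

lemma ode_perturbation_near:
  fixes y z :: "real \<Rightarrow> 'a::euclidean_space"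
  assumes y: "\<And>t. t \<in> {a..b} \<Longrightarrow> (y has_vector_derivative G t (y t)) (at t within {a..b})"
    and z: "\<And>t. t \<in> {a..b} \<Longrightarrow> (z has_vector_derivative H t (z t)) (at t within {a..b})"
    and int: "(\<lambda>s. G s (z s) - H s (z s)) integrable_on {a..b}"
    and lip: "\<And>t. t \<in> {a..b} \<Longrightarrow> norm (y t - z t) \<le> 1 \<Longrightarrow>
      norm (G t (y t) - G t (z t)) \<le> L * norm (y t - z t)"
    and c: "\<And>t. t \<in> {a..b} \<Longrightarrow> norm (integral {a..t} (\<lambda>s. G s (z s) - H s (z s))) \<le> c"
    and L: "0 \<le> L" and small: "(norm (y a - z a) + c) * exp (L * (b - a)) < 1"
    and t: "t \<in> {a..b}"
  shows "norm (y t - z t) < 1"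
proof (rule ccontr)
  let ?w = "\<lambda>t. norm (y t - z t)"
  assume "\<not> ?w t < 1"
  then have wt: "1 \<le> ?w t" by simp
  have ab: "a \<le> b" using t by auto
  have c0: "0 \<le> c" using c[of a] ab by simp
  have wa: "?w a < 1"
  proof -
    have "?w a * 1 \<le> (?w a + c) * exp (L * (b - a))"
      using c0 L ab by (intro mult_mono) auto
    with small show ?thesis by simp
  qed
  have cw: "continuous_on {a..b} ?w"
    by (intro continuous_intros; rule continuous_on_vector_derivative, erule y z)
  define S where "S = {s \<in> {a..b}. ?w s = 1}"
  have ivt: "\<exists>s. a \<le> s \<and> s \<le> u \<and> s \<in> S" if "u \<in> {a..b}" "1 \<le> ?w u" for u
    using IVT'[of ?w a 1 u] that wa continuous_on_subset[OF cw, of "{a..u}"]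
    unfolding S_def by fastforce
  have "S \<noteq> {}" using ivt[OF t wt] by auto
  moreover have "compact S"
  proof -
    have "closed S" unfolding S_def
      by (rule continuous_closed_preimage_constant[OF cw]) simp
    moreover have "bounded S" unfolding S_def by (rule bounded_subset[OF bounded_closed_interval[of a b]]) auto
    ultimately show ?thesis by (simp add: compact_eq_bounded_closed)
  qed
  ultimately obtain u where u: "u \<in> S" "\<And>s. s \<in> S \<Longrightarrow> u \<le> s"
    using compact_attains_inf by metis
  have uab: "u \<in> {a..b}" and wu: "?w u = 1" using u unfolding S_def by auto
  have le1: "?w s \<le> 1" if "s \<in> {a..u}" for s
    using ivt[of s] u(2) that uab wu by (smt (verit) atLeastAtMost_iff)
  have sub: "{a..u} \<subseteq> {a..b}" using uab by auto
  have "?w u \<le> (?w a + c) * exp (L * (u - a))"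
  proof (rule ode_perturbation[where b = u and G = G and H = H])
    show "(\<lambda>s. G s (z s) - H s (z s)) integrable_on {a..u}"
      using integrable_on_subinterval[OF int sub] .
  qed (use sub le1 uab in \<open>auto intro: has_vector_derivative_within_subset[OF y] has_vector_derivative_within_subset[OF z] intro!: lip c L\<close>)
  also have "\<dots> \<le> (?w a + c) * exp (L * (b - a))"
    using uab L c0 by (intro mult_left_mono) (auto intro: mult_left_mono)
  finally show False using small wu by simp
qed

text \<open>Zorn's lemma on graphs of solutions, where inclusion means extension. The argument
  covers every right-hand side, so the \<open>SOME\<close> in \<open>max_sol_pair\<close> has a
  witness whenever the initial time is admissible.\<close>

lemma ex_maximal_solution:
  assumes "t0 \<in> J"
  shows "\<exists>I u. maximal_solution J F t0 x0 I u"
proof -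
  define gr where "gr = (\<lambda>(I, u). {(t, u t :: 'a) | t. t \<in> (I :: real set)})"
  define \<S> where "\<S> = {gr (I, u) | I u. ivp_solution J F t0 x0 I u}"
  have gr_iff: "(t, x) \<in> gr (I, u) \<longleftrightarrow> t \<in> I \<and> x = u t" for t x I u
    by (auto simp: gr_def)
  have ub: "\<exists>U\<in>\<S>. \<forall>X\<in>C. X \<subseteq> U" if C: "C \<in> chains \<S>" for C
  proof (cases "C = {}")
    case True
    \<comment> \<open>The empty chain also needs an upper bound; on a single point the derivative
      condition is vacuous.\<close>
    have "ivp_solution J F t0 x0 {t0} (\<lambda>_. x0)"
      using assms by (simp add: ivp_solution_def is_interval_1 has_vector_derivative_def has_derivative_within_singleton_iff bounded_linear_scaleR_left)
    then show ?thesis using True unfolding \<S>_def by blast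
  next
    case False
    have Csub: "C \<subseteq> \<S>" and ch: "\<And>X Y. X \<in> C \<Longrightarrow> Y \<in> C \<Longrightarrow> X \<subseteq> Y \<or> Y \<subseteq> X"
      using C by (auto simp: chains_def chain_subset_def)
    obtain X0 where X0: "X0 \<in> C" using False by blast
    define D where "D = fst ` \<Union>C"
    define u where "u t = (SOME x. (t, x) \<in> \<Union>C)" for t
    have elem: "\<exists>I v. X = gr (I, v) \<and> ivp_solution J F t0 x0 I v" if "X \<in> C" for X
      using that Csub unfolding \<S>_def by blast
    have uniq: "x = y" if "(t, x) \<in> \<Union>C" "(t, y) \<in> \<Union>C" for t x y
    proof -
      obtain X Y where "X \<in> C" "(t, x) \<in> X" "Y \<in> C" "(t, y) \<in> Y" using \<open>(t, x) \<in> \<Union>C\<close> \<open>(t, y) \<in> \<Union>C\<close> by blast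
      then obtain Z where "Z \<in> C" "(t, x) \<in> Z" "(t, y) \<in> Z" using ch[of X Y] by blast
      then show ?thesis using elem[of Z] by (auto simp: gr_iff)
    qed
    have u: "u t = x" if "(t, x) \<in> \<Union>C" for t x
      using uniq[OF _ that] someI[of "\<lambda>x. (t, x) \<in> \<Union>C", OF that] unfolding u_def by blast
    \<comment> \<open>Three points, because differentiability at \<open>t\<close> is checked in one
      member of the chain whose interval also reaches to both sides of \<open>t\<close>, as far as
      \<open>D\<close> does.\<close>
    have three: "\<exists>I v. gr (I, v) \<in> C \<and> ivp_solution J F t0 x0 I v \<and> p \<in> I \<and> q \<in> I \<and> r \<in> I"
      if "p \<in> D" "q \<in> D" "r \<in> D" for p q r
    proof -
      obtain X Y Z where XYZ: "X \<in> C" "Y \<in> C" "Z \<in> C" "p \<in> fst ` X" "q \<in> fst ` Y" "r \<in> fst ` Z"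
        using \<open>p \<in> D\<close> \<open>q \<in> D\<close> \<open>r \<in> D\<close> unfolding D_def by blast
      obtain W1 where W1: "W1 \<in> C" "X \<subseteq> W1" "Y \<subseteq> W1" using ch[of X Y] XYZ by blast
      obtain W where W: "W \<in> C" "W1 \<subseteq> W" "Z \<subseteq> W" using ch[of W1 Z] XYZ W1 by blast
      have "p \<in> fst ` W" "q \<in> fst ` W" "r \<in> fst ` W" using W W1 XYZ by blast+
      moreover obtain I v where "W = gr (I, v)" "ivp_solution J F t0 x0 I v" using elem[OF W(1)] by blast
      moreover from this have "fst ` W = I" by (force simp: gr_def)
      ultimately show ?thesis using W(1) by blast
    qed
    have agree: "I \<subseteq> D \<and> (\<forall>t\<in>I. u t = v t)" if "gr (I, v) \<in> C" for I v
    proof -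
      have el: "(t, v t) \<in> \<Union>C" if "t \<in> I" for t
        using \<open>gr (I, v) \<in> C\<close> that gr_iff[of t "v t" I v] by blast
      have "t \<in> D" if "t \<in> I" for t
        unfolding D_def by (rule image_eqI[OF _ el[OF that]]) simp
      then show ?thesis using u[OF el] by blast
    qed
    have intD: "is_interval D"
    proof (subst is_interval_1, intro ballI allI impI)
      fix p q s assume "p \<in> D" "q \<in> D" "p \<le> s \<and> s \<le> q"
      then obtain I v where "gr (I, v) \<in> C" "is_interval I" "p \<in> I" "q \<in> I"
        using three[of p q q] unfolding ivp_solution_def by blast
      then show "s \<in> D" using agree[of I v] \<open>p \<le> s \<and> s \<le> q\<close>
        by (meson is_interval_1 subsetD)
    qed
    have "(u has_vector_derivative F t (u t)) (at t within D)" if tD: "t \<in> D" for t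
    proof -
      \<comment> \<open>\<open>p\<close> and \<open>q\<close> are points of \<open>D\<close> on
        either side of \<open>t\<close>, or \<open>t\<close> itself where \<open>D\<close> ends. A
        member of the chain containing both coincides with \<open>D\<close> on the neighbourhood
        \<open>S\<close> of \<open>t\<close>, so the derivatives within the two sets agree.\<close>
      define p where "p = (if \<exists>s\<in>D. s < t then SOME s. s \<in> D \<and> s < t else t)"
      define q where "q = (if \<exists>s\<in>D. t < s then SOME s. s \<in> D \<and> t < s else t)"
      have p: "p \<in> D \<and> (if \<exists>s\<in>D. s < t then p < t else p = t)"
        unfolding p_def using tD someI_ex[of "\<lambda>s. s \<in> D \<and> s < t"] by auto
      have q: "q \<in> D \<and> (if \<exists>s\<in>D. t < s then t < q else q = t)"
        unfolding q_def using tD someI_ex[of "\<lambda>s. s \<in> D \<and> t < s"] by auto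
      obtain I v where Iv: "gr (I, v) \<in> C" "ivp_solution J F t0 x0 I v" "p \<in> I" "q \<in> I" "t \<in> I"
        using three[of p q t] p q tD by blast
      define S where "S = (if p < t then {p<..} else UNIV) \<inter> (if t < q then {..<q} else UNIV)"
      have SI: "I \<inter> S = D \<inter> S"
      proof
        show "I \<inter> S \<subseteq> D \<inter> S" using agree[OF Iv(1)] by auto
        show "D \<inter> S \<subseteq> I \<inter> S"
        proof
          fix s assume s: "s \<in> D \<inter> S"
          have "is_interval I" using Iv(2) by (simp add: ivp_solution_def)
          moreover have "p \<le> s"
            by (cases "\<exists>s\<in>D. s < t") (use s p in \<open>auto simp: S_def not_less\<close>)
          moreover have "s \<le> q"
            by (cases "\<exists>s\<in>D. t < s") (use s q in \<open>auto simp: S_def not_less\<close>)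
          ultimately have "s \<in> I" using mem_is_interval_1_I Iv(3,4) by blast
          then show "s \<in> I \<inter> S" using s by simp
        qed
      qed
      have at: "at t within D = at t within I"
        by (rule at_within_nhd[where S = S]) (use SI in \<open>auto simp: S_def\<close>)
      have "(v has_vector_derivative F t (v t)) (at t within I)"
        using Iv by (simp add: ivp_solution_def)
      then have "(u has_vector_derivative F t (v t)) (at t within I)"
        by (rule has_vector_derivative_transform[rotated 2]) (use agree[OF Iv(1)] Iv(5) in auto)
      then show ?thesis using at agree[OF Iv(1)] Iv(5) by simp
    qed
    moreover have "D \<subseteq> J \<and> t0 \<in> D \<and> u t0 = x0"
    proof -
      obtain I v where "gr (I, v) \<in> C" "ivp_solution J F t0 x0 I v" using X0 elem by blast
      then have "t0 \<in> D" "u t0 = x0" using agree[of I v] by (auto simp: ivp_solution_def)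
      moreover have "D \<subseteq> J"
        using three unfolding ivp_solution_def by blast
      ultimately show ?thesis by simp
    qed
    ultimately have "ivp_solution J F t0 x0 D u"
      using intD unfolding ivp_solution_def by blast
    then have "gr (D, u) \<in> \<S>" unfolding \<S>_def by blast
    moreover have "\<forall>X\<in>C. X \<subseteq> gr (D, u)"
    proof
      fix X assume "X \<in> C"
      then obtain I v where "X = gr (I, v)" using elem by blast
      then show "X \<subseteq> gr (D, u)" using agree[of I v] \<open>X \<in> C\<close> by (auto simp: gr_def)
    qed
    ultimately show ?thesis by blast
  qed
  obtain M where M: "M \<in> \<S>" "\<And>X. X \<in> \<S> \<Longrightarrow> M \<subseteq> X \<Longrightarrow> X = M"
    using Zorn_Lemma2[of \<S>] ub by metis
  then obtain I u where Iu: "M = gr (I, u)" "ivp_solution J F t0 x0 I u" unfolding \<S>_def by blast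
  have "I' = I" if "ivp_solution J F t0 x0 I' v" "I \<subseteq> I'" "\<forall>t\<in>I. v t = u t" for I' v
  proof -
    have "gr (I', v) \<in> \<S>" using that unfolding \<S>_def by blast
    moreover have "M \<subseteq> gr (I', v)" using that Iu by (auto simp: gr_def)
    ultimately have "gr (I', v) = gr (I, u)" using M(2) Iu(1) by blast
    then have "fst ` gr (I', v) = fst ` gr (I, u)" by simp
    then show ?thesis by (force simp: gr_def image_iff)
  qed
  then show ?thesis using Iu unfolding maximal_solution_def by blast
qed

section \<open>Uniqueness of the chosen maximal solution\<close>

lemma maximal_solution_sol:
  assumes "t0 \<in> J"
  shows "maximal_solution J F t0 x0 (sol_dom J F t0 x0) (sol J F t0 x0)"
proof -
  have "\<exists>p. maximal_solution J F t0 x0 (fst p) (snd p)" using ex_maximal_solution[OF assms] by force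
  from someI_ex[OF this] show ?thesis unfolding sol_dom_def sol_def max_sol_pair_def .
qed

lemma ivp_solution_sol:
  "t0 \<in> J \<Longrightarrow> ivp_solution J F t0 x0 (sol_dom J F t0 x0) (sol J F t0 x0)"
  using maximal_solution_sol by (auto simp: maximal_solution_def)

text \<open>Gronwall identifies \<open>y\<close> with the chosen solution on each compact interval
  of its domain, with the Lipschitz constant of a ball containing both paths. So \<open>y\<close>
  extends the chosen solution, and maximality excludes a proper extension.\<close>

lemma ivp_solution_halfline_unique:
  fixes F :: "real \<Rightarrow> 'a::euclidean_space \<Rightarrow> 'a"
  assumes lip: "\<And>r. \<exists>L\<ge>0. \<forall>t\<ge>0. \<forall>x\<in>cball 0 r. \<forall>y\<in>cball 0 r. norm (F t x - F t y) \<le> L * norm (x - y)"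
    and y: "ivp_solution {0..} F 0 x0 {0..} y"
  shows "sol_dom {0..} F 0 x0 = {0..}" "\<And>t. t \<ge> 0 \<Longrightarrow> sol {0..} F 0 x0 t = y t"
proof -
  define I where "I = sol_dom {0..} F 0 x0"
  define u where "u = sol {0..} F 0 x0"
  have max: "maximal_solution {0..} F 0 x0 I u"
    unfolding I_def u_def by (rule maximal_solution_sol) simp
  then have ivp: "ivp_solution {0..} F 0 x0 I u" by (simp add: maximal_solution_def)
  have agree: "y t = u t" if "t \<in> I" for t
  proof -
    have sub: "{0..t} \<subseteq> I" "t \<ge> 0"
      using ivp that unfolding ivp_solution_def is_interval_1 by auto
    have dy: "(y has_vector_derivative F s (y s)) (at s within {0..t})" if "s \<in> {0..t}" for s
      using y that unfolding ivp_solution_def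
      by (auto intro: has_vector_derivative_within_subset)
    have du: "(u has_vector_derivative F s (u s)) (at s within {0..t})" if "s \<in> {0..t}" for s
      using ivp that sub(1) unfolding ivp_solution_def
      by (meson has_vector_derivative_within_subset subsetD)
    have "compact (y ` {0..t} \<union> u ` {0..t})"
      by (intro compact_Un compact_continuous_image compact_Icc;
          rule continuous_on_vector_derivative, erule dy du)
    then obtain r where r: "y ` {0..t} \<union> u ` {0..t} \<subseteq> cball 0 r"
      using bounded_pos compact_imp_bounded by (metis mem_cball_0 subsetI)
    obtain L where L: "L \<ge> 0" "\<forall>t\<ge>0. \<forall>x\<in>cball 0 r. \<forall>y\<in>cball 0 r. norm (F t x - F t y) \<le> L * norm (x - y)"
      using lip by blast
    have "norm (y t - u t) \<le> (norm (y 0 - u 0) + 0) * exp (L * (t - 0))"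
      by (rule ode_perturbation[where b = t and G = F and H = F]) (use dy du r L \<open>t \<ge> 0\<close> in \<open>auto simp: image_subset_iff\<close>)
    then show ?thesis using y ivp by (simp add: ivp_solution_def)
  qed
  have "I \<subseteq> {0..}" using ivp by (simp add: ivp_solution_def)
  then have "I = {0..}" using max y agree unfolding maximal_solution_def by blast
  then show "sol_dom {0..} F 0 x0 = {0..}" "\<And>t. t \<ge> 0 \<Longrightarrow> sol {0..} F 0 x0 t = y t"
    using agree by (auto simp: I_def u_def)
qed

section \<open>Global solutions of bounded, globally Lipschitz fields\<close>

lemma at_within_atLeast_eq_Icc:
  fixes t :: real
  assumes "0 \<le> t" "t < b"
  shows "at t within {0..} = at t within {0..b}"
  by (rule at_within_nhd[where S = "{..<b}"]) (use assms in auto)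

text \<open>Banach's fixed point theorem in Bielecki's weighted norm: after writing y(t) = exp(K t)
  w(t), the integral operator is a contraction for bounded continuous \<open>w\<close> on the whole
  half-line, so local solutions never have to be continued.\<close>

lemma picard_halfline:
  fixes G :: "real \<Rightarrow> 'a::euclidean_space \<Rightarrow> 'a"
  assumes cont: "continuous_on ({0..} \<times> UNIV) (\<lambda>(t, x). G t x)"
    and bdd: "\<And>t x. 0 \<le> t \<Longrightarrow> norm (G t x) \<le> M"
    and lip: "\<And>t x y. 0 \<le> t \<Longrightarrow> norm (G t x - G t y) \<le> L * norm (x - y)"
    and L: "0 \<le> L"
  shows "\<exists>y. y 0 = x0 \<and> (\<forall>t\<ge>0. (y has_vector_derivative G t (y t)) (at t within {0..}))"
proof -
  \<comment> \<open>\<open>L / K \<le> 1 / 2\<close> becomes the contraction constant;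
    \<open>K \<ge> 1\<close> lets the weight absorb the linear growth of \<open>J\<close>.\<close>
  define K where "K = 2 * L + 1"
  have K: "K \<ge> 1" "0 < K" "L / K \<le> 1 / 2" using L by (auto simp: K_def field_simps)
  define g where "g w s = G s (exp (K * s) *\<^sub>R apply_bcontfun w s)" for w s
  define J where "J w t = integral {0..t} (g w)" for w t
  have M: "0 \<le> M" using bdd[of 0 0] by (meson norm_ge_zero order_refl order_trans)
  have contg: "continuous_on {0..} (g w)" for w
  proof -
    have "continuous_on {0..} (\<lambda>s. (s, exp (K * s) *\<^sub>R apply_bcontfun w s))"
      by (intro continuous_intros continuous_on_subset[OF continuous_on_apply_bcontfun]) auto
    then show ?thesis
      using continuous_on_compose2[OF cont, of "{0..}" "\<lambda>s. (s, exp (K * s) *\<^sub>R apply_bcontfun w s)"]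
      by (auto simp: g_def)
  qed
  have contg': "continuous_on {0..t} (g w)" for w t
    by (rule continuous_on_subset[OF contg]) auto
  have dJ: "(J w has_vector_derivative g w t) (at t within {0..})" if "0 \<le> t" for w t
    using integral_has_vector_derivative[OF contg', of t "t + 1" w] that
    by (simp add: J_def[abs_def] at_within_atLeast_eq_Icc[of t "t + 1"])
  define P where "P w t = exp (- (K * t)) *\<^sub>R (x0 + J w t)" for w t
  \<comment> \<open>The value at 0 is kept for negative times, because \<open>bcontfun\<close>
    consists of functions on the whole real line.\<close>
  have contP: "continuous_on UNIV (\<lambda>t. P w (max 0 t))" for w
  proof -
    have "continuous_on {0..} (J w)"
      by (rule continuous_on_vector_derivative) (use dJ in auto)
    then have "continuous_on UNIV (\<lambda>t. J w (max 0 t))"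
      by (rule continuous_on_compose2) (auto intro!: continuous_intros)
    then show ?thesis unfolding P_def by (intro continuous_intros)
  qed
  have normP: "norm (P w t) \<le> norm x0 + M" if "0 \<le> t" for w t
  proof -
    have "norm (J w t) \<le> M * (t - 0)"
      unfolding J_def using that bdd contg' by (intro integral_bound) (auto simp: g_def)
    then have "norm (x0 + J w t) \<le> norm x0 + M * t" by (intro norm_triangle_le) auto
    then have "norm (P w t) \<le> exp (- (K * t)) * (norm x0 + M * t)"
      by (simp add: P_def)
    also have "\<dots> = exp (- (K * t)) * norm x0 + M * (t * exp (- (K * t)))" by (simp add: algebra_simps)
    also have "\<dots> \<le> 1 * norm x0 + M * 1"
    proof (intro add_mono mult_right_mono mult_left_mono M)
      show "exp (- (K * t)) \<le> 1" using K that by simp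
      have "1 * t \<le> K * t" using K that by (intro mult_right_mono) auto
      then have "t \<le> exp (K * t)" using exp_ge_add_one_self[of "K * t"] by linarith
      then show "t * exp (- (K * t)) \<le> 1" by (simp add: exp_minus field_simps)
    qed simp
    finally show ?thesis by simp
  qed
  define \<Phi> where "\<Phi> w = Bcontfun (\<lambda>t. P w (max 0 t))" for w
  have \<Phi>: "apply_bcontfun (\<Phi> w) t = P w (max 0 t)" for w t
  proof -
    have "(\<lambda>t. P w (max 0 t)) \<in> bcontfun"
      using contP normP by (auto intro!: bcontfun_normI[where b = "norm x0 + M"])
    then show ?thesis by (simp add: \<Phi>_def Bcontfun_inverse)
  qed
  have contr: "dist (\<Phi> w1) (\<Phi> w2) \<le> 1 / 2 * dist w1 w2" for w1 w2
  proof (rule dist_bound)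
    fix t0 :: real
    define t where "t = max 0 t0"
    have t: "0 \<le> t" by (simp add: t_def)
    let ?D = "dist w1 w2"
    have hi: "((\<lambda>s. L * ?D * exp (K * s)) has_integral (L * ?D * exp (K * t) / K - L * ?D * exp (K * 0) / K)) {0..t}"
      by (rule fundamental_theorem_of_calculus[OF t])
         (use K in \<open>auto intro!: derivative_eq_intros simp flip: has_real_derivative_iff_has_vector_derivative\<close>)
    have "norm (integral {0..t} (\<lambda>s. g w1 s - g w2 s)) \<le> integral {0..t} (\<lambda>s. L * ?D * exp (K * s))"
    proof (rule integral_norm_bound_integral)
      show "(\<lambda>s. g w1 s - g w2 s) integrable_on {0..t}"
        by (intro integrable_continuous_real continuous_intros contg')
      show "(\<lambda>s. L * ?D * exp (K * s)) integrable_on {0..t}" using hi by blast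
      fix s assume s: "s \<in> {0..t}"
      then have "norm (g w1 s - g w2 s) \<le> L * (exp (K * s) * norm (apply_bcontfun w1 s - apply_bcontfun w2 s))"
        using lip[of s "exp (K * s) *\<^sub>R apply_bcontfun w1 s" "exp (K * s) *\<^sub>R apply_bcontfun w2 s"]
        by (simp add: g_def flip: scaleR_diff_right)
      also have "\<dots> \<le> L * (exp (K * s) * ?D)"
        using dist_bounded[of w1 s w2] L by (intro mult_left_mono) (auto simp: dist_norm)
      finally show "norm (g w1 s - g w2 s) \<le> L * ?D * exp (K * s)" by (simp add: mult_ac)
    qed
    moreover have "integral {0..t} (\<lambda>s. g w1 s - g w2 s) = J w1 t - J w2 t"
      unfolding J_def by (intro integral_diff integrable_continuous_real contg')
    ultimately have "norm (J w1 t - J w2 t) \<le> L * ?D * exp (K * t) / K - L * ?D / K"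
      unfolding integral_unique[OF hi] by simp
    also have "\<dots> \<le> L * ?D * exp (K * t) / K" using L K by simp
    also have "\<dots> = (L / K) * ?D * exp (K * t)" by simp
    also have "\<dots> \<le> 1 / 2 * ?D * exp (K * t)" using K by (intro mult_right_mono) auto
    finally have "exp (- (K * t)) * norm (J w1 t - J w2 t) \<le> exp (- (K * t)) * (1 / 2 * ?D * exp (K * t))"
      by (intro mult_left_mono) auto
    also have "\<dots> = 1 / 2 * ?D" by (simp add: exp_minus field_simps)
    finally show "dist (apply_bcontfun (\<Phi> w1) t0) (apply_bcontfun (\<Phi> w2) t0) \<le> 1 / 2 * ?D"
      by (simp add: \<Phi> P_def t_def[symmetric] dist_norm flip: scaleR_diff_right)
  qed
  have "\<exists>!w. \<Phi> w = w"
    by (rule banach_fix_type[where c = "1/2"]) (use contr in auto)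
  then obtain w where w: "\<Phi> w = w" by blast
  define y where "y t = exp (K * t) *\<^sub>R apply_bcontfun w t" for t
  have y: "y t = x0 + J w t" if "0 \<le> t" for t
    using \<Phi>[of w t] that unfolding w y_def by (simp add: P_def flip: exp_add)
  have "(y has_vector_derivative G t (y t)) (at t within {0..})" if "0 \<le> t" for t
  proof -
    have "((\<lambda>t. x0 + J w t) has_vector_derivative g w t) (at t within {0..})"
      using has_vector_derivative_add[OF has_vector_derivative_const dJ[OF that]] by simp
    then have "(y has_vector_derivative g w t) (at t within {0..})"
      by (rule has_vector_derivative_transform[rotated 2]) (use y that in auto)
    then show ?thesis by (simp add: g_def y_def)
  qed
  moreover have "y 0 = x0" using y[of 0] by (simp add: J_def)
  ultimately show ?thesis by blast
qed

subsection \<open>Averaging on windows of fixed length\<close>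

locale averaging =
  fixes f :: "real \<Rightarrow> real \<Rightarrow> 'a::euclidean_space \<Rightarrow> 'a" and fhat :: "real \<times> 'a \<Rightarrow> 'a"
  assumes f_cont: "r > 0 \<Longrightarrow>
      continuous_on ({0..} \<times> UNIV \<times> cball 0 r) (\<lambda>(\<tau>, t, x). f \<tau> t x)"
    and f_bdd: "r > 0 \<Longrightarrow>
      bounded ((\<lambda>(\<tau>, t, x). f \<tau> t x) ` ({0..} \<times> UNIV \<times> cball 0 r))"
    and f_modulus: "r > 0 \<Longrightarrow> \<exists>\<theta> L. modulus_of_continuity \<theta> \<and> L > 0 \<and>
      (\<forall>\<tau>\<ge>0. \<forall>t1 t2. \<forall>x1\<in>cball 0 r. \<forall>x2\<in>cball 0 r.
         ennreal (norm (f \<tau> t1 x1 - f \<tau> t2 x2))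
           \<le> \<theta> \<bar>t1 - t2\<bar> + ennreal (L * norm (x1 - x2)))"
    and f_average: "r > 0 \<Longrightarrow>
      uniform_limit ({0..} \<times> UNIV \<times> cball 0 r)
        (\<lambda>T (\<tau>, t, x). (1 / T) *\<^sub>R integral {\<tau>..T + \<tau>} (\<lambda>s. f s t x))
        (\<lambda>(\<tau>, t, x). fhat (t, x)) at_top"
begin

text \<open>If every \<open>e > 0\<close> admits such an \<open>h\<close>, then \<open>g\<close> has
  a uniform modulus in time and Lipschitz constant \<open>L\<close> in the state. Being a non-strict
  inequality between two values, the condition survives time averages, shifts and limits, and so
  passes from \<open>f\<close> to \<open>fhat\<close> and on to the hull.\<close>

definition equimod :: "real \<Rightarrow> real \<Rightarrow> real \<Rightarrow> real \<Rightarrow> (real \<times> 'a \<Rightarrow> 'a) \<Rightarrow> bool" where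
  "equimod r L e h g \<longleftrightarrow> (\<forall>t1 t2. \<forall>x1\<in>cball 0 r. \<forall>x2\<in>cball 0 r. \<bar>t1 - t2\<bar> \<le> h \<longrightarrow>
     norm (g (t1, x1) - g (t2, x2)) \<le> e + L * norm (x1 - x2))"

lemma ex_equimod:
  assumes "r > 0"
  shows "\<exists>L>0. \<forall>e>0. \<exists>h>0. \<forall>\<tau>\<ge>0. equimod r L e h (\<lambda>(t, x). f \<tau> t x)"
proof -
  obtain \<theta> L where \<theta>: "modulus_of_continuity \<theta>" and L: "L > 0"
    and le: "\<forall>\<tau>\<ge>0. \<forall>t1 t2. \<forall>x1\<in>cball 0 r. \<forall>x2\<in>cball 0 r.
         ennreal (norm (f \<tau> t1 x1 - f \<tau> t2 x2)) \<le> \<theta> \<bar>t1 - t2\<bar> + ennreal (L * norm (x1 - x2))"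
    using f_modulus[OF assms] by blast
  have "\<exists>h>0. \<forall>\<tau>\<ge>0. equimod r L e h (\<lambda>(t, x). f \<tau> t x)" if e: "e > 0" for e
  proof -
    have "eventually (\<lambda>s. \<theta> s < ennreal e) (at_right 0)"
      using \<theta> e unfolding modulus_of_continuity_def by (auto intro: order_tendstoD)
    then obtain b where b: "b > 0" "\<And>s. 0 < s \<Longrightarrow> s < b \<Longrightarrow> \<theta> s < ennreal e"
      by (auto simp: eventually_at_right_field)
    \<comment> \<open>\<open>\<theta>\<close> is known to be below \<open>e\<close> only strictly
      between 0 and \<open>b\<close>. Monotonicity carries the bound at \<open>b / 2\<close> down to
      all smaller distances, including 0, about which the right limit says nothing.\<close>
    have "equimod r L e (b / 2) (\<lambda>(t, x). f \<tau> t x)" if "\<tau> \<ge> 0" for \<tau>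
      unfolding equimod_def
    proof (intro allI ballI impI)
      fix t1 t2 :: real and x1 x2 :: 'a
      assume x: "x1 \<in> cball 0 r" "x2 \<in> cball 0 r" and t: "\<bar>t1 - t2\<bar> \<le> b / 2"
      have "\<theta> \<bar>t1 - t2\<bar> \<le> \<theta> (b / 2)"
        using \<theta> t b(1) unfolding modulus_of_continuity_def by (intro mono_onD[of "{0..}" \<theta>]) auto
      also have "\<dots> \<le> ennreal e" using b(1) b(2)[of "b / 2"] by (intro less_imp_le) simp
      finally have "ennreal (norm (f \<tau> t1 x1 - f \<tau> t2 x2)) \<le> ennreal e + ennreal (L * norm (x1 - x2))"
        using le that x by (meson add_right_mono order_trans)
      also have "\<dots> = ennreal (e + L * norm (x1 - x2))" using e L by (intro ennreal_plus[symmetric]) auto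
      finally show "norm ((case (t1, x1) of (t, x) \<Rightarrow> f \<tau> t x) - (case (t2, x2) of (t, x) \<Rightarrow> f \<tau> t x))
          \<le> e + L * norm (x1 - x2)"
        using e L by (subst (asm) ennreal_le_iff) (auto intro!: add_nonneg_nonneg)
    qed
    then show ?thesis using b(1) by (intro exI[of _ "b / 2"]) auto
  qed
  then show ?thesis using L by blast
qed

text \<open>One constant for all \<open>e\<close>; the same one will serve \<open>fhat\<close>, the
  truncated fields and every member of the hull.\<close>

definition Lf :: "real \<Rightarrow> real" where
  "Lf r = (SOME L. L > 0 \<and> (\<forall>e>0. \<exists>h>0. \<forall>\<tau>\<ge>0. equimod r L e h (\<lambda>(t, x). f \<tau> t x)))"

lemma Lf:
  assumes "r > 0"
  shows "Lf r > 0" "e > 0 \<Longrightarrow> \<exists>h>0. \<forall>\<tau>\<ge>0. equimod r (Lf r) e h (\<lambda>(t, x). f \<tau> t x)"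
  using someI_ex[of "\<lambda>L. L > 0 \<and> (\<forall>e>0. \<exists>h>0. \<forall>\<tau>\<ge>0. equimod r L e h (\<lambda>(t, x). f \<tau> t x))"]
    ex_equimod[OF assms] unfolding Lf_def by (blast, blast)

lemma f_bound:
  assumes "r > 0"
  shows "\<exists>M>0. \<forall>\<tau>\<ge>0. \<forall>t. \<forall>x\<in>cball 0 r. norm (f \<tau> t x) \<le> M"
  using f_bdd[OF assms] unfolding bounded_pos by (force simp: image_iff)

lemma equimod_lipschitz:
  assumes "\<And>e. e > 0 \<Longrightarrow> \<exists>h>0. equimod r L e h g" "x \<in> cball 0 r" "y \<in> cball 0 r"
  shows "norm (g (t, x) - g (t, y)) \<le> L * norm (x - y)"
proof (rule field_le_epsilon)
  fix e :: real assume "e > 0"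
  then obtain h where "h > 0" "equimod r L e h g" using assms(1) by blast
  then show "norm (g (t, x) - g (t, y)) \<le> L * norm (x - y) + e"
    using assms(2,3) unfolding equimod_def by (auto simp: add.commute)
qed

lemma f_lipschitz:
  assumes "r > 0" "\<tau> \<ge> 0" "x \<in> cball 0 r" "y \<in> cball 0 r"
  shows "norm (f \<tau> t x - f \<tau> t y) \<le> Lf r * norm (x - y)"
  using equimod_lipschitz[of r "Lf r" "\<lambda>(t, x). f \<tau> t x" x y t] Lf(2)[OF assms(1)] assms by fastforce

lemma fhat_average:
  "((\<lambda>T. (1 / T) *\<^sub>R integral {0..T} (\<lambda>s. f s t x)) \<longlongrightarrow> fhat (t, x)) at_top"
proof -
  have "norm x + 1 > 0" by (simp add: add_nonneg_pos)
  from tendsto_uniform_limitI[OF f_average[OF this], of "(0, t, x)"] show ?thesis by simp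
qed

lemma continuous_on_f:
  assumes "r > 0" "continuous_on S a" "continuous_on S b" "continuous_on S c"
    "\<And>s. s \<in> S \<Longrightarrow> 0 \<le> a s \<and> c s \<in> cball 0 r"
  shows "continuous_on S (\<lambda>s. f (a s) (b s) (c s))"
proof -
  have "continuous_on S (\<lambda>s. (a s, b s, c s))" by (intro continuous_intros assms)
  from continuous_on_compose2[OF f_cont[OF assms(1)] this] show ?thesis
    using assms(5) by (simp add: image_subset_iff)
qed

lemma fhat_equimod:
  assumes r: "r > 0" and e: "e > 0" and h: "h > 0"
    and f: "\<And>\<tau>. \<tau> \<ge> 0 \<Longrightarrow> equimod r (Lf r) e h (\<lambda>(t, x). f \<tau> t x)"
  shows "equimod r (Lf r) e h fhat"
  unfolding equimod_def
proof (intro allI ballI impI)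
  fix t1 t2 :: real and x1 x2 :: 'a
  assume x: "x1 \<in> cball 0 r" "x2 \<in> cball 0 r" and t: "\<bar>t1 - t2\<bar> \<le> h"
  let ?B = "e + Lf r * norm (x1 - x2)"
  let ?A = "\<lambda>T t x. (1 / T) *\<^sub>R integral {0..T} (\<lambda>s. f s t x)"
  have c: "continuous_on {0..T} (\<lambda>s. f s t x)" if "x \<in> cball 0 r" for T t x
    by (rule continuous_on_f[OF r]) (use that in \<open>auto intro: continuous_intros\<close>)
  have "norm (?A T t1 x1 - ?A T t2 x2) \<le> ?B" if T: "T > 0" for T
  proof -
    have "norm (integral {0..T} (\<lambda>s. f s t1 x1 - f s t2 x2)) \<le> ?B * (T - 0)"
      by (rule integral_bound) (use T f x t in \<open>auto intro!: continuous_intros c simp: equimod_def\<close>)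
    then have "norm ((1 / T) *\<^sub>R integral {0..T} (\<lambda>s. f s t1 x1 - f s t2 x2)) \<le> ?B"
      using T by (simp add: field_simps)
    moreover have "integral {0..T} (\<lambda>s. f s t1 x1 - f s t2 x2)
        = integral {0..T} (\<lambda>s. f s t1 x1) - integral {0..T} (\<lambda>s. f s t2 x2)"
      by (intro integral_diff integrable_continuous_real c x)
    ultimately show ?thesis by (simp add: scaleR_diff_right)
  qed
  then have "eventually (\<lambda>T. norm (?A T t1 x1 - ?A T t2 x2) \<le> ?B) at_top"
    by (intro eventually_mono[OF eventually_gt_at_top[of 0]])
  then show "norm (fhat (t1, x1) - fhat (t2, x2)) \<le> ?B"
    by (rule tendsto_upperbound[OF tendsto_norm[OF tendsto_diff[OF fhat_average fhat_average]]]) simp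
qed

lemma fhat_bound:
  assumes r: "r > 0" and M: "\<forall>\<tau>\<ge>0. \<forall>t. \<forall>x\<in>cball 0 r. norm (f \<tau> t x) \<le> M"
    and x: "x \<in> cball 0 r"
  shows "norm (fhat (t, x)) \<le> M"
proof -
  have "norm ((1 / T) *\<^sub>R integral {0..T} (\<lambda>s. f s t x)) \<le> M" if T: "T > 0" for T
  proof -
    have "norm (integral {0..T} (\<lambda>s. f s t x)) \<le> M * (T - 0)"
      by (rule integral_bound)
        (use T M x in \<open>auto intro!: continuous_on_f[OF r] continuous_intros\<close>)
    then show ?thesis using T by (simp add: field_simps)
  qed
  then have "eventually (\<lambda>T. norm ((1 / T) *\<^sub>R integral {0..T} (\<lambda>s. f s t x)) \<le> M) at_top"
    by (intro eventually_mono[OF eventually_gt_at_top[of 0]])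
  then show ?thesis
    by (rule tendsto_upperbound[OF tendsto_norm[OF fhat_average]]) simp
qed

lemma ex_fhat_equimod:
  "r > 0 \<Longrightarrow> e > 0 \<Longrightarrow> \<exists>h>0. equimod r (Lf r) e h fhat"
  using Lf(2)[of r e] fhat_equimod by blast

lemma equimod_continuous:
  assumes "\<And>r e. r > 0 \<Longrightarrow> e > 0 \<Longrightarrow> \<exists>h>0. equimod r (Lf r) e h g"
  shows "continuous_on UNIV g"
proof (rule continuous_on_iff[THEN iffD2], intro ballI allI impI)
  fix p :: "real \<times> 'a" and e :: real assume e: "e > 0"
  obtain t x where p: "p = (t, x)" by (cases p)
  define r where "r = norm x + 1"
  have r: "r > 0" unfolding r_def by (simp add: add_nonneg_pos)
  obtain h where h: "h > 0" "equimod r (Lf r) (e / 2) h g" using assms[OF r, of "e / 2"] e by auto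
  define \<delta> where "\<delta> = min (min h 1) (e / (2 * Lf r + 2))"
  have L: "Lf r > 0" using Lf r by blast
  have "\<delta> > 0" using h e L by (auto simp: \<delta>_def)
  moreover have "dist (g q) (g p) < e" if "dist q p < \<delta>" for q
  proof -
    obtain s y where q: "q = (s, y)" by (cases q)
    have st: "\<bar>s - t\<bar> < \<delta>" and xy: "norm (y - x) < \<delta>"
      using dist_fst_le[of q p] dist_snd_le[of q p] that by (auto simp: p q dist_norm)
    have "norm y \<le> norm x + norm (y - x)" by (metis norm_triangle_sub)
    then have "y \<in> cball 0 r" "x \<in> cball 0 r" using xy by (auto simp: r_def \<delta>_def)
    then have "norm (g q - g p) \<le> e / 2 + Lf r * norm (y - x)"
      using h(2) st unfolding equimod_def p q \<delta>_def by fastforce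
    also have "\<dots> \<le> e / 2 + Lf r * (e / (2 * Lf r + 2))"
      using xy L by (intro add_left_mono mult_left_mono) (auto simp: \<delta>_def)
    also have "\<dots> < e" using e L by (simp add: field_simps)
    finally show ?thesis by (simp add: dist_norm)
  qed
  ultimately show "\<exists>d>0. \<forall>x'\<in>UNIV. dist x' p < d \<longrightarrow> dist (g x') (g p) < e" by blast
qed

lemma continuous_fhat: "continuous_on UNIV fhat"
  using equimod_continuous ex_fhat_equimod by blast

lemma continuous_on_fhat:
  "continuous_on S b \<Longrightarrow> continuous_on S c \<Longrightarrow> continuous_on S (\<lambda>s. fhat (b s, c s))"
  by (rule continuous_on_compose2[OF continuous_fhat]) (auto intro: continuous_intros)

lemma integral_average_short:
  assumes r: "r > 0" and \<epsilon>: "\<epsilon> > 0" and a: "a \<ge> 0" and h: "h > 0" "h \<le> h'"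
    and mod: "\<And>\<tau>. \<tau> \<ge> 0 \<Longrightarrow> equimod r (Lf r) e h' (\<lambda>(t, x). f \<tau> t x)"
    and mod': "equimod r (Lf r) e h' fhat"
    and z: "continuous_on {a..a + h} z" "\<And>s. s \<in> {a..a + h} \<Longrightarrow> z s \<in> cball 0 r"
      "\<And>s. s \<in> {a..a + h} \<Longrightarrow> norm (z s - z a) \<le> D"
    and avg: "norm ((1 / (h / \<epsilon>)) *\<^sub>R integral {a / \<epsilon>..h / \<epsilon> + a / \<epsilon>} (\<lambda>s. f s a (z a)) - fhat (a, z a)) \<le> \<gamma>"
  shows "norm (integral {a..a + h} (\<lambda>s. f (s / \<epsilon>) s (z s) - fhat (s, z s)))
      \<le> h * (2 * (e + Lf r * D) + \<gamma>)"
proof -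
  have L: "Lf r > 0" using Lf r by blast
  have za: "z a \<in> cball 0 r" using z(2)[of a] h by simp
  have c1: "continuous_on {a..a + h} (\<lambda>s. f (s / \<epsilon>) s (z s))"
    by (rule continuous_on_f[OF r]) (use z a \<epsilon> in \<open>auto intro!: continuous_intros\<close>)
  have c2: "continuous_on {a..a + h} (\<lambda>s. f (s / \<epsilon>) a (z a))"
    by (rule continuous_on_f[OF r]) (use za a \<epsilon> in \<open>auto intro!: continuous_intros\<close>)
  have c3: "continuous_on {a..a + h} (\<lambda>s. fhat (s, z s))"
    by (intro continuous_on_fhat z continuous_intros)
  let ?I1 = "integral {a..a + h} (\<lambda>s. f (s / \<epsilon>) s (z s) - f (s / \<epsilon>) a (z a))"
  let ?I2 = "integral {a..a + h} (\<lambda>s. f (s / \<epsilon>) a (z a))"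
  let ?I3 = "integral {a..a + h} (\<lambda>s. fhat (s, z s) - fhat (a, z a))"
  have LD: "Lf r * norm (z s - z a) \<le> Lf r * D" if "s \<in> {a..a + h}" for s
    using z(3)[OF that] L by simp
  have "norm ?I1 \<le> (e + Lf r * D) * (a + h - a)"
  proof (rule integral_bound)
    fix s assume s: "s \<in> {a..a + h}"
    then have "norm (f (s / \<epsilon>) s (z s) - f (s / \<epsilon>) a (z a)) \<le> e + Lf r * norm (z s - z a)"
      using mod[of "s / \<epsilon>"] z(2)[OF s] za a \<epsilon> h unfolding equimod_def by auto
    then show "norm (f (s / \<epsilon>) s (z s) - f (s / \<epsilon>) a (z a)) \<le> e + Lf r * D"
      using LD[OF s] by linarith
  qed (use h in \<open>auto intro!: continuous_intros c1 c2\<close>)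
  moreover have "norm ?I3 \<le> (e + Lf r * D) * (a + h - a)"
  proof (rule integral_bound)
    fix s assume s: "s \<in> {a..a + h}"
    then have "norm (fhat (s, z s) - fhat (a, z a)) \<le> e + Lf r * norm (z s - z a)"
      using mod' z(2)[OF s] za h unfolding equimod_def by auto
    then show "norm (fhat (s, z s) - fhat (a, z a)) \<le> e + Lf r * D"
      using LD[OF s] by linarith
  qed (use h in \<open>auto intro!: continuous_intros c3\<close>)
  moreover have "norm (?I2 - h *\<^sub>R fhat (a, z a)) \<le> h * \<gamma>"
  proof -
    have "((\<lambda>s. f s a (z a)) has_integral integral {a / \<epsilon>..h / \<epsilon> + a / \<epsilon>} (\<lambda>s. f s a (z a))) (cbox (a / \<epsilon>) (h / \<epsilon> + a / \<epsilon>))"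
      unfolding cbox_interval
      by (intro integrable_integral integrable_continuous_real continuous_on_f[OF r])
        (use za a \<epsilon> in \<open>auto intro!: continuous_intros intro: order_trans[rotated]\<close>)
    from has_integral_affinity[OF this, of "1 / \<epsilon>" 0]
    have "((\<lambda>s. f (s / \<epsilon>) a (z a)) has_integral \<epsilon> *\<^sub>R integral {a / \<epsilon>..h / \<epsilon> + a / \<epsilon>} (\<lambda>s. f s a (z a))) {a..a + h}"
      using \<epsilon> h image_mult_atLeastAtMost[OF \<epsilon>, of "a / \<epsilon>" "h / \<epsilon> + a / \<epsilon>"]
      by (simp add: mult.commute[of _ \<epsilon>] distrib_left add.commute[of h a])
    then have "?I2 = \<epsilon> *\<^sub>R integral {a / \<epsilon>..h / \<epsilon> + a / \<epsilon>} (\<lambda>s. f s a (z a))"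
      by (rule integral_unique)
    also have "\<dots> = h *\<^sub>R ((1 / (h / \<epsilon>)) *\<^sub>R integral {a / \<epsilon>..h / \<epsilon> + a / \<epsilon>} (\<lambda>s. f s a (z a)))"
      using h \<epsilon> by simp
    finally have "?I2 - h *\<^sub>R fhat (a, z a) = h *\<^sub>R ((1 / (h / \<epsilon>)) *\<^sub>R
        integral {a / \<epsilon>..h / \<epsilon> + a / \<epsilon>} (\<lambda>s. f s a (z a)) - fhat (a, z a))"
      by (simp only: scaleR_diff_right)
    then show ?thesis using avg h by simp
  qed
  moreover have eq: "integral {a..a + h} (\<lambda>s. f (s / \<epsilon>) s (z s) - fhat (s, z s))
      = ?I1 + (?I2 - h *\<^sub>R fhat (a, z a)) - ?I3"
  proof -
    have i: "(\<lambda>s. f (s / \<epsilon>) s (z s)) integrable_on {a..a + h}"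
        "(\<lambda>s. f (s / \<epsilon>) a (z a)) integrable_on {a..a + h}" "(\<lambda>s. fhat (s, z s)) integrable_on {a..a + h}"
      using c1 c2 c3 by (auto intro: integrable_continuous_real)
    show ?thesis
      using h by (simp add: integral_diff[OF i(1) i(2)] integral_diff[OF i(1) i(3)]
        integral_diff[OF i(3) integrable_const_ivl] algebra_simps)
  qed
  moreover have "norm (?I1 + (?I2 - h *\<^sub>R fhat (a, z a)) - ?I3)
      \<le> norm ?I1 + norm (?I2 - h *\<^sub>R fhat (a, z a)) + norm ?I3"
    by (intro norm_triangle_le_diff add_right_mono norm_triangle_ineq)
  moreover have "h * (2 * (e + Lf r * D) + \<gamma>)
      = (e + Lf r * D) * (a + h - a) + h * \<gamma> + (e + Lf r * D) * (a + h - a)"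
    by (simp add: algebra_simps)
  ultimately show ?thesis unfolding eq by linarith
qed

text \<open>The threshold depends neither on \<open>a\<close> nor on \<open>z\<close>: a path of
  Lipschitz constant \<open>M\<close> moves by at most \<open>M * h\<close> in a grid cell, and (d)
  is uniform in the initial fast time of the cell. Complete cells contribute in proportion to their
  length, the incomplete last one is bounded without cancellation.\<close>

lemma integral_average_window:
  assumes r: "r > 0" and T: "T > 0" and \<eta>: "\<eta> > 0"
    and M: "M > 0" "\<forall>\<tau>\<ge>0. \<forall>t. \<forall>x\<in>cball 0 r. norm (f \<tau> t x) \<le> M"
  shows "\<exists>\<epsilon>0>0. \<forall>\<epsilon> a z t. 0 < \<epsilon> \<and> \<epsilon> < \<epsilon>0 \<and> 0 \<le> a \<and> continuous_on {a..a + T} z \<and>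
    (\<forall>s\<in>{a..a + T}. z s \<in> cball 0 r) \<and>
    (\<forall>s\<in>{a..a + T}. \<forall>s'\<in>{a..a + T}. norm (z s - z s') \<le> M * \<bar>s - s'\<bar>) \<and> t \<in> {a..a + T} \<longrightarrow>
    norm (integral {a..t} (\<lambda>s. f (s / \<epsilon>) s (z s) - fhat (s, z s))) \<le> \<eta>"
proof -
  define L where "L = Lf r"
  have L: "L > 0" unfolding L_def using Lf r by blast
  \<comment> \<open>Error budget: over time \<open>T\<close> the terms of
    \<open>integral_average_short\<close> with \<open>e\<close>, \<open>h\<close> and
    \<open>\<gamma>\<close> cost at most \<open>\<eta> / 4\<close> each, and so does the incomplete
    cell, through \<open>2 * (h * M)\<close>.\<close>
  define e where "e = \<eta> / (8 * T)"
  have e: "e > 0" using \<eta> T by (simp add: e_def)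
  obtain h' where h': "h' > 0" "\<And>\<tau>. \<tau> \<ge> 0 \<Longrightarrow> equimod r L e h' (\<lambda>(t, x). f \<tau> t x)"
    using Lf(2)[OF r e] unfolding L_def by blast
  have mod': "equimod r L e h' fhat"
    unfolding L_def by (rule fhat_equimod) (use r e h' in \<open>auto simp: L_def\<close>)
  define Q where "Q = L * M * T + M + 1"
  have Q: "Q > 0" "L * M * T \<le> Q" "M \<le> Q" using L M T by (auto simp: Q_def add_nonneg_pos)
  define h where "h = min h' (\<eta> / (8 * Q))"
  have h: "h > 0" "h \<le> h'" using h' \<eta> Q by (auto simp: h_def)
  have hQ: "h * Q \<le> \<eta> / 8" using Q \<eta> by (simp add: h_def min_def field_simps)
  have hLMT: "h * (L * M * T) \<le> \<eta> / 8"
    using mult_left_mono[OF Q(2), of h] h hQ by linarith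
  have hM: "h * M \<le> \<eta> / 8" using mult_left_mono[OF Q(3), of h] h hQ by linarith
  define \<gamma> where "\<gamma> = \<eta> / (4 * T)"
  have \<gamma>: "\<gamma> > 0" using \<eta> T by (simp add: \<gamma>_def)
  from uniform_limitD[OF f_average[OF r] \<gamma>] obtain T0 where
    T0': "\<And>T' p. T' \<ge> T0 \<Longrightarrow> p \<in> {0..} \<times> UNIV \<times> cball 0 r \<Longrightarrow>
      dist (case p of (\<tau>, t, x) \<Rightarrow> (1 / T') *\<^sub>R integral {\<tau>..T' + \<tau>} (\<lambda>s. f s t x))
        (case p of (\<tau>, t, x) \<Rightarrow> fhat (t, x)) < \<gamma>"
    unfolding eventually_at_top_linorder by blast
  have T0: "norm ((1 / T') *\<^sub>R integral {\<tau>..T' + \<tau>} (\<lambda>s. f s t x) - fhat (t, x)) \<le> \<gamma>"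
    if "T' \<ge> T0" "\<tau> \<ge> 0" "x \<in> cball 0 r" for T' \<tau> t x
    using T0'[of T' "(\<tau>, t, x)"] that by (simp add: dist_norm)
  \<comment> \<open>Below this threshold a grid cell has fast length
    \<open>h / \<epsilon> \<ge> T0\<close>; \<open>max T0 1\<close> guards against a nonpositive
    \<open>T0\<close>.\<close>
  define \<epsilon>0 where "\<epsilon>0 = h / max T0 1"
  have "\<epsilon>0 > 0" using h by (simp add: \<epsilon>0_def)
  moreover have "norm (integral {a..t} (\<lambda>s. f (s / \<epsilon>) s (z s) - fhat (s, z s))) \<le> \<eta>"
    if \<epsilon>: "0 < \<epsilon>" "\<epsilon> < \<epsilon>0" and a: "0 \<le> a" and z: "continuous_on {a..a + T} z"
      "\<forall>s\<in>{a..a + T}. z s \<in> cball 0 r"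
      "\<forall>s\<in>{a..a + T}. \<forall>s'\<in>{a..a + T}. norm (z s - z s') \<le> M * \<bar>s - s'\<bar>"
      and t: "t \<in> {a..a + T}" for \<epsilon> a z t
  proof -
    let ?F = "\<lambda>s. f (s / \<epsilon>) s (z s) - fhat (s, z s)"
    have "\<epsilon> * max T0 1 < h" using \<epsilon> by (simp add: \<epsilon>0_def field_simps)
    moreover have "\<epsilon> * T0 \<le> \<epsilon> * max T0 1" using \<epsilon> by (intro mult_left_mono) auto
    ultimately have "\<epsilon> * T0 \<le> h" by linarith
    then have T0h: "T0 \<le> h / \<epsilon>" using \<epsilon> by (simp add: pos_le_divide_eq mult.commute)
    have cF: "continuous_on {a..a + T} ?F"
      by (intro continuous_intros continuous_on_f[OF r] continuous_on_fhat z)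
        (use z a \<epsilon> in \<open>auto intro!: continuous_intros\<close>)
    define c where "c = 2 * (e + L * (M * h)) + \<gamma>"
    have grid: "a + real n * h \<le> a + T \<Longrightarrow> norm (integral {a..a + real n * h} ?F) \<le> real n * h * c" for n
    proof (induction n)
      case (Suc n)
      let ?a = "a + real n * h"
      have le: "a \<le> ?a" "?a + h \<le> a + T" "?a \<le> a + T" using Suc.prems h by (auto simp: algebra_simps)
      have sub: "{?a..?a + h} \<subseteq> {a..a + T}"
        using le(1,2) by (simp only: atLeastatMost_subset_iff) simp
      have "norm (integral {?a..?a + h} ?F) \<le> h * (2 * (e + Lf r * (M * h)) + \<gamma>)"
      proof (rule integral_average_short[OF r \<epsilon>(1) _ h])
        show "0 \<le> ?a" using le a by linarith
        show "equimod r (Lf r) e h' (\<lambda>(t, x). f \<tau> t x)" if "\<tau> \<ge> 0" for \<tau> using h'(2)[OF that] by (simp add: L_def)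
        show "equimod r (Lf r) e h' fhat" using mod' by (simp add: L_def)
        show "continuous_on {?a..?a + h} z" using continuous_on_subset[OF z(1) sub] .
        show "z s \<in> cball 0 r" if "s \<in> {?a..?a + h}" for s using z(2) subsetD[OF sub that] by blast
        show "norm (z s - z ?a) \<le> M * h" if s: "s \<in> {?a..?a + h}" for s
        proof -
          have "s \<in> {a..a + T}" "?a \<in> {a..a + T}" using subsetD[OF sub s] le by simp_all
          then have "norm (z s - z ?a) \<le> M * \<bar>s - ?a\<bar>" using z(3) by blast
          also have "\<dots> \<le> M * h" using s M by (intro mult_left_mono) auto
          finally show ?thesis .
        qed
        show "norm ((1 / (h / \<epsilon>)) *\<^sub>R integral {?a / \<epsilon>..h / \<epsilon> + ?a / \<epsilon>} (\<lambda>s. f s ?a (z ?a)) - fhat (?a, z ?a)) \<le> \<gamma>"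
          by (rule T0[OF T0h]) (use z(2) le a \<epsilon> h in auto)
      qed
      moreover have "integral {a..a + real (Suc n) * h} ?F = integral {a..?a} ?F + integral {?a..?a + h} ?F"
        using le h integrable_continuous_real[OF continuous_on_subset[OF cF, of "{a..?a + h}"]]
          Henstock_Kurzweil_Integration.integral_combine[of a ?a "?a + h" ?F]
        by (simp add: algebra_simps)
      ultimately have "norm (integral {a..a + real (Suc n) * h} ?F) \<le> real n * h * c + h * c"
        using Suc.IH le norm_triangle_ineq[of "integral {a..?a} ?F" "integral {?a..?a + h} ?F"]
        by (simp add: c_def L_def)
      also have "\<dots> = real (Suc n) * h * c" by (simp add: algebra_simps)
      finally show ?case .
    qed simp
    define n where "n = nat \<lfloor>(t - a) / h\<rfloor>"
    have "real n \<le> (t - a) / h" "(t - a) / h < real n + 1"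
      using t h by (auto simp: n_def)
    then have n: "real n * h \<le> t - a" "t - a < real n * h + h" using h by (auto simp: field_simps)
    let ?a = "a + real n * h"
    have "norm (integral {?a..t} ?F) \<le> (2 * M) * (t - ?a)"
    proof (rule integral_bound)
      show "continuous_on {?a..t} ?F"
        by (rule continuous_on_subset[OF cF]) (use n t h in \<open>auto intro: order_trans[rotated]\<close>)
      fix s assume "s \<in> {?a..t}"
      moreover have "0 \<le> real n * h" using h by simp
      ultimately have s: "s \<in> {a..a + T}" "0 \<le> s" using t a by auto
      then have "norm (f (s / \<epsilon>) s (z s)) \<le> M" "norm (fhat (s, z s)) \<le> M"
        using M(2) z(2) fhat_bound[OF r M(2)] \<epsilon> by auto
      then show "norm (?F s) \<le> 2 * M" by (intro order_trans[OF norm_triangle_ineq4]) simp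
    qed (use n in simp)
    also have "\<dots> \<le> (2 * M) * h" using n M by (intro mult_left_mono) auto
    finally have last: "norm (integral {?a..t} ?F) \<le> 2 * (h * M)" by (simp add: mult_ac)
    have "norm (integral {a..?a} ?F) \<le> real n * h * c" using grid[of n] n t by auto
    also have "\<dots> \<le> T * c"
      using n t e L M h \<gamma> by (intro mult_right_mono) (auto simp: c_def intro!: add_nonneg_nonneg)
    also have "\<dots> = \<eta> / 4 + 2 * (h * (L * M * T)) + \<eta> / 4"
      using T by (simp add: c_def e_def \<gamma>_def field_simps)
    finally have "norm (integral {a..?a} ?F) \<le> 3 / 4 * \<eta>" using hLMT by linarith
    moreover have "integral {a..t} ?F = integral {a..?a} ?F + integral {?a..t} ?F"
      using n t h integrable_continuous_real[OF continuous_on_subset[OF cF, of "{a..t}"]]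
        Henstock_Kurzweil_Integration.integral_combine[of a ?a t ?F] by simp
    ultimately show ?thesis
      using last hM norm_triangle_ineq[of "integral {a..?a} ?F" "integral {?a..t} ?F"] by simp
  qed
  ultimately show ?thesis by blast
qed

text \<open>The projection onto the ball is 1-Lipschitz, so this field is bounded and globally
  Lipschitz in the state. Its solutions are global, and they solve the original equation as long as
  they stay in the ball.\<close>

definition trunc :: "real \<Rightarrow> real \<Rightarrow> real \<Rightarrow> 'a \<Rightarrow> 'a" where
  "trunc r \<epsilon> t x = f (t / \<epsilon>) t (closest_point (cball 0 r) x)"

lemma trunc_eq: "r > 0 \<Longrightarrow> x \<in> cball 0 r \<Longrightarrow> trunc r \<epsilon> t x = f (t / \<epsilon>) t x"
  by (simp add: trunc_def closest_point_self)

lemma closest_point_cball: "r > 0 \<Longrightarrow> closest_point (cball 0 r) x \<in> cball 0 r" for x :: 'a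
  by (rule closest_point_in_set) auto

lemma trunc_lipschitz:
  assumes "r > 0" "\<epsilon> > 0" "t \<ge> 0"
  shows "norm (trunc r \<epsilon> t x - trunc r \<epsilon> t y) \<le> Lf r * norm (x - y)"
proof -
  have "norm (trunc r \<epsilon> t x - trunc r \<epsilon> t y)
      \<le> Lf r * norm (closest_point (cball 0 r) x - closest_point (cball 0 r) y)"
    unfolding trunc_def using assms closest_point_cball by (intro f_lipschitz) auto
  also have "\<dots> \<le> Lf r * norm (x - y)"
    using closest_point_lipschitz[of "cball 0 r" x y] assms Lf(1)[of r]
    by (intro mult_left_mono) (auto simp: dist_norm)
  finally show ?thesis .
qed

lemma ex_trunc_solution:
  assumes r: "r > 0" and \<epsilon>: "\<epsilon> > 0"
  shows "\<exists>y. y 0 = x0 \<and> (\<forall>t\<ge>0. (y has_vector_derivative trunc r \<epsilon> t (y t)) (at t within {0..}))"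
proof -
  obtain M where M: "\<forall>\<tau>\<ge>0. \<forall>t. \<forall>x\<in>cball 0 r. norm (f \<tau> t x) \<le> M" using f_bound[OF r] by blast
  show ?thesis
  proof (rule picard_halfline)
    have "continuous_on UNIV (closest_point (cball 0 r :: 'a set))"
      using r by (intro continuous_on_closest_point) auto
    then have "continuous_on ({0..} \<times> UNIV) (\<lambda>p. closest_point (cball 0 r :: 'a set) (snd p))"
      by (rule continuous_on_compose2) (auto intro: continuous_intros)
    then have "continuous_on ({0..} \<times> UNIV) (\<lambda>p. f (fst p / \<epsilon>) (fst p) (closest_point (cball 0 r) (snd p)))"
      using closest_point_cball[OF r] \<epsilon> by (intro continuous_on_f[OF r]) (auto intro!: continuous_intros)
    then show "continuous_on ({0..} \<times> UNIV) (\<lambda>(t, x). trunc r \<epsilon> t x)"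
      by (simp add: trunc_def case_prod_unfold)
    show "norm (trunc r \<epsilon> t x) \<le> M" if "0 \<le> t" for t x
      using M that \<epsilon> closest_point_cball[OF r] by (simp add: trunc_def)
    show "norm (trunc r \<epsilon> t x - trunc r \<epsilon> t y) \<le> Lf r * norm (x - y)" if "0 \<le> t" for t x y
      using trunc_lipschitz[OF r \<epsilon> that] .
    show "0 \<le> Lf r" using Lf(1)[OF r] by simp
  qed
qed

text \<open>Only the averaged solution \<open>z\<close> is confined to the ball, hence has speed at
  most \<open>M\<close>; truncation is what allows \<open>y\<close> to be anywhere. The factor
  \<open>exp (- (Lf r * T))\<close> in \<open>\<eta>\<close> offsets the growth in Gronwall's
  estimate.\<close>

lemma averaging_window:
  assumes r: "r > 0" and T: "T > 0" and \<delta>: "\<delta> > 0"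
  shows "\<exists>\<epsilon>0>0. \<forall>\<epsilon> a y z. 0 < \<epsilon> \<and> \<epsilon> < \<epsilon>0 \<and> 0 \<le> a \<and> y a = z a \<and>
    (\<forall>t\<in>{a..a + T}. z t \<in> cball 0 r \<and> (z has_vector_derivative fhat (t, z t)) (at t within {a..a + T})) \<and>
    (\<forall>t\<in>{a..a + T}. (y has_vector_derivative trunc r \<epsilon> t (y t)) (at t within {a..a + T})) \<longrightarrow>
    (\<forall>t\<in>{a..a + T}. norm (y t - z t) \<le> \<delta>)"
proof -
  obtain M where M: "M > 0" "\<forall>\<tau>\<ge>0. \<forall>t. \<forall>x\<in>cball 0 r. norm (f \<tau> t x) \<le> M" using f_bound[OF r] by blast
  have L: "Lf r > 0" using Lf(1)[OF r] .
  define \<eta> where "\<eta> = \<delta> * exp (- (Lf r * T))"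
  have \<eta>: "\<eta> > 0" using \<delta> by (simp add: \<eta>_def)
  obtain \<epsilon>0 where \<epsilon>0: "\<epsilon>0 > 0" and int0: "\<forall>\<epsilon> a z t. 0 < \<epsilon> \<and> \<epsilon> < \<epsilon>0 \<and> 0 \<le> a \<and> continuous_on {a..a + T} z \<and>
      (\<forall>s\<in>{a..a + T}. z s \<in> cball 0 r) \<and>
      (\<forall>s\<in>{a..a + T}. \<forall>s'\<in>{a..a + T}. norm (z s - z s') \<le> M * \<bar>s - s'\<bar>) \<and> t \<in> {a..a + T} \<longrightarrow>
      norm (integral {a..t} (\<lambda>s. f (s / \<epsilon>) s (z s) - fhat (s, z s))) \<le> \<eta>"
    using integral_average_window[OF r T \<eta> M] by (elim exE conjE)
  \<comment> \<open>The six uses of \<open>conjI\<close> split the premise of \<open>int0\<close>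
    into its seven conjuncts.\<close>
  note int = int0[rule_format, OF conjI, OF _ conjI, OF _ _ conjI, OF _ _ _ conjI, OF _ _ _ _ conjI, OF _ _ _ _ _ conjI]
  have "norm (y t - z t) \<le> \<delta>" if \<epsilon>: "0 < \<epsilon>" "\<epsilon> < \<epsilon>0" and a: "0 \<le> a" and ya: "y a = z a"
    and zr: "\<And>t. t \<in> {a..a + T} \<Longrightarrow> z t \<in> cball 0 r"
    and z: "\<And>t. t \<in> {a..a + T} \<Longrightarrow> (z has_vector_derivative fhat (t, z t)) (at t within {a..a + T})"
    and y: "\<And>t. t \<in> {a..a + T} \<Longrightarrow> (y has_vector_derivative trunc r \<epsilon> t (y t)) (at t within {a..a + T})"
    and t: "t \<in> {a..a + T}" for \<epsilon> a y z t
  proof -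
    have cz: "continuous_on {a..a + T} z" using z by (rule continuous_on_vector_derivative)
    have zlip: "norm (z s - z s') \<le> M * norm (s - s')" if "s \<in> {a..a + T}" "s' \<in> {a..a + T}" for s s'
    proof (rule differentiable_bound[where S = "{a..a + T}" and f' = "\<lambda>t h. h *\<^sub>R fhat (t, z t)"])
      show "(z has_derivative (\<lambda>h. h *\<^sub>R fhat (t, z t))) (at t within {a..a + T})" if "t \<in> {a..a + T}" for t
        using z[OF that] by (simp add: has_vector_derivative_def)
      show "onorm (\<lambda>h. h *\<^sub>R fhat (t, z t)) \<le> M" if "t \<in> {a..a + T}" for t
        using fhat_bound[OF r M(2) zr[OF that]]
        by (simp add: onorm_scaleR_left onorm_id bounded_linear_ident)
    qed (use that in auto)
    have eq: "trunc r \<epsilon> s (z s) = f (s / \<epsilon>) s (z s)" if "s \<in> {a..a + T}" for s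
      using trunc_eq[OF r zr[OF that]] .
    have "norm (y t - z t) \<le> (norm (y a - z a) + \<eta>) * exp (Lf r * (t - a))"
    proof (rule ode_perturbation[where b = "a + T" and G = "trunc r \<epsilon>" and H = "\<lambda>t x. fhat (t, x)"])
      have "continuous_on {a..a + T} (\<lambda>s. f (s / \<epsilon>) s (z s) - fhat (s, z s))"
        by (intro continuous_intros continuous_on_f[OF r] continuous_on_fhat cz)
          (use zr a \<epsilon> in \<open>auto intro!: continuous_intros\<close>)
      then have "(\<lambda>s. f (s / \<epsilon>) s (z s) - fhat (s, z s)) integrable_on {a..a + T}"
        by (rule integrable_continuous_real)
      then show "(\<lambda>s. trunc r \<epsilon> s (z s) - fhat (s, z s)) integrable_on {a..a + T}"
        by (rule integrable_eq) (simp add: eq)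
      show "norm (integral {a..t} (\<lambda>s. trunc r \<epsilon> s (z s) - fhat (s, z s))) \<le> \<eta>" if t: "t \<in> {a..a + T}" for t
      proof -
        have "integral {a..t} (\<lambda>s. trunc r \<epsilon> s (z s) - fhat (s, z s))
            = integral {a..t} (\<lambda>s. f (s / \<epsilon>) s (z s) - fhat (s, z s))"
          by (rule integral_cong) (use t eq in auto)
        moreover have "norm (integral {a..t} (\<lambda>s. f (s / \<epsilon>) s (z s) - fhat (s, z s))) \<le> \<eta>"
          by (rule int[OF \<epsilon> a cz _ _ t]) (use zr zlip in auto)
        ultimately show ?thesis by simp
      qed
      show "norm (trunc r \<epsilon> t (y t) - trunc r \<epsilon> t (z t)) \<le> Lf r * norm (y t - z t)" if "t \<in> {a..a + T}" for t
        using trunc_lipschitz[OF r \<epsilon>(1)] that a by auto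
    qed (use y z t L in auto)
    also have "\<dots> \<le> \<eta> * exp (Lf r * T)"
      using t L \<eta> ya by (simp add: mult_left_mono)
    also have "\<dots> = \<delta>" by (simp add: \<eta>_def flip: exp_add)
    finally show ?thesis .
  qed
  then show ?thesis using \<epsilon>0 by blast
qed

end

subsection \<open>Invariant measures as limits of occupation measures\<close>

text \<open>These are the properties of occupation fractions on open sets that survive a limit taken
  set by set. Continuity from below may be lost, so the measure constructed from \<open>lam\<close>
  can be strictly smaller than \<open>lam\<close> on an open set.\<close>

locale open_content = Metric_space +
  fixes lam :: "'a set \<Rightarrow> real"
  assumes compact: "compact_space mtopology"
    and nonneg: "openin mtopology U \<Longrightarrow> 0 \<le> lam U"
    and mono: "openin mtopology U \<Longrightarrow> openin mtopology V \<Longrightarrow> U \<subseteq> V \<Longrightarrow> lam U \<le> lam V"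
    and subadd: "openin mtopology U \<Longrightarrow> openin mtopology V \<Longrightarrow> lam (U \<union> V) \<le> lam U + lam V"
    and superadd: "openin mtopology U \<Longrightarrow> openin mtopology V \<Longrightarrow> U \<inter> V = {} \<Longrightarrow>
      lam U + lam V \<le> lam (U \<union> V)"
    and total: "lam M = 1"
begin

section \<open>The outer measure of a content on open sets\<close>

definition covers :: "'a set \<Rightarrow> (nat \<Rightarrow> 'a set) set" where
  "covers E = {V. (\<forall>i. openin mtopology (V i)) \<and> E \<subseteq> (\<Union>i. V i)}"

text \<open>Countable covers rather than single open supersets, because \<open>lam\<close> itself
  need not be countably subadditive.\<close>

definition mu :: "'a set \<Rightarrow> ennreal" where
  "mu E = (INF V\<in>covers E. \<Sum>i. ennreal (lam (V i)))"

lemma lam_empty [simp]: "lam {} = 0"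
  using superadd[of "{}" "{}"] nonneg[of "{}"] by simp

lemma openin_M: "openin mtopology M"
  using openin_topspace[of mtopology] by simp

lemma mu_le_cover: "V \<in> covers E \<Longrightarrow> mu E \<le> (\<Sum>i. ennreal (lam (V i)))"
  unfolding mu_def by (rule INF_lower)

lemma mu_le_lam:
  assumes "openin mtopology U" "E \<subseteq> U"
  shows "mu E \<le> ennreal (lam U)"
proof -
  define V where "V i = (if i = 0 then U else {})" for i :: nat
  have "V \<in> covers E" using assms by (auto simp: V_def covers_def)
  moreover have "(\<Sum>i. ennreal (lam (V i))) = (\<Sum>i\<in>{0}. ennreal (lam (V i)))"
    by (rule suminf_finite) (auto simp: V_def)
  ultimately show ?thesis using mu_le_cover[of V E] by (simp add: V_def)
qed

lemma mu_mono: "E \<subseteq> F \<Longrightarrow> mu E \<le> mu F"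
  unfolding mu_def covers_def by (rule INF_superset_mono) auto

lemma mu_empty [simp]: "mu {} = 0"
  using mu_le_lam[of "{}" "{}"] by simp

lemma mu_le_1: "E \<subseteq> M \<Longrightarrow> mu E \<le> 1"
  using mu_le_lam[OF openin_M] total by simp

lemma lam_finite_Union:
  assumes "finite I" "\<And>i. i \<in> I \<Longrightarrow> openin mtopology (V i)"
  shows "lam (\<Union>i\<in>I. V i) \<le> (\<Sum>i\<in>I. lam (V i))"
  using assms
proof (induction I rule: finite_induct)
  case (insert i I)
  have "lam (V i \<union> (\<Union>i\<in>I. V i)) \<le> lam (V i) + lam (\<Union>i\<in>I. V i)"
    using insert by (intro subadd) auto
  then show ?case using insert by simp
qed simp

text \<open>A countable open cover of the compact space has a finite subcover, for which finite
  subadditivity is enough. So passing from \<open>lam\<close> to \<open>mu\<close> loses no total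
  mass.\<close>

lemma mu_M: "mu M = 1"
proof (rule antisym[OF mu_le_1])
  show "1 \<le> mu M"
    unfolding mu_def
  proof (rule INF_greatest)
    fix V assume V: "V \<in> covers M"
    then have op: "openin mtopology (V i)" for i by (simp add: covers_def)
    have MV: "M \<subseteq> \<Union>(range V)" using V by (auto simp: covers_def)
    have "compactin mtopology M" using compact by (simp add: compact_space_def)
    then obtain F where F: "finite F" "F \<subseteq> range V" "M \<subseteq> \<Union>F"
      using MV op unfolding compactin_def by (metis (no_types, lifting) imageE)
    obtain I where I: "finite I" "F = V ` I" using finite_subset_image[OF F(1,2)] by blast
    have "M = (\<Union>i\<in>I. V i)" using F(3) I openin_subset[OF op] by fastforce
    then have "1 \<le> (\<Sum>i\<in>I. lam (V i))" using lam_finite_Union[OF I(1), of V] op total by simp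
    then have "1 \<le> (\<Sum>i\<in>I. ennreal (lam (V i)))"
      using nonneg[OF op] by (simp flip: ennreal_1)
    also have "\<dots> \<le> (\<Sum>i. ennreal (lam (V i)))"
      using I(1) by (intro sum_le_suminf) auto
    finally show "1 \<le> (\<Sum>i. ennreal (lam (V i)))" .
  qed
qed simp

lemma sum_half_ennreal:
  assumes "0 < e"
  shows "(\<Sum>i. ennreal (e * (1 / 2) ^ Suc i)) = ennreal e"
proof (rule suminf_ennreal_eq)
  show "0 \<le> e * (1 / 2) ^ Suc i" for i using assms by (intro mult_nonneg_nonneg zero_le_power) auto
  show "(\<lambda>i. e * (1 / 2) ^ Suc i) sums e"
    using sums_mult[OF power_half_series, of e] by (simp only: mult_1_right)
qed

lemma mu_countable_subadd:
  assumes "\<And>i. A i \<subseteq> M"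
  shows "mu (\<Union>i. A i) \<le> (\<Sum>i. mu (A i))"
proof (rule ennreal_le_epsilon)
  fix e :: real assume e: "0 < e"
  have "\<exists>V\<in>covers (A i). (\<Sum>j. ennreal (lam (V j))) < mu (A i) + ennreal (e * (1 / 2) ^ Suc i)" for i
  proof -
    have "mu (A i) < top" using mu_le_1[OF assms, of i] by (simp add: le_less_trans)
    then have "mu (A i) < mu (A i) + ennreal (e * (1 / 2) ^ Suc i)"
      using e by (cases "mu (A i)") (auto simp: ennreal_less_iff simp flip: ennreal_plus)
    then show ?thesis unfolding mu_def[of "A i"] by (simp add: INF_less_iff)
  qed
  then obtain V where V: "\<And>i. V i \<in> covers (A i)"
    "\<And>i. (\<Sum>j. ennreal (lam (V i j))) < mu (A i) + ennreal (e * (1 / 2) ^ Suc i)" by metis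
  define W where "W k = (case prod_decode k of (i, j) \<Rightarrow> V i j)" for k
  have "W \<in> covers (\<Union>i. A i)"
  proof -
    have "openin mtopology (W k)" for k
      using V(1) by (auto simp: W_def covers_def split: prod.split)
    moreover have "x \<in> (\<Union>k. W k)" if x: "x \<in> A i" for x i
    proof -
      obtain j where "x \<in> V i j" using V(1)[of i] x by (auto simp: covers_def)
      then have "x \<in> W (prod_encode (i, j))" by (simp add: W_def)
      then show ?thesis by blast
    qed
    ultimately show ?thesis unfolding covers_def by blast
  qed
  then have "mu (\<Union>i. A i) \<le> (\<Sum>k. ennreal (lam (W k)))" by (rule mu_le_cover)
  also have "\<dots> = (\<Sum>i. \<Sum>j. ennreal (lam (V i j)))"
    using suminf_ennreal_2dimen[of "\<lambda>i. \<Sum>j. ennreal (lam (V i j))" "\<lambda>(i, j). ennreal (lam (V i j))"]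
    by (simp add: W_def case_prod_unfold)
  also have "\<dots> \<le> (\<Sum>i. mu (A i) + ennreal (e * (1 / 2) ^ Suc i))"
    using V(2) by (intro suminf_le) (auto intro: less_imp_le)
  also have "\<dots> = (\<Sum>i. mu (A i)) + ennreal e"
    using sum_half_ennreal[OF e] by (subst suminf_add[symmetric]) auto
  finally show "mu (\<Union>i. A i) \<le> (\<Sum>i. mu (A i)) + ennreal e" .
qed

lemma mu_Un:
  assumes "A \<subseteq> M" "B \<subseteq> M"
  shows "mu (A \<union> B) \<le> mu A + mu B"
proof -
  define C where "C i = (if i = 0 then A else if i = 1 then B else {})" for i :: nat
  have "(\<Union>i. C i) = A \<union> B"
  proof
    show "A \<union> B \<subseteq> (\<Union>i. C i)" using UN_upper[of 0 UNIV C] UN_upper[of 1 UNIV C] by (simp add: C_def)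
  qed (auto simp: C_def split: if_splits)
  moreover have "(\<Sum>i. mu (C i)) = (\<Sum>i\<in>{0, 1}. mu (C i))"
    by (rule suminf_finite) (auto simp: C_def)
  ultimately show ?thesis using mu_countable_subadd[of C] assms by (simp add: C_def)
qed

text \<open>Demanding a radius \<open>s > r\<close> leaves a margin that makes this set open. It is
  disjoint from \<open>out V r\<close>, while for \<open>r < s\<close> the sets
  \<open>inn V r\<close> and \<open>out V s\<close> together exhaust the space.\<close>

definition inn :: "'a set \<Rightarrow> real \<Rightarrow> 'a set" where
  "inn V r = {x \<in> M. \<exists>s>r. mball x s \<subseteq> V}"

definition out :: "'a set \<Rightarrow> real \<Rightarrow> 'a set" where
  "out V r = (\<Union>v\<in>M - V. mball v r)"

lemma openin_out: "openin mtopology (out V r)"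
  unfolding out_def by blast

lemma openin_inn: "openin mtopology (inn V r)"
  unfolding openin_mtopology
proof (intro conjI allI impI)
  fix x assume "x \<in> inn V r"
  then obtain s where x: "x \<in> M" "s > r" "mball x s \<subseteq> V" by (auto simp: inn_def)
  define s' where "s' = (s + r) / 2"
  have s': "r < s'" "s' < s" using x by (auto simp: s'_def)
  have "y \<in> inn V r" if "y \<in> mball x (s - s')" for y
  proof -
    have "mball y s' \<subseteq> mball x s"
      using that triangle[of x y] by (fastforce simp: in_mball)
    then show ?thesis using that s' x by (auto simp: inn_def)
  qed
  then show "\<exists>\<delta>>0. mball x \<delta> \<subseteq> inn V r" using s' by (intro exI[of _ "s - s'"]) auto
qed (auto simp: inn_def)

lemma inn_subset: "0 \<le> r \<Longrightarrow> inn V r \<subseteq> V"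
  by (auto simp: inn_def)

lemma inn_antimono: "r \<le> r' \<Longrightarrow> inn V r' \<subseteq> inn V r"
  by (auto simp: inn_def intro: le_less_trans)

lemma inn_out_disjoint: "inn V r \<inter> out V r = {}"
proof -
  have False if xv: "x \<in> inn V r" "v \<in> M - V" "x \<in> mball v r" for x v
  proof -
    obtain s where "s > r" "mball x s \<subseteq> V" using xv(1) by (auto simp: inn_def)
    moreover have "v \<in> mball x s" using xv \<open>s > r\<close> by (auto simp: in_mball commute)
    ultimately show False using xv by blast
  qed
  then show ?thesis unfolding out_def by blast
qed

lemma not_inn_out: "x \<in> M \<Longrightarrow> x \<notin> inn V r \<Longrightarrow> r < s \<Longrightarrow> x \<in> out V s"
  by (auto simp: inn_def out_def in_mball commute subset_iff)

text \<open>The part of \<open>V\<close> close to its complement is covered by annuli \<open>inn V (r (n + 2)) \<inter> out V (r n)\<close>,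
  which do not meet \<open>inn V (r n)\<close> and hence are small once \<open>lam (inn V (r n))\<close> is close to its supremum.\<close>

lemma mu_inner:
  assumes V: "openin mtopology V" and e: "e > 0"
  shows "\<exists>r>0. mu V \<le> ennreal (lam (inn V r)) + ennreal e"
proof -
  let ?W = "inn V"
  define g where "g = (SUP r\<in>{0<..}. lam (?W r))"
  have bdd: "bdd_above ((\<lambda>r. lam (?W r)) ` {0<..})"
    using mono[OF openin_inn openin_M] total by (intro bdd_aboveI2[of _ _ 1]) (auto simp: inn_def)
  have le_g: "lam (?W r) \<le> g" if "r > 0" for r
    unfolding g_def using that by (intro cSUP_upper bdd) auto
  have "\<exists>\<rho>>0. g - e * (1 / 2) ^ Suc n < lam (?W \<rho>)" for n
  proof -
    have "g - e * (1 / 2) ^ Suc n < g" using e by simp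
    then show ?thesis unfolding g_def by (subst (asm) less_cSUP_iff[OF _ bdd]) auto
  qed
  then obtain \<rho> where \<rho>: "\<And>n. \<rho> n > 0" "\<And>n. g - e * (1 / 2) ^ Suc n < lam (?W (\<rho> n))" by metis
  \<comment> \<open>The minimum over earlier radii gives \<open>r n \<le> \<rho> n\<close>; the
    divisor makes the sequence strictly decreasing with limit 0.\<close>
  define r where "r n = Min (\<rho> ` {..n}) / (real n + 1)" for n
  have Min: "Min (\<rho> ` {..n}) > 0" for n using \<rho> by (subst Min_gr_iff) auto
  have r_pos: "r n > 0" for n using Min by (simp add: r_def)
  have r_le: "r n \<le> \<rho> n" for n
  proof -
    have "Min (\<rho> ` {..n}) * 1 \<le> Min (\<rho> ` {..n}) * (real n + 1)"
      by (rule mult_left_mono) (use less_imp_le[OF Min[of n]] in \<open>simp_all only: le_add_same_cancel2 of_nat_0_le_iff\<close>)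
    then have "r n \<le> Min (\<rho> ` {..n})" unfolding r_def by (subst pos_divide_le_eq) linarith+
    also have "\<dots> \<le> \<rho> n" by simp
    finally show ?thesis .
  qed
  have r_dec: "r (Suc n) < r n" for n
  proof -
    have "r (Suc n) \<le> Min (\<rho> ` {..n}) / (real (Suc n) + 1)"
      unfolding r_def by (intro divide_right_mono Min_antimono) auto
    also have "\<dots> < r n" unfolding r_def using Min[of n]
      by (intro divide_strict_left_mono mult_pos_pos; linarith)
    finally show ?thesis .
  qed
  have r_lim: "r \<longlonglongrightarrow> 0"
  proof (rule tendsto_sandwich[of "\<lambda>_. 0" _ _ "\<lambda>n. \<rho> 0 / (real n + 1)"])
    show "eventually (\<lambda>n. r n \<le> \<rho> 0 / (real n + 1)) sequentially"
      unfolding r_def by (intro always_eventually allI divide_right_mono) auto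
    show "(\<lambda>n. \<rho> 0 / (real n + 1)) \<longlonglongrightarrow> 0"
      using tendsto_mult_right_zero[OF LIMSEQ_inverse_real_of_nat, of "\<rho> 0"]
      by (simp add: divide_inverse add.commute)
  qed (use r_pos in \<open>auto intro!: always_eventually less_imp_le\<close>)
  define N where "N m = ?W (r (m + 2)) \<inter> out V (r m)" for m
  have opN: "openin mtopology (N m)" for m unfolding N_def by (intro openin_Int openin_inn openin_out)
  have lamN: "lam (N m) \<le> e * (1 / 2) ^ Suc m" for m
  proof -
    have "lam (N m) + lam (?W (r m)) \<le> lam (N m \<union> ?W (r m))"
      using inn_out_disjoint[of V "r m"] by (intro superadd opN openin_inn) (auto simp: N_def)
    also have "\<dots> \<le> lam (?W (r (m + 2)))"
      using inn_antimono[of "r (m + 2)" "r m" V] r_dec[of m] r_dec[of "Suc m"]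
      by (intro mono openin_Un opN openin_inn) (auto simp: N_def)
    also have "\<dots> \<le> g" using le_g r_pos by blast
    also have "g < lam (?W (\<rho> m)) + e * (1 / 2) ^ Suc m" using \<rho>(2)[of m] by linarith
    also have "lam (?W (\<rho> m)) \<le> lam (?W (r m))"
      by (intro mono openin_inn inn_antimono r_le)
    finally show ?thesis by linarith
  qed
  have "V \<subseteq> ?W (r 1) \<union> (\<Union>m. N m)"
  proof
    fix x assume x: "x \<in> V"
    then obtain s where s: "s > 0" "mball x s \<subseteq> V" using V unfolding openin_mtopology by blast
    have xM: "x \<in> M" using x openin_subset[OF V] by auto
    have "eventually (\<lambda>n. r n < s) sequentially" using order_tendstoD(2)[OF r_lim s(1)] .
    then obtain n0 where "r n0 < s" by (auto simp: eventually_sequentially)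
    then have "x \<in> ?W (r n0)" using s xM by (auto simp: inn_def)
    \<comment> \<open>Failing \<open>inn V (r (m + 1))\<close> places \<open>x\<close> in
      \<open>out V (r m)\<close> only because \<open>r (m + 1) < r m\<close>. This lost index is why
      the annuli \<open>N m\<close> span two steps.\<close>
    define n where "n = (LEAST n. x \<in> ?W (r n))"
    have n: "x \<in> ?W (r n)" unfolding n_def using \<open>x \<in> ?W (r n0)\<close> by (rule LeastI)
    show "x \<in> ?W (r 1) \<union> (\<Union>m. N m)"
    proof (cases "n \<le> 1")
      case True
      then have "r 1 \<le> r n" using r_dec[of 0] by (cases n) auto
      then show ?thesis using n inn_antimono by blast
    next
      case False
      then obtain m where m: "n = m + 2" by (metis add.commute le_add_diff_inverse not_less_eq_eq numeral_2_eq_2 One_nat_def)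
      have "x \<notin> ?W (r (Suc m))" using not_less_Least[of "Suc m" "\<lambda>n. x \<in> ?W (r n)"] m unfolding n_def by simp
      then have "x \<in> out V (r m)" using not_inn_out xM r_dec by blast
      then show ?thesis using n m by (auto simp: N_def)
    qed
  qed
  then have "mu V \<le> mu (?W (r 1) \<union> (\<Union>m. N m))" by (rule mu_mono)
  also have "\<dots> \<le> mu (?W (r 1)) + mu (\<Union>m. N m)"
    by (intro mu_Un) (auto simp: inn_def N_def)
  also have "mu (\<Union>m. N m) \<le> (\<Sum>m. mu (N m))"
    by (intro mu_countable_subadd) (auto simp: inn_def N_def)
  also have "\<dots> \<le> (\<Sum>m. ennreal (e * (1 / 2) ^ Suc m))"
    by (intro suminf_le order_trans[OF mu_le_lam[OF opN order_refl]] ennreal_leI lamN) auto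
  also have "\<dots> = ennreal e" using sum_half_ennreal[OF e] .
  also have "mu (?W (r 1)) \<le> ennreal (lam (?W (r 1)))" by (intro mu_le_lam openin_inn) simp
  finally show ?thesis using r_pos[of 1] by (auto intro: add_mono)
qed

text \<open>Superadditivity applies only to disjoint open sets, and \<open>V - U\<close> is in
  general not open. Shrinking \<open>V \<inter> U\<close> slightly to an inner set makes room for an
  open set that is disjoint from it and covers \<open>V - U\<close>; by \<open>mu_inner\<close> the
  shrinking costs at most \<open>e\<close>.\<close>

lemma mu_split_le_lam:
  assumes U: "openin mtopology U" and V: "openin mtopology V"
  shows "mu (V \<inter> U) + mu (V - U) \<le> ennreal (lam V)"
proof (rule ennreal_le_epsilon)
  fix e :: real assume e: "0 < e"
  obtain r where r: "r > 0" "mu (V \<inter> U) \<le> ennreal (lam (inn (V \<inter> U) r)) + ennreal e"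
    using mu_inner[OF openin_Int[OF V U] e] by blast
  let ?W = "inn (V \<inter> U) r" and ?N = "out (V \<inter> U) r \<inter> V"
  have "V - U \<subseteq> ?N"
    using r(1) openin_subset[OF V] by (auto simp: out_def in_mball intro!: bexI)
  then have "mu (V - U) \<le> ennreal (lam ?N)" by (intro mu_le_lam openin_Int openin_out V)
  with r have "mu (V \<inter> U) + mu (V - U) \<le> ennreal (lam ?W) + ennreal e + ennreal (lam ?N)"
    by (intro add_mono)
  also have "\<dots> = ennreal (lam ?W + lam ?N) + ennreal e"
    using nonneg openin_inn openin_out V by (simp add: ennreal_plus openin_Int ac_simps)
  also have "lam ?W + lam ?N \<le> lam (?W \<union> ?N)"
    using inn_out_disjoint[of "V \<inter> U" r] by (intro superadd openin_inn openin_Int openin_out V) auto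
  also have "\<dots> \<le> lam V"
    using inn_subset[of r "V \<inter> U"] r by (intro mono openin_Un openin_inn openin_Int openin_out V) auto
  finally show "mu (V \<inter> U) + mu (V - U) \<le> ennreal (lam V) + ennreal e"
    by (simp add: ennreal_leI add_mono)
qed

abbreviation "L \<equiv> lambda_system M (Pow M) mu"

lemma in_L_iff: "U \<in> L \<longleftrightarrow> U \<subseteq> M \<and> (\<forall>E\<subseteq>M. mu (E \<inter> U) + mu (E - U) \<le> mu E)"
proof -
  interpret sigma_algebra M "Pow M" by (rule sigma_algebra_Pow)
  have "mu E \<le> mu (E \<inter> U) + mu (E - U)" if "E \<subseteq> M" for E U
    using mu_Un[of "E \<inter> U" "E - U"] that by (simp add: Int_Diff_Un le_infI1 Diff_subset subset_trans[of _ E])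
  then show ?thesis unfolding lambda_system_eq by (auto intro: antisym)
qed

text \<open>Apply \<open>mu_split_le_lam\<close> to each member of an open cover of the test set and
  sum.\<close>

lemma open_in_L:
  assumes U: "openin mtopology U"
  shows "U \<in> L"
  unfolding in_L_iff
proof (intro conjI allI impI)
  show "U \<subseteq> M" using openin_subset[OF U] by simp
  fix E assume E: "E \<subseteq> M"
  show "mu (E \<inter> U) + mu (E - U) \<le> mu E"
    unfolding mu_def[of E]
  proof (rule INF_greatest)
    fix V assume "V \<in> covers E"
    then have op: "\<And>i. openin mtopology (V i)" and EV: "E \<subseteq> (\<Union>i. V i)" by (auto simp: covers_def)
    have VM: "V i \<subseteq> M" for i using openin_subset[OF op] by simp
    have "mu (E \<inter> U) \<le> mu (\<Union>i. V i \<inter> U)" using EV by (intro mu_mono) auto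
    also have "\<dots> \<le> (\<Sum>i. mu (V i \<inter> U))" by (intro mu_countable_subadd) (use VM in auto)
    finally have 1: "mu (E \<inter> U) \<le> (\<Sum>i. mu (V i \<inter> U))" .
    have "mu (E - U) \<le> mu (\<Union>i. V i - U)" using EV by (intro mu_mono) auto
    also have "\<dots> \<le> (\<Sum>i. mu (V i - U))" by (intro mu_countable_subadd) (use VM in auto)
    finally have "mu (E \<inter> U) + mu (E - U) \<le> (\<Sum>i. mu (V i \<inter> U)) + (\<Sum>i. mu (V i - U))"
      using 1 by (intro add_mono)
    also have "\<dots> = (\<Sum>i. mu (V i \<inter> U) + mu (V i - U))" by (intro suminf_add) auto
    also have "\<dots> \<le> (\<Sum>i. ennreal (lam (V i)))"
      by (intro suminf_le mu_split_le_lam U op) auto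
    finally show "mu (E \<inter> U) + mu (E - U) \<le> (\<Sum>i. ennreal (lam (V i)))" .
  qed
qed

lemma measure_space_mu: "measure_space M L mu"
proof -
  interpret sigma_algebra M "Pow M" by (rule sigma_algebra_Pow)
  show ?thesis
  proof (rule caratheodory_lemma)
    show "outer_measure_space (Pow M) mu"
      unfolding outer_measure_space_def positive_def increasing_def countably_subadditive_def
      by (auto intro: mu_mono mu_countable_subadd)
  qed
qed

lemma mu_outer_regular:
  "mu B = (INF U\<in>{U. openin mtopology U \<and> B \<subseteq> U}. mu U)"
proof (rule antisym)
  show "mu B \<le> (INF U\<in>{U. openin mtopology U \<and> B \<subseteq> U}. mu U)"
    by (rule INF_greatest) (auto intro: mu_mono)
  show "(INF U\<in>{U. openin mtopology U \<and> B \<subseteq> U}. mu U) \<le> mu B"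
    unfolding mu_def[of B]
  proof (rule INF_greatest)
    fix V assume V: "V \<in> covers B"
    then have "(INF U\<in>{U. openin mtopology U \<and> B \<subseteq> U}. mu U) \<le> mu (\<Union>i. V i)"
      by (intro INF_lower) (auto simp: covers_def)
    also have "\<dots> \<le> (\<Sum>i. ennreal (lam (V i)))"
      using V by (intro mu_le_cover) (auto simp: covers_def)
    finally show "(INF U\<in>{U. openin mtopology U \<and> B \<subseteq> U}. mu U) \<le> (\<Sum>i. ennreal (lam (V i)))" .
  qed
qed

lemma mu_image_le:
  assumes g: "\<And>U. openin mtopology U \<Longrightarrow> openin mtopology (g ` U) \<and> lam (g ` U) = lam U"
  shows "mu (g ` E) \<le> mu E"
  unfolding mu_def[of E]
proof (rule INF_greatest)
  fix V assume V: "V \<in> covers E"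
  then have op: "openin mtopology (V i)" for i by (simp add: covers_def)
  have "g ` E \<subseteq> (\<Union>i. g ` V i)" using V by (auto simp: covers_def image_UN[symmetric])
  then have "(\<lambda>i. g ` V i) \<in> covers (g ` E)" using op g by (auto simp: covers_def)
  from mu_le_cover[OF this] show "mu (g ` E) \<le> (\<Sum>i. ennreal (lam (V i)))" using g[OF op] by simp
qed

text \<open>Taken on the full Caratheodory sigma-algebra rather than on the Borel sets, which makes
  the measure complete.\<close>

definition nu :: "'a measure" where "nu = measure_of M L mu"

lemma sigma_algebra_L: "sigma_algebra M L"
  using measure_space_mu by (simp add: measure_space_def)

lemma space_nu [simp]: "space nu = M"
  unfolding nu_def by (rule space_measure_of) (auto simp: in_L_iff)

lemma sets_nu: "sets nu = L"
  unfolding nu_def using sigma_algebra.sets_measure_of_eq[OF sigma_algebra_L] by simp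

lemma emeasure_nu: "B \<in> L \<Longrightarrow> emeasure nu B = mu B"
  unfolding nu_def using measure_space_mu
  by (intro emeasure_measure_of_sigma) (auto simp: measure_space_def)

lemma prob_space_nu: "prob_space nu"
proof
  have "M \<in> L" using open_in_L[OF openin_M] .
  then show "emeasure nu (space nu) = 1" by (simp add: emeasure_nu mu_M)
qed

lemma complete_measure_nu: "complete_measure nu"
proof
  fix A B assume "B \<subseteq> A" "A \<in> null_sets nu"
  then have "A \<subseteq> M" "mu A = 0" by (auto simp: null_sets_def sets_nu emeasure_nu in_L_iff)
  then have "mu B = 0" using mu_mono[OF \<open>B \<subseteq> A\<close>] by simp
  then have "mu (E \<inter> B) + mu (E - B) \<le> mu E" for E
    using mu_mono[of "E \<inter> B" B] mu_mono[of "E - B" E] by simp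
  then show "B \<in> sets nu" using \<open>A \<subseteq> M\<close> \<open>B \<subseteq> A\<close> by (auto simp: sets_nu in_L_iff)
qed

lemma nu_outer_regular:
  assumes "B \<in> sets nu"
  shows "emeasure nu B = (INF U\<in>{U. openin mtopology U \<and> B \<subseteq> U}. emeasure nu U)"
  using assms mu_outer_regular[of B] open_in_L by (simp add: emeasure_nu sets_nu cong: INF_cong_simp)

text \<open>Outer regularity of the complement: what remains outside an open set is closed, hence
  compact.\<close>

lemma nu_inner_regular:
  assumes B: "B \<in> sets nu"
  shows "emeasure nu B = (SUP K\<in>{K. compactin mtopology K \<and> K \<subseteq> B}. emeasure nu K)"
proof (rule antisym)
  interpret prob_space nu by (rule prob_space_nu)
  have BM: "B \<subseteq> M" using sets.sets_into_space[OF B] by simp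
  show "(SUP K\<in>{K. compactin mtopology K \<and> K \<subseteq> B}. emeasure nu K) \<le> emeasure nu B"
    using B by (auto intro!: SUP_least emeasure_mono)
  show "emeasure nu B \<le> (SUP K\<in>{K. compactin mtopology K \<and> K \<subseteq> B}. emeasure nu K)"
  proof (rule ennreal_le_epsilon)
    fix e :: real assume e: "0 < e"
    have MB: "M - B \<in> sets nu" using sets.compl_sets[OF B] by simp
    have "emeasure nu (M - B) < emeasure nu (M - B) + ennreal e"
      using e by (simp add: emeasure_eq_measure ennreal_less_iff flip: ennreal_plus)
    then obtain U where U: "openin mtopology U" "M - B \<subseteq> U" "emeasure nu U < emeasure nu (M - B) + ennreal e"
      using nu_outer_regular[OF MB] by (auto simp: INF_less_iff)
    have Us: "U \<in> sets nu" using open_in_L[OF U(1)] by (simp add: sets_nu)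
    have "closedin mtopology (M - U)" using U(1) closedin_diff[OF closedin_topspace, of mtopology U] by simp
    then have K: "compactin mtopology (M - U)" using closedin_compact_space[OF compact] by blast
    have "measure nu (M - U) = 1 - measure nu U" "measure nu (M - B) = 1 - measure nu B"
      using prob_compl[OF Us] prob_compl[OF B] by simp_all
    moreover have "measure nu U < measure nu (M - B) + e"
      using U(3) e by (simp add: emeasure_eq_measure ennreal_less_iff flip: ennreal_plus)
    ultimately have "emeasure nu B \<le> emeasure nu (M - U) + ennreal e"
      using e by (simp add: emeasure_eq_measure flip: ennreal_plus)
    also have "emeasure nu (M - U) \<le> (SUP K\<in>{K. compactin mtopology K \<and> K \<subseteq> B}. emeasure nu K)"
      using K U(2) BM by (intro SUP_upper) auto
    finally show "emeasure nu B \<le> (SUP K\<in>{K. compactin mtopology K \<and> K \<subseteq> B}. emeasure nu K) + ennreal e"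
      by (simp add: add_right_mono)
  qed
qed

text \<open>Neither \<open>g\<close> nor its inverse can increase \<open>mu\<close>, so both
  preserve it; measurability of the image follows by pulling test sets back with
  \<open>g'\<close>.\<close>

lemma nu_invariant:
  assumes g: "\<And>U. openin mtopology U \<Longrightarrow> openin mtopology (g ` U) \<and> lam (g ` U) = lam U"
    and g': "\<And>U. openin mtopology U \<Longrightarrow> openin mtopology (g' ` U) \<and> lam (g' ` U) = lam U"
    and inv: "\<And>x. x \<in> M \<Longrightarrow> g x \<in> M \<and> g' (g x) = x" "\<And>x. x \<in> M \<Longrightarrow> g' x \<in> M \<and> g (g' x) = x"
    and B: "B \<in> sets nu"
  shows "g ` B \<in> sets nu \<and> emeasure nu (g ` B) = emeasure nu B"
proof -
  have round: "g' ` g ` E = E" "g ` g' ` E = E" if "E \<subseteq> M" for E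
    using inv that by (force simp: image_iff subset_iff)+
  have eq: "mu (g ` E) = mu E" if "E \<subseteq> M" for E
    using mu_image_le[OF g, of E] mu_image_le[OF g', of "g ` E"] round[OF that] by (intro antisym) auto
  have BM: "B \<subseteq> M" using B by (simp add: sets_nu in_L_iff)
  have "mu (E \<inter> g ` B) + mu (E - g ` B) \<le> mu E" if E: "E \<subseteq> M" for E
  proof -
    define F where "F = g' ` E"
    have F: "F \<subseteq> M" "E = g ` F" using inv E round[OF E] by (auto simp: F_def)
    have inj: "inj_on g M" using inv by (metis inj_onI)
    have "E \<inter> g ` B = g ` (F \<inter> B)" "E - g ` B = g ` (F - B)"
      using inj_on_image_Int[OF inj F(1) BM] inj_on_image_set_diff[OF inj _ BM, of F] F by auto
    moreover have "mu (F \<inter> B) + mu (F - B) \<le> mu F" using B F by (simp add: sets_nu in_L_iff)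
    moreover have "F \<inter> B \<subseteq> M" "F - B \<subseteq> M" using F by auto
    ultimately show ?thesis using F eq[of F] eq[of "F \<inter> B"] eq[of "F - B"] by auto
  qed
  then have "g ` B \<in> L" using BM inv by (auto simp: in_L_iff)
  then show ?thesis using B eq[OF BM] by (simp add: sets_nu emeasure_nu)
qed

end

text \<open>Tychonoff's theorem. The index type may be uncountable, here all subsets of the hull, so
  a convergent subsequence cannot be expected; a proper filter finer than
  \<open>sequentially\<close> takes its place.\<close>

lemma ex_cluster_point:
  fixes \<nu> :: "nat \<Rightarrow> 'i \<Rightarrow> real"
  assumes "\<And>k i. \<nu> k i \<in> {0..1}"
  shows "\<exists>l G. G \<noteq> bot \<and> G \<le> sequentially \<and> (\<forall>i. ((\<lambda>k. \<nu> k i) \<longlongrightarrow> l i) G)"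
proof -
  let ?K = "PiE UNIV (\<lambda>_. {0..1}) :: ('i \<Rightarrow> real) set"
  have "compactin (product_topology (\<lambda>_. euclidean) UNIV) ?K"
    unfolding compactin_PiE by simp
  then have "compact ?K" by (simp add: euclidean_product_topology)
  moreover have "filtermap \<nu> sequentially \<noteq> bot" by (simp add: filtermap_bot_iff)
  moreover have "eventually (\<lambda>x. x \<in> ?K) (filtermap \<nu> sequentially)"
    using assms by (simp add: eventually_filtermap PiE_iff)
  ultimately obtain l where l: "inf (nhds l) (filtermap \<nu> sequentially) \<noteq> bot"
    unfolding compact_filter by blast
  \<comment> \<open>Since \<open>l\<close> is a cluster point, preimages of its neighbourhoods meet
    every tail of the index set, so they generate a proper filter with the tails.\<close>
  define G where "G = inf (filtercomap \<nu> (nhds l)) sequentially"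
  have "G \<noteq> bot"
  proof
    assume "G = bot"
    then have "eventually (\<lambda>_. False) G" by simp
    then obtain P Q where PQ: "eventually P (filtercomap \<nu> (nhds l))" "eventually Q sequentially"
      "\<And>k. P k \<Longrightarrow> Q k \<Longrightarrow> False" unfolding G_def eventually_inf by blast
    obtain P' where P': "eventually P' (nhds l)" "\<And>k. P' (\<nu> k) \<Longrightarrow> P k"
      using PQ(1) unfolding eventually_filtercomap by blast
    have "eventually (\<lambda>x. \<not> P' x) (filtermap \<nu> sequentially)"
      unfolding eventually_filtermap using PQ(2) by (rule eventually_mono) (use P'(2) PQ(3) in blast)
    with P'(1) have "eventually (\<lambda>_. False) (inf (nhds l) (filtermap \<nu> sequentially))"
      unfolding eventually_inf by blast
    with l show False by simp
  qed
  moreover have "((\<lambda>k. \<nu> k i) \<longlongrightarrow> l i) G" for i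
  proof -
    have "filterlim \<nu> (nhds l) G"
      unfolding G_def by (rule filterlim_mono[OF filterlim_filtercomap order_refl inf_le1])
    moreover have "open ((\<lambda>x. x i) -` S)" if "open S" for S :: "real set"
      by (rule open_vimage[OF that continuous_on_product_coordinates])
    ultimately show ?thesis
      by (intro topological_tendstoI) (force simp: filterlim_iff eventually_nhds)
  qed
  ultimately show ?thesis unfolding G_def by (intro exI[of _ l] exI[of _ G]) (auto simp: G_def)
qed

section \<open>Occupation fractions of a path\<close>

definition occ :: "(real \<Rightarrow> 'a) \<Rightarrow> real \<Rightarrow> 'a set \<Rightarrow> real" where
  "occ \<phi> T E = measure lebesgue ({0..T} \<inter> \<phi> -` E) / T"

text \<open>For a nonmeasurable set \<open>measure\<close> is 0 by convention, so the bounds hold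
  for every set and the limit can be taken over all sets at once.\<close>

lemma occ_bounds: "0 < T \<Longrightarrow> occ \<phi> T E \<in> {0..1}"
  for T :: real
proof (cases "{0..T} \<inter> \<phi> -` E \<in> sets lebesgue")
  case True
  assume T: "0 < T"
  have "measure lebesgue ({0..T} \<inter> \<phi> -` E) \<le> measure lebesgue {0..T}"
    by (rule measure_mono_fmeasurable) (use True in auto)
  with T show ?thesis by (simp add: occ_def)
qed (simp add: occ_def measure_notin_sets)

context Metric_space
begin

lemma open_path_vimage:
  assumes "continuous_map euclideanreal mtopology \<phi>" "openin mtopology U"
  shows "open (\<phi> -` U)"
  using openin_continuous_map_preimage[OF assms] by (simp add: vimage_def)

lemma occ_lmeasurable:
  assumes "continuous_map euclideanreal mtopology \<phi>" "openin mtopology U"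
  shows "{a..b} \<inter> \<phi> -` U \<in> lmeasurable"
  by (intro fmeasurable_Int_fmeasurable) (use open_path_vimage[OF assms] in auto)

text \<open>Moving the set along the flow amounts to translating the time window, which changes only
  a piece of length \<bar>t\<bar> at its ends.\<close>

lemma occ_shift:
  assumes \<phi>: "continuous_map euclideanreal mtopology \<phi>" and T: "0 < T"
    and inv: "\<And>t x. x \<in> M \<Longrightarrow> \<sigma> (- t) (\<sigma> t x) = x" "\<And>s t. \<phi> (s + t) = \<sigma> t (\<phi> s)"
    and U: "openin mtopology U" "openin mtopology (\<sigma> t ` U)"
  shows "occ \<phi> T (\<sigma> t ` U) \<le> occ \<phi> T U + \<bar>t\<bar> / T"
proof -
  have UM: "U \<subseteq> M" using openin_subset[OF U(1)] by simp
  let ?A = "{0..T} \<inter> \<phi> -` (\<sigma> t ` U)"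
  \<comment> \<open>At most one of the two extra intervals has positive length, which one depending
    on the sign of \<open>t\<close>; for \<open>t = 0\<close> both are single points.\<close>
  have "(\<lambda>s. s - t) ` ?A \<subseteq> ({0..T} \<inter> \<phi> -` U) \<union> ({-t..0} \<union> {T..T-t})"
  proof
    fix s assume "s \<in> (\<lambda>s. s - t) ` ?A"
    then have s: "s + t \<in> {0..T}" "\<phi> (s + t) \<in> \<sigma> t ` U" by auto
    then obtain u where u: "u \<in> U" "\<phi> (s + t) = \<sigma> t u" by auto
    have "\<phi> s \<in> M" using continuous_map_image_subset_topspace[OF \<phi>] by auto
    then have "\<phi> s = u" using u inv(1)[of u t] inv(1)[of "\<phi> s" t] inv(2)[of s t] UM by auto
    with u s show "s \<in> ({0..T} \<inter> \<phi> -` U) \<union> ({-t..0} \<union> {T..T-t})" by auto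
  qed
  then have "measure lebesgue ((\<lambda>s. s - t) ` ?A) \<le> measure lebesgue (({0..T} \<inter> \<phi> -` U) \<union> ({-t..0} \<union> {T..T-t}))"
    using occ_lmeasurable[OF \<phi> U(2), of 0 T] occ_lmeasurable[OF \<phi> U(1), of 0 T]
      measurable_translation_subtract[of ?A t]
    by (intro measure_mono_fmeasurable) (auto intro!: fmeasurable.Un)
  also have "\<dots> \<le> measure lebesgue ({0..T} \<inter> \<phi> -` U) + measure lebesgue ({-t..0} \<union> {T..T-t})"
    using occ_lmeasurable[OF \<phi> U(1), of 0 T] by (intro measure_Un_le) auto
  also have "measure lebesgue ({-t..0} \<union> {T..T-t}) = \<bar>t\<bar>"
  proof (cases t "0 :: real" rule: linorder_cases)
    case equal
    then have "measure lebesgue ({-t..0} \<union> {T..T-t}) = 0"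
      by (intro negligible_imp_measure0 negligible_finite) simp
    then show ?thesis using equal by simp
  qed auto
  also have "measure lebesgue ((\<lambda>s. s - t) ` ?A) = measure lebesgue ?A"
    by (rule measure_translation_subtract)
  finally show ?thesis using T by (simp add: occ_def field_simps)
qed

text \<open>The last clause is the portmanteau inequality for open sets. It is phrased through
  eventual bounds along \<open>T\<close>, because convergence holds only along a finer filter that
  is hidden from the conclusion; an eventual bound passes to any such filter.\<close>

theorem krylov_bogoliubov:
  assumes compact: "compact_space mtopology"
    and \<phi>: "continuous_map euclideanreal mtopology \<phi>"
    and \<sigma>: "\<And>t. continuous_map mtopology mtopology (\<sigma> t)"
    and inv: "\<And>t x. x \<in> M \<Longrightarrow> \<sigma> (- t) (\<sigma> t x) = x" "\<And>s t. \<phi> (s + t) = \<sigma> t (\<phi> s)"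
    and T: "\<And>k. 0 < T k" "filterlim T at_top sequentially"
  shows "\<exists>m. prob_space m \<and> complete_measure m \<and> space m = M \<and>
    (\<forall>U. openin mtopology U \<longrightarrow> U \<in> sets m) \<and>
    (\<forall>B\<in>sets m. emeasure m B = (INF U\<in>{U. openin mtopology U \<and> B \<subseteq> U}. emeasure m U) \<and>
        emeasure m B = (SUP K\<in>{K. compactin mtopology K \<and> K \<subseteq> B}. emeasure m K)) \<and>
    (\<forall>t. \<forall>B\<in>sets m. \<sigma> t ` B \<in> sets m \<and> emeasure m (\<sigma> t ` B) = emeasure m B) \<and>
    (\<forall>U c. openin mtopology U \<longrightarrow> eventually (\<lambda>k. occ \<phi> (T k) U \<le> c) sequentially \<longrightarrow>
        emeasure m U \<le> ennreal c)"
proof -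
  obtain lam G where G: "G \<noteq> bot" "G \<le> sequentially" and
    lim: "\<And>E. ((\<lambda>k. occ \<phi> (T k) E) \<longlongrightarrow> lam E) G"
    using ex_cluster_point[of "\<lambda>k. occ \<phi> (T k)"] occ_bounds[OF T(1)] by blast
  note meas = occ_lmeasurable[OF \<phi>] open_path_vimage[OF \<phi>]
  have \<phi>M: "\<phi> s \<in> M" for s using continuous_map_image_subset_topspace[OF \<phi>] by auto
  interpret C: open_content M d lam
  proof
    fix U V assume U: "openin mtopology U" and V: "openin mtopology V"
    show "lam U \<le> lam V" if "U \<subseteq> V"
    proof (rule tendsto_le[OF G(1) lim lim], rule always_eventually, rule allI)
      fix k
      have "measure lebesgue ({0..T k} \<inter> \<phi> -` U) \<le> measure lebesgue ({0..T k} \<inter> \<phi> -` V)"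
        by (rule measure_mono_fmeasurable) (use that meas[OF U] meas[OF V] in auto)
      then show "occ \<phi> (T k) U \<le> occ \<phi> (T k) V"
        unfolding occ_def using T(1)[of k] by (intro divide_right_mono) auto
    qed
    show "lam (U \<union> V) \<le> lam U + lam V"
    proof (rule tendsto_le[OF G(1) tendsto_add[OF lim lim] lim], rule always_eventually, rule allI)
      fix k
      have "measure lebesgue (({0..T k} \<inter> \<phi> -` U) \<union> ({0..T k} \<inter> \<phi> -` V))
          \<le> measure lebesgue ({0..T k} \<inter> \<phi> -` U) + measure lebesgue ({0..T k} \<inter> \<phi> -` V)"
        by (rule measure_Un_le) (use meas(1)[OF U] meas(1)[OF V] in auto)
      then show "occ \<phi> (T k) (U \<union> V) \<le> occ \<phi> (T k) U + occ \<phi> (T k) V"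
        unfolding occ_def using T(1)[of k]
        by (simp add: vimage_Un Int_Un_distrib flip: add_divide_distrib) (simp add: divide_right_mono)
    qed
    show "lam U + lam V \<le> lam (U \<union> V)" if "U \<inter> V = {}"
    proof (rule tendsto_le[OF G(1) lim tendsto_add[OF lim lim]], rule always_eventually, rule allI)
      fix k
      have "measure lebesgue (({0..T k} \<inter> \<phi> -` U) \<union> ({0..T k} \<inter> \<phi> -` V))
          = measure lebesgue ({0..T k} \<inter> \<phi> -` U) + measure lebesgue ({0..T k} \<inter> \<phi> -` V)"
        by (rule measure_Un_AE) (use that meas(1)[OF U] meas(1)[OF V] in auto)
      then show "occ \<phi> (T k) U + occ \<phi> (T k) V \<le> occ \<phi> (T k) (U \<union> V)"
        unfolding occ_def by (simp add: vimage_Un Int_Un_distrib add_divide_distrib)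
    qed
    show "0 \<le> lam U"
      by (rule tendsto_lowerbound[OF lim always_eventually G(1)])
        (use occ_bounds[OF T(1)] in auto)
  next
    have "occ \<phi> (T k) M = 1" for k
    proof -
      have "{0..T k} \<inter> \<phi> -` M = {0..T k}" using \<phi>M by auto
      then show ?thesis using T(1)[of k] by (simp add: occ_def)
    qed
    then show "lam M = 1" using lim[of M] tendsto_unique[OF G(1) lim[of M], of 1] by simp
  qed (rule compact)
  have lim0: "((\<lambda>k. \<bar>t\<bar> / T k) \<longlongrightarrow> 0) G" for t
    using tendsto_mono[OF G(2) tendsto_divide_0[OF tendsto_const filterlim_at_top_imp_at_infinity[OF T(2)]]] .
  have \<sigma>M: "\<sigma> t x \<in> M" if "x \<in> M" for t x
    using continuous_map_image_subset_topspace[OF \<sigma>] that by auto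
  have im: "\<sigma> t ` U = {x \<in> M. \<sigma> (- t) x \<in> U}" if "U \<subseteq> M" for t U
  proof -
    have "x \<in> \<sigma> t ` U" if "x \<in> M" "\<sigma> (- t) x \<in> U" for x
      using inv(1)[of x "- t"] that by force
    then show ?thesis using that inv(1) \<sigma>M by auto
  qed
  have op: "openin mtopology (\<sigma> t ` U)" if "openin mtopology U" for t U
    using openin_continuous_map_preimage[OF \<sigma> that, of "- t"] openin_subset[OF that] by (simp add: im)
  \<comment> \<open>The boundary term of \<open>occ_shift\<close> vanishes in the limit. Applied to
    the image with time \<open>- t\<close>, the same inequality gives equality in
    \<open>eq\<close>.\<close>
  have le: "lam (\<sigma> t ` U) \<le> lam U" if U: "openin mtopology U" for t U
  proof -
    have "((\<lambda>k. occ \<phi> (T k) U + \<bar>t\<bar> / T k) \<longlongrightarrow> lam U + 0) G"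
      by (intro tendsto_add lim lim0)
    then show ?thesis
      using occ_shift[OF \<phi> T(1) inv U op[OF U]] tendsto_le[OF G(1) _ lim, of _ "lam U + 0" "\<sigma> t ` U"]
      by (simp add: always_eventually)
  qed
  have round: "\<sigma> (- t) ` \<sigma> t ` U = U" if "U \<subseteq> M" for t U
    unfolding image_image by (rule trans[OF image_cong[OF refl, of _ _ id]]) (use that inv(1) in auto)
  have eq: "lam (\<sigma> t ` U) = lam U" if U: "openin mtopology U" for t U
    using le[OF U, of t] le[OF op[OF U], of "- t" t] round[of U t] openin_subset[OF U] by simp
  show ?thesis
  proof (rule exI[of _ C.nu], intro conjI allI ballI impI)
    fix t B assume B: "B \<in> sets C.nu"
    have "\<sigma> t ` B \<in> sets C.nu \<and> emeasure C.nu (\<sigma> t ` B) = emeasure C.nu B"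
      by (rule C.nu_invariant[where g' = "\<sigma> (- t)"])
        (use op eq inv(1)[of _ t] inv(1)[of _ "- t"] \<sigma>M B in auto)
    then show "\<sigma> t ` B \<in> sets C.nu" "emeasure C.nu (\<sigma> t ` B) = emeasure C.nu B" by auto
  next
    fix U c assume U: "openin mtopology U"
      and c: "eventually (\<lambda>k. occ \<phi> (T k) U \<le> c) sequentially"
    have "lam U \<le> c"
      using c G(2) by (intro tendsto_upperbound[OF lim _ G(1)]) (simp add: le_filter_def)
    then show "emeasure C.nu U \<le> ennreal c"
      using C.mu_le_lam[OF U order_refl] C.open_in_L[OF U]
      by (simp add: C.emeasure_nu ennreal_leI order_trans)
  next
    show "openin mtopology U \<Longrightarrow> U \<in> sets C.nu" for U
      using C.open_in_L by (simp add: C.sets_nu)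
  qed (rule C.prob_space_nu C.complete_measure_nu C.space_nu C.nu_outer_regular C.nu_inner_regular; assumption?)+
qed

end

subsection \<open>The hull\<close>

lemma openin_compact_open:
  "compact K \<Longrightarrow> open U \<Longrightarrow> openin compact_open_topology {h. continuous_on UNIV h \<and> h ` K \<subseteq> U}"
  unfolding compact_open_topology_def by (rule topology_generated_by_Basis) auto

lemma topspace_compact_open [simp]:
  "topspace compact_open_topology
    = {h :: 'a::topological_space \<Rightarrow> 'b::topological_space. continuous_on UNIV h}"
proof -
  have "{h. continuous_on UNIV h \<and> h ` {} \<subseteq> (UNIV :: 'b set)}
      \<in> {{h :: 'a \<Rightarrow> 'b. continuous_on UNIV h \<and> h ` K \<subseteq> U} | K U. compact K \<and> open U}"
    by (intro CollectI exI[of _ "{}"] exI[of _ UNIV]) simp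
  then show ?thesis unfolding compact_open_topology_def topology_generated_by_topspace
    by (intro antisym) auto
qed

lemma continuous_map_into_compact_open:
  fixes \<Phi> :: "'c \<Rightarrow> 'a::topological_space \<Rightarrow> 'b::topological_space"
  assumes "\<And>x. x \<in> topspace X \<Longrightarrow> continuous_on UNIV (\<Phi> x)"
    and "\<And>K U. compact K \<Longrightarrow> open U \<Longrightarrow> openin X {x \<in> topspace X. \<Phi> x ` K \<subseteq> U}"
  shows "continuous_map X compact_open_topology \<Phi>"
  unfolding compact_open_topology_def
proof (rule continuous_on_generated_topo)
  fix B :: "('a \<Rightarrow> 'b) set" assume "B \<in> {{h. continuous_on UNIV h \<and> h ` K \<subseteq> U} |K U. compact K \<and> open U}"
  then obtain K U where "B = {h. continuous_on UNIV h \<and> h ` K \<subseteq> U}" "compact K" "open U" by blast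
  moreover from this assms(1) have "\<Phi> -` B \<inter> topspace X = {x \<in> topspace X. \<Phi> x ` K \<subseteq> U}" by auto
  ultimately show "openin X (\<Phi> -` B \<inter> topspace X)" using assms(2) by simp
next
  have "\<Phi> x \<in> topspace compact_open_topology" if "x \<in> topspace X" for x using assms(1)[OF that] by simp
  then show "\<Phi> ` topspace X \<subseteq> \<Union> {{h. continuous_on UNIV h \<and> h ` K \<subseteq> U} |K U. compact K \<and> open U}"
    unfolding compact_open_topology_def topology_generated_by_topspace by blast
qed

lemma continuous_map_eval:
  "continuous_map compact_open_topology euclidean (\<lambda>h. h p)"
  unfolding continuous_map_def
proof (intro conjI allI impI)
  fix U :: "'b set" assume "openin euclidean U"
  then show "openin compact_open_topology {h \<in> topspace compact_open_topology. h p \<in> U}"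
    using openin_compact_open[of "{p}" U] by simp
qed simp

section \<open>Shifts and the hull\<close>

lemma vf_shift_apply [simp]: "vf_shift h s (t, x) = h (t + s, x)"
  by (simp add: vf_shift_def)

lemma vf_shift_vf_shift: "vf_shift (vf_shift h s) t = vf_shift h (s + t)"
  by (auto simp: vf_shift_def add_ac)

lemma vf_shift_0 [simp]: "vf_shift h 0 = h"
  by (simp add: vf_shift_def)

lemma vf_shift_compose: "vf_shift h t = h \<circ> (\<lambda>p. (fst p + t, snd p))"
  by (auto simp: vf_shift_def)

lemma continuous_vf_shift: "continuous_on UNIV h \<Longrightarrow> continuous_on UNIV (vf_shift h t)"
  unfolding vf_shift_compose
  by (rule continuous_on_compose) (auto intro!: continuous_intros intro: continuous_on_subset)

lemma continuous_map_vf_shift: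
  "continuous_map compact_open_topology compact_open_topology (\<lambda>h. vf_shift h t)"
proof (rule continuous_map_into_compact_open)
  fix K :: "(real \<times> (real^'a)) set" and U :: "(real^'a) set"
  assume K: "compact K" and U: "open U"
  have "compact ((\<lambda>p. (fst p + t, snd p)) ` K)"
    by (intro compact_continuous_image K continuous_intros)
  from openin_compact_open[OF this U]
  show "openin compact_open_topology {h \<in> topspace compact_open_topology. vf_shift h t ` K \<subseteq> U}"
    by (simp add: vf_shift_compose image_comp)
qed (simp add: continuous_vf_shift)

text \<open>The times at which the shifted field takes \<open>K\<close> out of \<open>U\<close> form
  the projection, along the compact set \<open>K\<close>, of a closed set.\<close>

lemma continuous_map_orbit:
  fixes h :: "'n::finite vfield"
  assumes h: "continuous_on UNIV h"
  shows "continuous_map euclideanreal compact_open_topology (vf_shift h)"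
proof (rule continuous_map_into_compact_open)
  fix K :: "(real \<times> (real^'n)) set" and U :: "(real^'n) set"
  assume K: "compact K" and U: "open U"
  have "continuous_on UNIV (\<lambda>q :: (real \<times> (real^'n)) \<times> real. h (fst (fst q) + snd q, snd (fst q)))"
    by (rule continuous_on_compose2[OF h]) (auto intro!: continuous_intros)
  from closed_vimage[OF closed_Compl[OF U] this]
  have "closed {t. \<exists>p. p \<in> K \<and> (p, t) \<in> (\<lambda>q. h (fst (fst q) + snd q, snd (fst q))) -` (- U)}"
    by (rule closed_compact_projection[OF K])
  then have "open (- {t. \<exists>p. p \<in> K \<and> (p, t) \<in> (\<lambda>q. h (fst (fst q) + snd q, snd (fst q))) -` (- U)})"
    by (rule open_Compl)
  also have "- {t. \<exists>p. p \<in> K \<and> (p, t) \<in> (\<lambda>q. h (fst (fst q) + snd q, snd (fst q))) -` (- U)}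
      = {t. vf_shift h t ` K \<subseteq> U}"
    by (auto simp: vf_shift_compose)
  finally show "openin euclideanreal {t \<in> topspace euclideanreal. vf_shift h t ` K \<subseteq> U}" by simp
qed (simp add: continuous_vf_shift h)

lemma vf_hull_continuous: "\<omega> \<in> vf_hull h \<Longrightarrow> continuous_on UNIV \<omega>"
  using closure_of_subset_topspace[of compact_open_topology "range (vf_shift h)"]
  unfolding vf_hull_def by auto

lemma vf_shift_in_hull: "continuous_on UNIV h \<Longrightarrow> vf_shift h t \<in> vf_hull h"
  unfolding vf_hull_def
  by (rule subsetD[OF closure_of_subset]) (auto simp: continuous_vf_shift)

lemma vf_hull_shift_invariant:
  assumes "\<omega> \<in> vf_hull h"
  shows "vf_shift \<omega> t \<in> vf_hull h"
proof -
  have "vf_shift \<omega> t \<in> compact_open_topology closure_of (\<lambda>h. vf_shift h t) ` range (vf_shift h)"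
    using continuous_map_image_closure_subset[OF continuous_map_vf_shift] assms
    unfolding vf_hull_def by blast
  moreover have "(\<lambda>h. vf_shift h t) ` range (vf_shift h) \<subseteq> range (vf_shift h)"
    by (auto simp: vf_shift_vf_shift)
  ultimately show ?thesis unfolding vf_hull_def using closure_of_mono by blast
qed

text \<open>A closed condition on the values at two points passes from the orbit to its closure,
  because evaluations are continuous in the compact-open topology.\<close>

lemma vf_hull_norm_diff_le:
  assumes "\<omega> \<in> vf_hull h" "\<And>s. norm (vf_shift h s p - vf_shift h s q) \<le> B"
  shows "norm (\<omega> p - \<omega> q) \<le> B"
proof -
  have "continuous_map compact_open_topology euclideanreal (\<lambda>h. norm (h p - h q))"
    by (intro continuous_map_norm continuous_map_diff continuous_map_eval)
  from continuous_map_image_closure_subset[OF this, of "range (vf_shift h)"] assms(1)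
  have "norm (\<omega> p - \<omega> q) \<in> closure ((\<lambda>h. norm (h p - h q)) ` range (vf_shift h))"
    unfolding vf_hull_def by auto
  also have "\<dots> \<subseteq> {..B}"
    using assms(2) by (intro closure_minimal) auto
  finally show ?thesis by simp
qed

text \<open>\<open>dOm\<close> may be any distance inducing the hull topology. Compactness is a
  locale assumption, discharged in the final proof through the attractor.\<close>

locale averaged_hull = averaging f fhat + Metric_space "vf_hull fhat" dOm
  for f :: "real \<Rightarrow> real \<Rightarrow> real ^ 'n \<Rightarrow> real ^ 'n" and fhat dOm +
  assumes mtopology_eq: "mtopology = hull_topology fhat"
    and hull_compact: "compact_space mtopology"
begin

abbreviation "\<Omega> \<equiv> vf_hull fhat"

abbreviation "orbit \<equiv> vf_shift fhat"

lemma orbit_in: "orbit t \<in> \<Omega>"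
  by (rule vf_shift_in_hull[OF continuous_fhat])

lemma fhat_in: "fhat \<in> \<Omega>"
  using orbit_in[of 0] by simp

lemma hull_equimod:
  assumes "equimod r L e h fhat" "\<omega> \<in> \<Omega>"
  shows "equimod r L e h \<omega>"
  unfolding equimod_def
proof (intro allI ballI impI)
  fix t1 t2 :: real and x1 x2 :: "real ^ 'n"
  assume x: "x1 \<in> cball 0 r" "x2 \<in> cball 0 r" and t: "\<bar>t1 - t2\<bar> \<le> h"
  show "norm (\<omega> (t1, x1) - \<omega> (t2, x2)) \<le> e + L * norm (x1 - x2)"
  proof (rule vf_hull_norm_diff_le[OF assms(2)])
    show "norm (orbit s (t1, x1) - orbit s (t2, x2)) \<le> e + L * norm (x1 - x2)" for s
      using assms(1)[unfolded equimod_def, rule_format, OF x, of "t1 + s" "t2 + s"] t by simp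
  qed
qed

lemma hull_lipschitz:
  assumes "\<omega> \<in> \<Omega>" "r > 0" "x \<in> cball 0 r" "y \<in> cball 0 r"
  shows "norm (\<omega> (t, x) - \<omega> (t, y)) \<le> Lf r * norm (x - y)"
proof (rule equimod_lipschitz[OF _ assms(3,4)])
  show "\<exists>h>0. equimod r (Lf r) e h \<omega>" if "e > 0" for e
    using ex_fhat_equimod[OF assms(2) that] hull_equimod[OF _ assms(1)] by blast
qed

lemma continuous_map_into_hull:
  "continuous_map X compact_open_topology g \<Longrightarrow> g ` topspace X \<subseteq> \<Omega> \<Longrightarrow> continuous_map X mtopology g"
  unfolding mtopology_eq hull_topology_def by (rule continuous_map_into_subtopology) auto

lemma continuous_map_from_hull:
  "continuous_map compact_open_topology X g \<Longrightarrow> continuous_map mtopology X g"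
  unfolding mtopology_eq hull_topology_def by (rule continuous_map_from_subtopology)

lemma continuous_orbit: "continuous_map euclideanreal mtopology orbit"
  by (rule continuous_map_into_hull) (auto intro: continuous_map_orbit continuous_fhat orbit_in)

lemma continuous_shift: "continuous_map mtopology mtopology (\<lambda>\<omega>. vf_shift \<omega> t)"
  by (rule continuous_map_into_hull[OF continuous_map_from_hull[OF continuous_map_vf_shift]])
    (auto intro: vf_hull_shift_invariant)

text \<open>Heine-Cantor on the compact hull: the only way to turn smallness of the unspecified
  distance \<open>dOm\<close> into a numerical estimate.\<close>

lemma eval_uniform:
  assumes "e > 0"
  shows "\<exists>\<kappa>>0. \<forall>\<omega>\<in>\<Omega>. \<forall>\<omega>'\<in>\<Omega>. dOm \<omega> \<omega>' < \<kappa> \<longrightarrow> norm (\<omega> p - \<omega>' p) < e"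
proof -
  have "uniformly_continuous_map Self euclidean_metric (\<lambda>\<omega>. \<omega> p)"
    using continuous_eq_uniformly_continuous_map[of Self euclidean_metric "\<lambda>\<omega>. \<omega> p"]
      hull_compact continuous_map_from_hull[OF continuous_map_eval] by (simp add: Self_def)
  then show ?thesis using assms unfolding uniformly_continuous_map_def
    by (simp add: dist_norm) (metis commute norm_minus_commute)
qed

text \<open>The common modulus of all members of the hull reduces the compact set to a finite net,
  and \<open>eval_uniform\<close> handles each point of the net.\<close>

lemma hull_uniform_on_compact:
  assumes e: "e > 0" and R: "R > 0"
  shows "\<exists>\<kappa>>0. \<forall>\<omega>\<in>\<Omega>. \<forall>\<omega>'\<in>\<Omega>. dOm \<omega> \<omega>' < \<kappa> \<longrightarrow>
    (\<forall>t\<in>{0..T}. \<forall>x\<in>cball 0 R. norm (\<omega> (t, x) - \<omega>' (t, x)) \<le> e)"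
proof -
  have L: "Lf R > 0" using Lf(1)[OF R] .
  \<comment> \<open>Moving to a net point costs \<open>e / 6\<close> in time and
    \<open>e / 6\<close> in the state. This is paid for both fields, and the comparison at the net
    point costs another \<open>e / 3\<close>.\<close>
  obtain h where h: "h > 0" "equimod R (Lf R) (e / 6) h fhat"
    using ex_fhat_equimod[OF R, of "e / 6"] e by auto
  define \<delta> where "\<delta> = min h (e / (6 * Lf R))"
  have \<delta>: "\<delta> > 0" "Lf R * \<delta> \<le> e / 6"
    using h e L by (auto simp: \<delta>_def min_def field_simps)
  let ?K = "{0..T} \<times> cball (0 :: real^'n) R"
  have "compact ?K" by (intro compact_Times compact_Icc compact_cball)
  from compactE_image[OF this, of ?K "\<lambda>p. ball p \<delta>"] \<delta>
  obtain P where P: "P \<subseteq> ?K" "finite P" "?K \<subseteq> (\<Union>p\<in>P. ball p \<delta>)" by force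
  have "\<exists>\<kappa>>0. \<forall>\<omega>\<in>\<Omega>. \<forall>\<omega>'\<in>\<Omega>. dOm \<omega> \<omega>' < \<kappa> \<longrightarrow> norm (\<omega> p - \<omega>' p) < e / 3" for p
    using eval_uniform[of "e / 3" p] e by simp
  then obtain \<kappa> where \<kappa>: "\<And>p. \<kappa> p > 0" "\<And>p \<omega> \<omega>'. \<omega> \<in> \<Omega> \<Longrightarrow> \<omega>' \<in> \<Omega> \<Longrightarrow> dOm \<omega> \<omega>' < \<kappa> p \<Longrightarrow> norm (\<omega> p - \<omega>' p) < e / 3"
    by metis
  define k where "k = Min (insert 1 (\<kappa> ` P))"
  have k: "k > 0" "\<And>p. p \<in> P \<Longrightarrow> k \<le> \<kappa> p" using P(2) \<kappa>(1) by (auto simp: k_def)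
  have "norm (\<omega> (t, x) - \<omega>' (t, x)) \<le> e"
    if w: "\<omega> \<in> \<Omega>" "\<omega>' \<in> \<Omega>" "dOm \<omega> \<omega>' < k" and tx: "t \<in> {0..T}" "x \<in> cball 0 R" for \<omega> \<omega>' t x
  proof -
    obtain p where p: "p \<in> P" "(t, x) \<in> ball p \<delta>" using P(3) tx by blast
    obtain s y where sy: "p = (s, y)" by (cases p)
    have y: "y \<in> cball 0 R" using P(1) p(1) sy by auto
    have "\<bar>t - s\<bar> < \<delta>" "norm (x - y) < \<delta>"
      using p(2) dist_fst_le[of p "(t, x)"] dist_snd_le[of p "(t, x)"] sy
      by (auto simp: dist_norm abs_minus_commute norm_minus_commute)
    have "Lf R * norm (x - y) \<le> e / 6"
      using \<delta>(2) \<open>norm (x - y) < \<delta>\<close> L by (smt (verit) mult_left_mono)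
    have *: "norm (v (t, x) - v (s, y)) \<le> e / 3" if "v \<in> \<Omega>" for v
    proof -
      have "norm (v (t, x) - v (s, y)) \<le> e / 6 + Lf R * norm (x - y)"
        using hull_equimod[OF h(2) that, unfolded equimod_def, rule_format, OF tx(2) y, of t s]
          \<open>\<bar>t - s\<bar> < \<delta>\<close> by (simp add: \<delta>_def)
      with \<open>Lf R * norm (x - y) \<le> e / 6\<close> show ?thesis by linarith
    qed
    have "norm (\<omega> p - \<omega>' p) < e / 3" using \<kappa>(2)[OF w(1,2)] w(3) k(2)[OF p(1)] by auto
    moreover have "\<omega> (t, x) - \<omega>' (t, x) = (\<omega> (t, x) - \<omega> p) + (\<omega> p - \<omega>' p) + (\<omega>' p - \<omega>' (t, x))" by simp
    then have "norm (\<omega> (t, x) - \<omega>' (t, x)) \<le> norm (\<omega> (t, x) - \<omega> p) + norm (\<omega> p - \<omega>' p) + norm (\<omega>' p - \<omega>' (t, x))"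
      by (metis norm_triangle_ineq norm_triangle_le add_right_mono)
    ultimately show ?thesis using *[OF w(1)] *[OF w(2)] sy by (simp add: norm_minus_commute)
  qed
  then show ?thesis using k(1) by blast
qed

text \<open>By minimality every orbit meets \<open>V\<close>, so the sets of points that are in
  \<open>V\<close> at time \<open>s\<close> form an open cover. A finite subcover gives the times in
  \<open>S\<close>, which may be negative.\<close>

lemma return_times:
  assumes min: "minimal_hull fhat" and V: "openin mtopology V" "V \<noteq> {}"
  shows "\<exists>S. finite S \<and> (\<forall>\<omega>\<in>\<Omega>. \<exists>s\<in>S. vf_shift \<omega> s \<in> V)"
proof -
  define W where "W s = {\<omega> \<in> \<Omega>. vf_shift \<omega> s \<in> V}" for s
  have op: "openin mtopology (W s)" for s
    using openin_continuous_map_preimage[OF continuous_shift V(1)] by (simp add: W_def)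
  have "\<Omega> \<subseteq> \<Union>(range W)"
  proof
    fix \<omega> assume w: "\<omega> \<in> \<Omega>"
    obtain v where v: "v \<in> V" using V(2) by blast
    have "v \<in> \<Omega>" using v openin_subset[OF V(1)] by auto
    then have "v \<in> mtopology closure_of range (vf_shift \<omega>)"
      using min w unfolding minimal_hull_def mtopology_eq by simp
    then obtain y where "y \<in> range (vf_shift \<omega>)" "y \<in> V" using V(1) v unfolding in_closure_of by blast
    then show "\<omega> \<in> \<Union>(range W)" using w unfolding W_def by blast
  qed
  moreover have "compactin mtopology \<Omega>" using hull_compact by (simp add: compact_space_def)
  ultimately obtain F where F: "finite F" "F \<subseteq> range W" "\<Omega> \<subseteq> \<Union>F"
    using op unfolding compactin_def by (metis (no_types, lifting) imageE)
  obtain S where "finite S" "F = W ` S" using finite_subset_image[OF F(1,2)] by blast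
  then show ?thesis using F(3) unfolding W_def by (intro exI[of _ S]) fastforce
qed

section \<open>Visits of the averaged field to open sets\<close>

definition visits :: "real \<Rightarrow> (real \<times> (real^'n) \<Rightarrow> real^'n) set \<Rightarrow> real set" where
  "visits T1 V = {t. T1 \<le> t \<and> orbit t \<in> V}"

lemma relatively_dense_visits:
  assumes "minimal_hull fhat" "openin mtopology V" "V \<noteq> {}" "0 \<le> T1"
  shows "relatively_dense (visits T1 V)"
proof -
  obtain S where S: "finite S" "\<forall>\<omega>\<in>\<Omega>. \<exists>s\<in>S. vf_shift \<omega> s \<in> V"
    using return_times[OF assms(1-3)] by blast
  \<comment> \<open>As return times may be negative, the search starts at \<open>b + T1 + m\<close>,
    which keeps every return after \<open>b + T1\<close>. The extra 1 in the window length makes it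
    positive even if \<open>T1\<close> and \<open>m\<close> vanish.\<close>
  define m where "m = Max (insert 0 (abs ` S))"
  have m: "\<bar>s\<bar> \<le> m" if "s \<in> S" for s using S(1) that by (auto simp: m_def)
  have m0: "0 \<le> m" using S(1) by (auto simp: m_def)
  have "visits T1 V \<inter> {b..b + (T1 + 2 * m + 1)} \<noteq> {}" if "b \<ge> 0" for b
  proof -
    obtain s where "s \<in> S" "vf_shift (orbit (b + T1 + m)) s \<in> V" using S(2) orbit_in by blast
    then have "b + T1 + m + s \<in> visits T1 V \<inter> {b..b + (T1 + 2 * m + 1)}"
      using m[of s] that assms(4) by (auto simp: visits_def vf_shift_vf_shift)
    then show ?thesis by blast
  qed
  then show ?thesis unfolding relatively_dense_def
    using m0 assms(4) by (intro exI[of _ "T1 + 2 * m + 1"]) auto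
qed

text \<open>The premise on \<open>c\<close> says that the lower limit of the occupation fractions is
  at least \<open>c\<close>. Discarding the times before \<open>T1\<close> changes them by at most
  \<open>T1 / t\<close>, which tends to 0.\<close>

lemma lower_density_visits:
  assumes V: "openin mtopology V" and T1: "0 \<le> T1"
    and c: "\<And>y. y < c \<Longrightarrow> eventually (\<lambda>t. y < occ orbit t V) at_top"
  shows "ereal c \<le> lower_density (visits T1 V)"
  unfolding lower_density_def
proof (rule ereal_le_epsilon2)
  fix e :: real assume e: "0 < e"
  let ?D = "visits T1 V"
  let ?I = "\<lambda>t. 1 / t * integral {0..t} (indicator ?D :: real \<Rightarrow> real)"
  have "eventually (\<lambda>t. c - e / 2 < occ orbit t V) at_top" using c e by simp
  moreover have "eventually (\<lambda>t. T1 / t < e / 2) at_top"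
    using order_tendstoD(2)[OF real_tendsto_divide_at_top[OF tendsto_const filterlim_ident]] e by simp
  ultimately have "eventually (\<lambda>t. ereal (c - e) \<le> ereal (?I t)) at_top"
    using eventually_gt_at_top[of 0]
  proof eventually_elim
    fix t :: real assume t: "c - e / 2 < occ orbit t V" "T1 / t < e / 2" "0 < t"
    have m1: "{0..t} \<inter> orbit -` V \<in> lmeasurable" by (rule occ_lmeasurable[OF continuous_orbit V])
    have eq: "{0..t} \<inter> ?D = {0..t} \<inter> orbit -` V \<inter> {T1..}" by (auto simp: visits_def)
    have m2: "{0..t} \<inter> ?D \<in> lmeasurable" unfolding eq by (intro fmeasurable_Int_fmeasurable m1) auto
    have "measure lebesgue ({0..t} \<inter> orbit -` V) \<le> measure lebesgue (({0..t} \<inter> ?D) \<union> {0..T1})"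
      by (rule measure_mono_fmeasurable) (use m1 m2 in \<open>auto simp: visits_def intro!: fmeasurable.Un\<close>)
    also have "\<dots> \<le> measure lebesgue ({0..t} \<inter> ?D) + measure lebesgue {0..T1}"
      using m2 by (intro measure_Un_le) auto
    also have "measure lebesgue ({0..t} \<inter> ?D) = integral {0..t} (indicator ?D)"
    proof -
      have "measure lebesgue ({0..t} \<inter> ?D) = integral UNIV (indicator ({0..t} \<inter> ?D) :: real \<Rightarrow> real)"
        by (rule lmeasure_integral_UNIV[OF m2])
      also have "\<dots> = integral UNIV (\<lambda>x. if x \<in> {0..t} then indicator ?D x else 0 :: real)"
        by (intro arg_cong[where f = "integral UNIV"]) (auto simp: indicator_def)
      also have "\<dots> = integral {0..t} (indicator ?D)" by (rule integral_restrict_UNIV)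
      finally show ?thesis .
    qed
    finally have "occ orbit t V \<le> (integral {0..t} (indicator ?D) + T1) / t"
      unfolding occ_def using t T1 by (intro divide_right_mono) auto
    then have "occ orbit t V \<le> ?I t + T1 / t" by (simp add: add_divide_distrib)
    with t have "c - e \<le> ?I t" by linarith
    then show "ereal (c - e) \<le> ereal (?I t)" by simp
  qed
  then have "ereal (c - e) \<le> Liminf at_top (\<lambda>t. ereal (?I t))" by (rule Liminf_bounded)
  then have "ereal (c - e) + ereal e \<le> Liminf at_top (\<lambda>t. ereal (?I t)) + ereal e" by (rule add_right_mono)
  then show "ereal c \<le> Liminf at_top (\<lambda>t. ereal (?I t)) + ereal e" by simp
qed

text \<open>Finitely many translates of \<open>V\<close> cover the hull, so their occupation
  fractions add up to at least 1. By \<open>occ_shift\<close> each is asymptotically at most that of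
  \<open>V\<close>, which leaves \<open>V\<close> at least \<open>1 / card S\<close>.\<close>

lemma occ_orbit_lower_bound:
  assumes "minimal_hull fhat" and V: "openin mtopology V" "V \<noteq> {}"
  shows "\<exists>c>0. \<forall>y<c. eventually (\<lambda>t. y < occ orbit t V) at_top"
proof -
  obtain S where S: "finite S" "\<forall>\<omega>\<in>\<Omega>. \<exists>s\<in>S. vf_shift \<omega> s \<in> V"
    using return_times[OF assms] by blast
  have "S \<noteq> {}" using S(2) fhat_in by blast
  then have N: "real (card S) > 0" using S(1) by (simp add: card_gt_0_iff)
  have VM: "V \<subseteq> \<Omega>" using openin_subset[OF V(1)] by simp
  let ?V = "\<lambda>s. (\<lambda>\<omega>. vf_shift \<omega> (- s)) ` V"
  have Veq: "?V s = {\<omega> \<in> \<Omega>. vf_shift \<omega> s \<in> V}" for s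
  proof -
    have "\<omega> \<in> ?V s" if "vf_shift \<omega> s \<in> V" for \<omega>
      by (rule image_eqI[OF _ that]) (simp add: vf_shift_vf_shift)
    then show ?thesis using VM by (auto simp: vf_shift_vf_shift intro: vf_hull_shift_invariant)
  qed
  have op: "openin mtopology (?V s)" for s
    unfolding Veq using openin_continuous_map_preimage[OF continuous_shift V(1)] by simp
  have bound: "(1 - (\<Sum>s\<in>S. \<bar>s\<bar>) / t) / card S \<le> occ orbit t V" if t: "t > 0" for t
  proof -
    have "{0..t} = (\<Union>s\<in>S. {0..t} \<inter> orbit -` ?V s)"
      unfolding Veq using S(2) orbit_in by fastforce
    moreover have "t = measure lebesgue {0..t}" using t by simp
    ultimately have "t = measure lebesgue (\<Union>s\<in>S. {0..t} \<inter> orbit -` ?V s)" by (simp only:)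
    also have "\<dots> \<le> (\<Sum>s\<in>S. measure lebesgue ({0..t} \<inter> orbit -` ?V s))"
      by (rule measure_UNION_le[OF S(1)]) (use occ_lmeasurable[OF continuous_orbit op] in auto)
    finally have "1 \<le> (\<Sum>s\<in>S. occ orbit t (?V s))"
      using t by (simp add: occ_def flip: sum_divide_distrib)
    also have "\<dots> \<le> (\<Sum>s\<in>S. occ orbit t V + \<bar>s\<bar> / t)"
    proof (rule sum_mono)
      fix s assume "s \<in> S"
      show "occ orbit t (?V s) \<le> occ orbit t V + \<bar>s\<bar> / t"
        using occ_shift[OF continuous_orbit t, of "\<lambda>t \<omega>. vf_shift \<omega> t" V "- s"] op[of s] V(1)
        by (simp add: vf_shift_vf_shift)
    qed
    also have "\<dots> = card S * occ orbit t V + (\<Sum>s\<in>S. \<bar>s\<bar>) / t"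
      by (simp add: sum.distrib sum_divide_distrib)
    finally show ?thesis using N by (simp add: field_simps)
  qed
  have "eventually (\<lambda>t. y < occ orbit t V) at_top" if y: "y < 1 / card S" for y
  proof -
    have "((\<lambda>t. (1 - (\<Sum>s\<in>S. \<bar>s\<bar>) / t) / card S) \<longlongrightarrow> (1 - 0) / card S) at_top"
      using N by (intro tendsto_intros real_tendsto_divide_at_top[OF tendsto_const filterlim_ident]) simp
    then have "eventually (\<lambda>t. y < (1 - (\<Sum>s\<in>S. \<bar>s\<bar>) / t) / card S) at_top"
      using y by (intro order_tendstoD(1)) auto
    then show ?thesis using eventually_gt_at_top[of 0]
      by eventually_elim (use bound in \<open>auto intro: less_le_trans\<close>)
  qed
  then show ?thesis using N by (intro exI[of _ "1 / card S"]) auto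
qed

end

subsection \<open>Tracking the attractor\<close>

lemma has_vector_derivative_delay:
  fixes z :: "real \<Rightarrow> 'a::real_normed_vector"
  assumes "(z has_vector_derivative D) (at (s - a) within {0..})" "s \<in> {a..b}"
  shows "((\<lambda>s. z (s - a)) has_vector_derivative D) (at s within {a..b})"
proof -
  have "((\<lambda>s. s - a) has_vector_derivative 1) (at s within {a..b})"
    by (auto intro!: derivative_eq_intros)
  moreover have "(z has_vector_derivative D) (at (s - a) within (\<lambda>s. s - a) ` {a..b})"
    by (rule has_vector_derivative_within_subset[OF assms(1)]) auto
  ultimately show ?thesis
    using vector_diff_chain_within[of "\<lambda>s. s - a" 1 s "{a..b}" z D] by (simp add: o_def)
qed

locale attractor_setting = averaged_hull f fhat dOm
  for f :: "real \<Rightarrow> real \<Rightarrow> real ^ 'n \<Rightarrow> real ^ 'n" and fhat dOm +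
  fixes A :: "((real \<times> (real ^ 'n) \<Rightarrow> real ^ 'n) \<times> (real ^ 'n)) set" and xhat :: "real ^ 'n"
  assumes attractor: "local_attractor fhat dOm A"
    and in_basin: "(fhat, xhat) \<in> basin fhat dOm A"
begin

text \<open>Distance to \<open>A\<close> in the product space, written without
  \<open>ennreal\<close>. The witness may lie over a base point other than \<open>\<omega>\<close>,
  so \<open>near\<close> alone says nothing about the fibre over \<open>\<omega>\<close>.\<close>

definition near :: "real \<Rightarrow> (real \<times> (real ^ 'n) \<Rightarrow> real ^ 'n) \<Rightarrow> real ^ 'n \<Rightarrow> bool" where
  "near \<kappa> \<omega> x \<longleftrightarrow> (\<exists>(\<omega>', x')\<in>A. dOm \<omega> \<omega>' < \<kappa> \<and> norm (x - x') < \<kappa>)"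

lemma near_mono:
  assumes "near \<kappa> \<omega> x" "\<kappa> \<le> \<kappa>'"
  shows "near \<kappa>' \<omega> x"
proof -
  obtain \<omega>' x' where A: "(\<omega>', x') \<in> A" "dOm \<omega> \<omega>' < \<kappa>" "norm (x - x') < \<kappa>"
    using assms(1) unfolding near_def by blast
  then have "dOm \<omega> \<omega>' < \<kappa>'" "norm (x - x') < \<kappa>'" using assms(2) by linarith+
  with A(1) show ?thesis unfolding near_def by blast
qed

lemma near_perturb: "near \<kappa> \<omega> x \<Longrightarrow> norm (y - x) \<le> \<kappa>' \<Longrightarrow> near (\<kappa> + \<kappa>') \<omega> y"
proof -
  assume n: "near \<kappa> \<omega> x" and yx: "norm (y - x) \<le> \<kappa>'"
  obtain \<omega>' x' where A: "(\<omega>', x') \<in> A" "dOm \<omega> \<omega>' < \<kappa>" "norm (x - x') < \<kappa>"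
    using n unfolding near_def by blast
  have "norm (y - x') \<le> norm (y - x) + norm (x - x')"
    using norm_triangle_ineq[of "y - x" "x - x'"] by simp
  moreover have "0 \<le> norm (y - x)" by simp
  ultimately have "dOm \<omega> \<omega>' < \<kappa> + \<kappa>'" "norm (y - x') < \<kappa> + \<kappa>'" using A yx by linarith+
  with A show ?thesis unfolding near_def by blast
qed

lemma near_iff_pt_dist: "pt_dist (max_dist dOm) (\<omega>, x) A < ennreal \<kappa> \<longleftrightarrow> near \<kappa> \<omega> x"
  unfolding pt_dist_def near_def INF_less_iff
  by (auto simp: max_dist_def ennreal_less_iff dist_norm le_max_iff_disj split: prod.splits
      intro!: bexI)

section \<open>Solutions of the skewproduct flow near the attractor\<close>

abbreviation "flow \<omega> x \<equiv> sol UNIV (\<lambda>s z. \<omega> (s, z)) 0 x"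

lemma in_skew_domain_iff:
  "(t, \<omega>, x) \<in> skew_domain fhat \<longleftrightarrow> \<omega> \<in> \<Omega> \<and> t \<in> sol_dom UNIV (\<lambda>s z. \<omega> (s, z)) 0 x"
  by (simp add: skew_domain_def)

lemma flow_solution:
  assumes "\<And>t. 0 \<le> t \<Longrightarrow> (t, \<omega>, x) \<in> skew_domain fhat"
  shows "flow \<omega> x 0 = x"
    "0 \<le> t \<Longrightarrow> (flow \<omega> x has_vector_derivative \<omega> (t, flow \<omega> x t)) (at t within {0..})"
proof -
  have ivp: "ivp_solution UNIV (\<lambda>s z. \<omega> (s, z)) 0 x (sol_dom UNIV (\<lambda>s z. \<omega> (s, z)) 0 x) (flow \<omega> x)"
    by (rule ivp_solution_sol) simp
  then show "flow \<omega> x 0 = x" by (simp add: ivp_solution_def)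
  have sub: "{0..} \<subseteq> sol_dom UNIV (\<lambda>s z. \<omega> (s, z)) 0 x"
    using assms by (auto simp: in_skew_domain_iff)
  assume "0 \<le> t"
  with sub have "t \<in> sol_dom UNIV (\<lambda>s z. \<omega> (s, z)) 0 x" by auto
  then have "(flow \<omega> x has_vector_derivative \<omega> (t, flow \<omega> x t)) (at t within sol_dom UNIV (\<lambda>s z. \<omega> (s, z)) 0 x)"
    using ivp by (simp add: ivp_solution_def)
  then show "(flow \<omega> x has_vector_derivative \<omega> (t, flow \<omega> x t)) (at t within {0..})"
    by (rule has_vector_derivative_within_subset[OF _ sub])
qed

lemma attractor_invariant:
  assumes "(\<omega>, x) \<in> A"
  shows "(t, \<omega>, x) \<in> skew_domain fhat" "(vf_shift \<omega> t, flow \<omega> x t) \<in> A"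
proof -
  have inv: "UNIV \<times> A \<subseteq> skew_domain fhat" "skew_image fhat t A = A"
    using attractor by (auto simp: local_attractor_def skew_invariant_def)
  show *: "(t, \<omega>, x) \<in> skew_domain fhat" using inv(1) assms by blast
  have "skew_flow t (\<omega>, x) \<in> skew_image fhat t A"
    unfolding skew_image_def using assms * by blast
  then show "(vf_shift \<omega> t, flow \<omega> x t) \<in> A" using inv(2) by (simp add: skew_flow_def)
qed

lemma attractor_hull: "(\<omega>, x) \<in> A \<Longrightarrow> \<omega> \<in> \<Omega>"
  using attractor_invariant(1)[of \<omega> x 0] by (simp add: in_skew_domain_iff)

lemma attractor_bounded: "\<exists>R\<ge>0. \<forall>(\<omega>, x)\<in>A. norm x \<le> R"
proof -
  have "compactin (skew_topology fhat) A" using attractor by (simp add: local_attractor_def)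
  then have "compactin euclidean (snd ` A)"
    unfolding skew_topology_def by (rule image_compactin) (rule continuous_map_snd)
  then have "bounded (snd ` A)" by (simp add: compact_imp_bounded)
  then obtain R where "\<forall>y\<in>snd ` A. norm y \<le> R" by (auto simp: bounded_iff)
  then show ?thesis by (intro exI[of _ "max R 0"]) force
qed

lemma semidist_imp_near:
  assumes "semidist (max_dist dOm) (skew_image fhat t C) A < ennreal e"
    and "(\<omega>, x) \<in> C" "(t, \<omega>, x) \<in> skew_domain fhat"
  shows "near e (vf_shift \<omega> t) (flow \<omega> x t)"
proof -
  have "(vf_shift \<omega> t, flow \<omega> x t) \<in> skew_image fhat t C"
    unfolding skew_image_def using assms(2,3) by (force simp: skew_flow_def)
  then have "pt_dist (max_dist dOm) (vf_shift \<omega> t, flow \<omega> x t) A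
      \<le> semidist (max_dist dOm) (skew_image fhat t C) A"
    unfolding semidist_def by (rule SUP_upper)
  then show ?thesis using assms(1) near_iff_pt_dist by (meson le_less_trans)
qed

lemma attraction:
  "\<exists>\<mu>>0. (\<forall>\<omega>\<in>\<Omega>. \<forall>x t. near \<mu> \<omega> x \<longrightarrow> 0 \<le> t \<longrightarrow> (t, \<omega>, x) \<in> skew_domain fhat) \<and>
    (\<forall>e>0. \<exists>T>0. \<forall>t\<ge>T. \<forall>\<omega>\<in>\<Omega>. \<forall>x. near \<mu> \<omega> x \<longrightarrow> near e (vf_shift \<omega> t) (flow \<omega> x t))"
proof -
  obtain \<mu> where \<mu>: "\<mu> > 0" "{0..} \<times> skew_cball fhat dOm \<mu> A \<subseteq> skew_domain fhat"
    "((\<lambda>t. semidist (max_dist dOm) (skew_image fhat t (skew_cball fhat dOm \<mu> A)) A) \<longlongrightarrow> 0) at_top"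
    using attractor unfolding local_attractor_def by blast
  have "topspace (skew_topology fhat) = \<Omega> \<times> UNIV"
    unfolding skew_topology_def by (simp flip: mtopology_eq)
  then have cball: "(\<omega>, x) \<in> skew_cball fhat dOm \<mu> A" if "\<omega> \<in> \<Omega>" "near \<mu> \<omega> x" for \<omega> x
    unfolding skew_cball_def using that
    by (intro subsetD[OF closure_of_subset]) (auto simp: near_iff_pt_dist)
  have dom: "(t, \<omega>, x) \<in> skew_domain fhat" if "\<omega> \<in> \<Omega>" "near \<mu> \<omega> x" "0 \<le> t" for \<omega> x t
    using cball[OF that(1,2)] \<mu>(2) that(3) by auto
  have "\<exists>T>0. \<forall>t\<ge>T. \<forall>\<omega>\<in>\<Omega>. \<forall>x. near \<mu> \<omega> x \<longrightarrow> near e (vf_shift \<omega> t) (flow \<omega> x t)" if e: "e > 0" for e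
  proof -
    have "eventually (\<lambda>t. semidist (max_dist dOm) (skew_image fhat t (skew_cball fhat dOm \<mu> A)) A < ennreal e) at_top"
      using \<mu>(3) by (rule order_tendstoD) (use e in simp)
    then obtain T where T: "\<And>t. t \<ge> T \<Longrightarrow>
        semidist (max_dist dOm) (skew_image fhat t (skew_cball fhat dOm \<mu> A)) A < ennreal e"
      by (auto simp: eventually_at_top_linorder)
    show ?thesis
      by (intro exI[of _ "max T 1"] conjI allI impI ballI semidist_imp_near[OF T])
        (use cball dom in auto)
  qed
  then show ?thesis using \<mu>(1) dom by blast
qed

lemma basin_attraction:
  "0 \<le> t \<Longrightarrow> (t, fhat, xhat) \<in> skew_domain fhat"
  "e > 0 \<Longrightarrow> \<exists>T>0. near e (orbit T) (flow fhat xhat T)"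
proof -
  obtain U where U: "attraction_open_set fhat dOm A U" "(fhat, xhat) \<in> U"
    using in_basin unfolding basin_def by blast
  show dom: "(t, fhat, xhat) \<in> skew_domain fhat" if "0 \<le> t" for t
    using U that unfolding attraction_open_set_def by auto
  assume e: "e > 0"
  have "openin (skew_topology fhat) U" using U(1) by (simp add: attraction_open_set_def)
  from openin_subset[OF this] have "compactin (skew_topology fhat) {(fhat, xhat)}"
    using U(2) by (intro finite_imp_compactin) auto
  then have "((\<lambda>t. semidist (max_dist dOm) (skew_image fhat t {(fhat, xhat)}) A) \<longlongrightarrow> 0) at_top"
    using U unfolding attraction_open_set_def by blast
  then have "eventually (\<lambda>t. semidist (max_dist dOm) (skew_image fhat t {(fhat, xhat)}) A < ennreal e) at_top"
    by (rule order_tendstoD) (use e in simp)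
  then obtain T where "\<And>t. t \<ge> T \<Longrightarrow> semidist (max_dist dOm) (skew_image fhat t {(fhat, xhat)}) A < ennreal e"
    by (auto simp: eventually_at_top_linorder)
  then have "semidist (max_dist dOm) (skew_image fhat (max T 1) {(fhat, xhat)}) A < ennreal e" by simp
  from semidist_imp_near[OF this, of fhat xhat] dom
  show "\<exists>T>0. near e (orbit T) (flow fhat xhat T)" by (intro exI[of _ "max T 1"]) auto
qed

text \<open>Attraction gives no control before it takes effect. On that initial stretch the solution
  is compared with the one through a nearby point of \<open>A\<close>, which never leaves
  \<open>A\<close> and is thus bounded by \<open>R\<close>.\<close>

lemma near_bounded_finite:
  assumes T: "T > 0" and R: "R \<ge> 0" "\<forall>(\<omega>, x)\<in>A. norm x \<le> R"
  shows "\<exists>\<kappa>>0. \<forall>\<omega>\<in>\<Omega>. \<forall>x. near \<kappa> \<omega> x \<longrightarrow> (\<forall>t\<ge>0. (t, \<omega>, x) \<in> skew_domain fhat) \<longrightarrow>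
    (\<forall>t\<in>{0..T}. norm (flow \<omega> x t) \<le> R + 1)"
proof -
  define L where "L = Lf (R + 1)"
  have R1: "R + 1 > 0" using R by simp
  have L: "L > 0" unfolding L_def by (rule Lf(1)[OF R1])
  \<comment> \<open>Field error over time \<open>T\<close> and initial error each contribute
    \<open>exp (- (L * T)) / 4\<close>; after the Gronwall factor the distance is at most 1/2, below
    the threshold 1 of \<open>ode_perturbation_near\<close>.\<close>
  define e where "e = exp (- (L * T)) / (4 * T)"
  have e: "e > 0" using T by (simp add: e_def)
  obtain k where k: "k > 0" "\<forall>\<omega>\<in>\<Omega>. \<forall>\<omega>'\<in>\<Omega>. dOm \<omega> \<omega>' < k \<longrightarrow>
      (\<forall>t\<in>{0..T}. \<forall>x\<in>cball 0 (R + 1). norm (\<omega> (t, x) - \<omega>' (t, x)) \<le> e)"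
    using hull_uniform_on_compact[OF e R1] by blast
  define \<kappa> where "\<kappa> = min k (exp (- (L * T)) / 4)"
  have \<kappa>: "\<kappa> > 0" "\<kappa> \<le> k" "\<kappa> \<le> exp (- (L * T)) / 4" using k by (auto simp: \<kappa>_def)
  have "norm (flow \<omega> x t) \<le> R + 1"
    if w: "\<omega> \<in> \<Omega>" and n: "near \<kappa> \<omega> x" and dom: "\<And>t. t \<ge> 0 \<Longrightarrow> (t, \<omega>, x) \<in> skew_domain fhat"
      and t: "t \<in> {0..T}" for \<omega> x t
  proof -
    obtain \<omega>' x' where A: "(\<omega>', x') \<in> A" "dOm \<omega> \<omega>' < \<kappa>" "norm (x - x') < \<kappa>"
      using n unfolding near_def by blast
    have w': "\<omega>' \<in> \<Omega>" using attractor_hull[OF A(1)] .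
    let ?y = "flow \<omega> x" and ?z = "flow \<omega>' x'"
    have zR: "norm (?z s) \<le> R" for s using attractor_invariant(2)[OF A(1), of s] R(2) by blast
    note y = flow_solution[OF dom] and z = flow_solution[OF attractor_invariant(1)[OF A(1)]]
    have sub: "{0..T} \<subseteq> {0..}" by auto
    have cz: "continuous_on {0..T} ?z"
      by (rule continuous_on_vector_derivative, rule has_vector_derivative_within_subset[OF z(2) sub]) simp
    have close: "norm (\<omega> (s, ?z s) - \<omega>' (s, ?z s)) \<le> e" if "s \<in> {0..T}" for s
      using k(2) w w' A(2) \<kappa>(2) that order_trans[OF zR, of "R + 1"] by simp
    have cD: "continuous_on {0..T} (\<lambda>s. \<omega> (s, ?z s) - \<omega>' (s, ?z s))"
    proof (rule continuous_on_diff)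
      have "continuous_on {0..T} (\<lambda>s. v (s, ?z s))" if "v \<in> \<Omega>" for v
        by (rule continuous_on_compose2[OF vf_hull_continuous[OF that] continuous_on_Pair[OF continuous_on_id cz]]) auto
      then show "continuous_on {0..T} (\<lambda>s. \<omega> (s, ?z s))" "continuous_on {0..T} (\<lambda>s. \<omega>' (s, ?z s))"
        using w w' by blast+
    qed
    have "norm (?y t - ?z t) < 1"
    proof (rule ode_perturbation_near[where a = 0 and b = T and G = "\<lambda>s z. \<omega> (s, z)" and H = "\<lambda>s z. \<omega>' (s, z)" and L = L and c = "e * T"])
      show "(?y has_vector_derivative \<omega> (s, ?y s)) (at s within {0..T})" if "s \<in> {0..T}" for s
        using has_vector_derivative_within_subset[OF y(2) sub] that by simp
      show "(?z has_vector_derivative \<omega>' (s, ?z s)) (at s within {0..T})" if "s \<in> {0..T}" for s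
        using has_vector_derivative_within_subset[OF z(2) sub] that by simp
      show "(\<lambda>s. \<omega> (s, ?z s) - \<omega>' (s, ?z s)) integrable_on {0..T}"
        by (rule integrable_continuous_real[OF cD])
      show "norm (\<omega> (s, ?y s) - \<omega> (s, ?z s)) \<le> L * norm (?y s - ?z s)"
        if "s \<in> {0..T}" "norm (?y s - ?z s) \<le> 1" for s
        unfolding L_def
      proof (rule hull_lipschitz[OF w R1])
        have "norm (?y s) \<le> norm (?z s) + norm (?y s - ?z s)" by (rule norm_triangle_sub)
        then show "?y s \<in> cball 0 (R + 1)" using that(2) zR[of s] by simp
        show "?z s \<in> cball 0 (R + 1)" using zR[of s] by simp
      qed
      show "norm (integral {0..s} (\<lambda>s. \<omega> (s, ?z s) - \<omega>' (s, ?z s))) \<le> e * T" if s: "s \<in> {0..T}" for s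
      proof -
        have "norm (integral {0..s} (\<lambda>s. \<omega> (s, ?z s) - \<omega>' (s, ?z s))) \<le> e * (s - 0)"
          by (rule integral_bound) (use s close in \<open>auto intro: continuous_on_subset[OF cD]\<close>)
        also have "\<dots> \<le> e * T" using s e by (intro mult_left_mono) auto
        finally show ?thesis .
      qed
      have "(norm (x - x') + e * T) * exp (L * T) \<le> (exp (- (L * T)) / 4 + exp (- (L * T)) / 4) * exp (L * T)"
        using A(3) \<kappa>(3) T by (intro mult_right_mono add_mono) (auto simp: e_def)
      also have "\<dots> = 1 / 2" by (simp add: exp_minus field_simps)
      finally show "(norm (?y 0 - ?z 0) + e * T) * exp (L * (T - 0)) < 1" using y(1) z(1) by simp
    qed (use L t in auto)
    moreover have "norm (?y t) \<le> norm (?z t) + norm (?y t - ?z t)" by (rule norm_triangle_sub)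
    ultimately show ?thesis using zR[of t] by linarith
  qed
  then show ?thesis using \<kappa>(1) by blast
qed

text \<open>Every averaged solution started near the attractor stays bounded and is pulled closer within a fixed
  time, so that the averaging error on windows of that length never accumulates.\<close>

theorem tracking:
  assumes \<delta>: "\<delta> > 0"
  shows "\<exists>T1\<ge>0. \<exists>\<epsilon>0>0. \<forall>\<epsilon>. 0 < \<epsilon> \<and> \<epsilon> < \<epsilon>0 \<longrightarrow>
    (\<forall>t\<ge>T1. t \<in> eps_dom f \<epsilon> 0 xhat \<and> near \<delta> (orbit t) (eps_sol f \<epsilon> t 0 xhat))"
proof -
  obtain R where R: "R \<ge> 0" "\<forall>(\<omega>, x)\<in>A. norm x \<le> R" using attractor_bounded by blast
  obtain \<mu> where \<mu>: "\<mu> > 0"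
    "\<And>\<omega> x t. \<omega> \<in> \<Omega> \<Longrightarrow> near \<mu> \<omega> x \<Longrightarrow> 0 \<le> t \<Longrightarrow> (t, \<omega>, x) \<in> skew_domain fhat"
    "\<And>e. e > 0 \<Longrightarrow> \<exists>T>0. \<forall>t\<ge>T. \<forall>\<omega>\<in>\<Omega>. \<forall>x. near \<mu> \<omega> x \<longrightarrow> near e (vf_shift \<omega> t) (flow \<omega> x t)"
    using attraction by blast
  obtain T\<mu> where T\<mu>: "T\<mu> > 0" "\<And>t \<omega> x. t \<ge> T\<mu> \<Longrightarrow> \<omega> \<in> \<Omega> \<Longrightarrow> near \<mu> \<omega> x \<Longrightarrow> near 1 (vf_shift \<omega> t) (flow \<omega> x t)"
    using \<mu>(3)[of 1] by auto
  obtain \<kappa>0 where \<kappa>0: "\<kappa>0 > 0" "\<And>\<omega> x t. \<omega> \<in> \<Omega> \<Longrightarrow> near \<kappa>0 \<omega> x \<Longrightarrow>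
      (\<forall>t\<ge>0. (t, \<omega>, x) \<in> skew_domain fhat) \<Longrightarrow> t \<in> {0..T\<mu>} \<Longrightarrow> norm (flow \<omega> x t) \<le> R + 1"
    using near_bounded_finite[OF T\<mu>(1) R] by blast
  \<comment> \<open>\<open>\<kappa>0\<close> gives boundedness on the initial stretch,
    \<open>\<mu>\<close> global existence and attraction, \<open>\<delta>\<close> the accuracy
    wanted, and 1 keeps the averaging error within the margin of \<open>r\<close>.\<close>
  define \<kappa> where "\<kappa> = Min {\<kappa>0, \<mu>, \<delta>, 1}"
  have \<kappa>: "\<kappa> > 0" "\<kappa> \<le> \<kappa>0" "\<kappa> \<le> \<mu>" "\<kappa> \<le> \<delta>" "\<kappa> \<le> 1" using \<kappa>0 \<mu> \<delta> by (auto simp: \<kappa>_def)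
  have bounded: "norm (flow \<omega> x t) \<le> R + 1" if "\<omega> \<in> \<Omega>" "near \<kappa> \<omega> x" "t \<ge> 0" for \<omega> x t
  proof (cases "t \<le> T\<mu>")
    case True
    show ?thesis
      by (rule \<kappa>0(2)[OF that(1)]) (use True that \<mu>(2) near_mono[OF that(2)] \<kappa> in auto)
  next
    case False
    then have "near 1 (vf_shift \<omega> t) (flow \<omega> x t)"
      using T\<mu>(2)[of t \<omega> x] that near_mono[OF that(2) \<kappa>(3)] by simp
    then obtain \<omega>' x' where "(\<omega>', x') \<in> A" "norm (flow \<omega> x t - x') < 1" unfolding near_def by blast
    moreover from this have "norm x' \<le> R" using R(2) by blast
    ultimately show ?thesis using norm_triangle_sub[of "flow \<omega> x t" x'] by linarith
  qed
  obtain T where T: "T > 0" "\<And>t \<omega> x. t \<ge> T \<Longrightarrow> \<omega> \<in> \<Omega> \<Longrightarrow> near \<mu> \<omega> x \<Longrightarrow> near (\<kappa> / 2) (vf_shift \<omega> t) (flow \<omega> x t)"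
    using \<mu>(3)[of "\<kappa> / 2"] \<kappa>(1) by auto
  obtain T0 where T0: "T0 > 0" "near (\<kappa> / 2) (orbit T0) (flow fhat xhat T0)"
    using basin_attraction(2)[of "\<kappa> / 2"] \<kappa>(1) by auto
  note z0 = flow_solution[OF basin_attraction(1)]
  have "continuous_on {0..T0} (flow fhat xhat)"
    by (rule continuous_on_vector_derivative, rule has_vector_derivative_within_subset[OF z0(2)]) auto
  then have "bounded (flow fhat xhat ` {0..T0})"
    by (intro compact_imp_bounded compact_continuous_image compact_Icc)
  then obtain R1 where "\<forall>t\<in>{0..T0}. norm (flow fhat xhat t) \<le> R1"
    unfolding bounded_iff by (auto simp del: atLeastAtMost_iff)
  then have R1: "norm (flow fhat xhat t) \<le> R1" if "t \<in> {0..T0}" for t using that by blast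
  \<comment> \<open>The averaged solutions involved stay within \<open>max R1 (R + 1)\<close>. The
    margin 1 exceeds the averaging error \<open>\<kappa> / 2\<close>, so the perturbed solution will
    stay where truncation has no effect.\<close>
  define r where "r = max R1 (R + 1) + 1"
  have r: "r > 0" using R(1) by (simp add: r_def)
  have k2: "\<kappa> / 2 > 0" using \<kappa> by simp
  define win where "win a \<epsilon> S y z \<longleftrightarrow> 0 \<le> a \<and> y a = z a \<and>
    (\<forall>t\<in>{a..a + S}. z t \<in> cball 0 r \<and> (z has_vector_derivative fhat (t, z t)) (at t within {a..a + S})) \<and>
    (\<forall>t\<in>{a..a + S}. (y has_vector_derivative trunc r \<epsilon> t (y t)) (at t within {a..a + S}))" for a \<epsilon> S y z
  have window: "\<exists>e>0. \<forall>\<epsilon> a y z. 0 < \<epsilon> \<and> \<epsilon> < e \<and> win a \<epsilon> S y z \<longrightarrow>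
      (\<forall>t\<in>{a..a + S}. norm (y t - z t) \<le> \<kappa> / 2)" if "S > 0" for S
    using averaging_window[OF r that k2] unfolding win_def .
  obtain e1 where e1: "e1 > 0" "\<forall>\<epsilon> a y z. 0 < \<epsilon> \<and> \<epsilon> < e1 \<and> win a \<epsilon> T0 y z \<longrightarrow>
      (\<forall>t\<in>{a..a + T0}. norm (y t - z t) \<le> \<kappa> / 2)"
    using window[OF T0(1)] by (elim exE conjE)
  \<comment> \<open>Windows last \<open>2 * T\<close> but start every \<open>T\<close>: attraction
    has taken effect only in the second half of a window, and these halves must cover all times from
    \<open>T0 + T\<close> on.\<close>
  have "2 * T > 0" using T by simp
  from window[OF this] obtain e2 where e2: "e2 > 0" "\<forall>\<epsilon> a y z. 0 < \<epsilon> \<and> \<epsilon> < e2 \<and> win a \<epsilon> (2 * T) y z \<longrightarrow>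
      (\<forall>t\<in>{a..a + 2 * T}. norm (y t - z t) \<le> \<kappa> / 2)"
    by (elim exE conjE)
  have "t \<in> eps_dom f \<epsilon> 0 xhat \<and> near \<delta> (orbit t) (eps_sol f \<epsilon> t 0 xhat)"
    if \<epsilon>: "0 < \<epsilon>" "\<epsilon> < min e1 e2" and t: "t \<ge> T0 + T" for \<epsilon> t
  proof -
    obtain y where y: "y 0 = xhat" "\<And>t. t \<ge> 0 \<Longrightarrow> (y has_vector_derivative trunc r \<epsilon> t (y t)) (at t within {0..})"
      using ex_trunc_solution[OF r \<epsilon>(1)] by blast
    have y': "(y has_vector_derivative trunc r \<epsilon> t (y t)) (at t within {a..b})" if "0 \<le> a" "t \<in> {a..b}" for a b t
      by (rule has_vector_derivative_within_subset[OF y(2)]) (use that in auto)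
    have in_r: "y t \<in> cball 0 r" if "norm (y t - z) \<le> \<kappa> / 2" "norm z \<le> max R1 (R + 1)" for t z
      using norm_triangle_sub[of "y t" z] that \<kappa>(5) by (simp add: r_def)
    have win0: "win 0 \<epsilon> T0 y (flow fhat xhat)"
      unfolding win_def
    proof (intro conjI ballI)
      fix t assume "t \<in> {0..0 + T0}"
      then show "flow fhat xhat t \<in> cball 0 r" using R1[of t] by (simp add: r_def)
      show "(flow fhat xhat has_vector_derivative fhat (t, flow fhat xhat t)) (at t within {0..0 + T0})"
        by (rule has_vector_derivative_within_subset[OF z0(2)]) (use \<open>t \<in> {0..0 + T0}\<close> in auto)
    qed (use y y' z0(1) in auto)
    have init: "norm (y t - flow fhat xhat t) \<le> \<kappa> / 2" if "t \<in> {0..T0}" for t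
      using e1(2)[rule_format, of \<epsilon> 0 y "flow fhat xhat" t] win0 \<epsilon> that by simp
    define a where "a n = T0 + real n * T" for n
    have a0: "a n \<ge> 0" for n using T0 T by (simp add: a_def)
    \<comment> \<open>The averaged solution is restarted from \<open>y (a n)\<close> itself, so no
      initial error is carried over. It is the solution over the base point
      \<open>orbit (a n)\<close>, delayed by \<open>a n\<close>.\<close>
    have step: "norm (y s - flow (orbit (a n)) (y (a n)) (s - a n)) \<le> \<kappa> / 2"
      if n: "near \<kappa> (orbit (a n)) (y (a n))" and s: "s \<in> {a n..a n + 2 * T}" for n s
    proof -
      let ?z = "flow (orbit (a n)) (y (a n))"
      have dom: "(t, orbit (a n), y (a n)) \<in> skew_domain fhat" if "t \<ge> 0" for t
        using \<mu>(2)[OF orbit_in near_mono[OF n \<kappa>(3)] that] .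
      note z = flow_solution[OF dom]
      have "win (a n) \<epsilon> (2 * T) y (\<lambda>s. ?z (s - a n))"
        unfolding win_def
      proof (intro conjI ballI)
        fix t assume t: "t \<in> {a n..a n + 2 * T}"
        show "?z (t - a n) \<in> cball 0 r"
          using bounded[OF orbit_in n, of "t - a n"] t by (simp add: r_def)
        have "(?z has_vector_derivative orbit (a n) (t - a n, ?z (t - a n))) (at (t - a n) within {0..})"
          using z(2)[of "t - a n"] t by simp
        from has_vector_derivative_delay[OF this t]
        show "((\<lambda>s. ?z (s - a n)) has_vector_derivative fhat (t, ?z (t - a n))) (at t within {a n..a n + 2 * T})"
          by simp
        show "(y has_vector_derivative trunc r \<epsilon> t (y t)) (at t within {a n..a n + 2 * T})"
          by (rule y'[OF a0 t])
      qed (use a0 z(1) in auto)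
      with e2(2)[rule_format, of \<epsilon> "a n" y "\<lambda>s. ?z (s - a n)" s] \<epsilon> s show ?thesis by simp
    qed
    \<comment> \<open>Attraction leaves distance \<open>\<kappa> / 2\<close> and averaging adds at
      most \<open>\<kappa> / 2\<close>, so the next window starts under the same condition as this
      one.\<close>
    have late: "near \<kappa> (orbit s) (y s)"
      if n: "near \<kappa> (orbit (a n)) (y (a n))" and s: "s \<in> {a n + T..a n + 2 * T}" for n s
    proof -
      have "near (\<kappa> / 2) (vf_shift (orbit (a n)) (s - a n)) (flow (orbit (a n)) (y (a n)) (s - a n))"
        using s by (intro T(2) orbit_in near_mono[OF n \<kappa>(3)]) auto
      from near_perturb[OF this step[OF n]] s T show ?thesis by (simp add: vf_shift_vf_shift)
    qed
    have near_a: "near \<kappa> (orbit (a n)) (y (a n))" for n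
    proof (induction n)
      case 0
      from near_perturb[OF T0(2) init[of T0]] T0 show ?case by (simp add: a_def)
    next
      case (Suc n)
      then show ?case using late[of n "a (Suc n)"] T by (simp add: a_def algebra_simps)
    qed
    have grid: "\<exists>n. s \<in> {a n + b..a n + b + T}" if "s \<ge> T0 + b" for s b
    proof -
      define n where "n = nat \<lfloor>(s - T0 - b) / T\<rfloor>"
      have "real n \<le> (s - T0 - b) / T" "(s - T0 - b) / T < real n + 1"
        using that T by (auto simp: n_def)
      then have "real n * T \<le> s - T0 - b" "s - T0 - b < (real n + 1) * T"
        using T by (auto simp: field_simps)
      then show ?thesis by (intro exI[of _ n]) (auto simp: a_def algebra_simps)
    qed
    have yr: "y s \<in> cball 0 r" if s: "s \<ge> 0" for s
    proof (cases "s \<le> T0")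
      case True
      then show ?thesis using in_r[OF init[of s]] R1[of s] s by simp
    next
      case False
      then obtain n where n: "s \<in> {a n + 0..a n + 0 + T}" using grid[of 0 s] by auto
      then have n': "s \<in> {a n..a n + 2 * T}" using T by auto
      show ?thesis
        by (rule in_r[OF step[OF near_a n']])
          (use bounded[OF orbit_in near_a, of "s - a n" n] n in auto)
    qed
    \<comment> \<open>As \<open>y\<close> stays in the ball of radius \<open>r\<close>, it solves
      the original equation on the half-line, and uniqueness identifies it with
      \<open>eps_sol\<close>.\<close>
    let ?F = "\<lambda>t x. f (t / \<epsilon>) t x"
    have ivp: "ivp_solution {0..} ?F 0 xhat {0..} y"
      unfolding ivp_solution_def
    proof (intro conjI ballI)
      fix s :: real assume "s \<in> {0..}"
      then show "(y has_vector_derivative f (s / \<epsilon>) s (y s)) (at s within {0..})"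
        using y(2)[of s] yr[of s] trunc_eq[OF r, of "y s" \<epsilon> s] by simp
    qed (use y in \<open>auto simp: is_interval_1\<close>)
    have lip: "\<exists>L\<ge>0. \<forall>t\<ge>0. \<forall>x\<in>cball 0 q. \<forall>y\<in>cball 0 q. norm (?F t x - ?F t y) \<le> L * norm (x - y)" for q
    proof -
      define q' where "q' = max q 1"
      have q': "q' > 0" "cball 0 q \<subseteq> (cball 0 q' :: (real^'n) set)" by (auto simp: q'_def)
      show ?thesis
        by (intro exI[of _ "Lf q'"] conjI allI impI ballI f_lipschitz[OF q'(1)] less_imp_le[OF Lf(1)[OF q'(1)]])
          (use q' \<epsilon> in auto)
    qed
    note sol = ivp_solution_halfline_unique[OF lip ivp]
    have "t \<ge> 0" using t T T0 by simp
    obtain n where "t \<in> {a n + T..a n + T + T}" using grid[of T t] t by blast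
    then have "near \<kappa> (orbit t) (y t)" using late[OF near_a, of t n] by simp
    then show ?thesis
      using near_mono[OF _ \<kappa>(4)] sol(1) sol(2)[OF \<open>t \<ge> 0\<close>] \<open>t \<ge> 0\<close>
      by (simp add: eps_dom_def eps_sol_def)
  qed
  then show ?thesis
    using T T0 e1(1) e2(1) by (intro exI[of _ "T0 + T"] conjI exI[of _ "min e1 e2"]) auto
qed

end

subsection \<open>Fibres near continuity points\<close>

lemma hausdorff_dist_lessD:
  assumes "hausdorff_dist dist X Y < ennreal e"
  shows "x \<in> X \<Longrightarrow> \<exists>y\<in>Y. dist x y < e" "y \<in> Y \<Longrightarrow> \<exists>x\<in>X. dist y x < e"
proof -
  have pt: "\<exists>y\<in>Y. dist x y < e" if "semidist dist X Y < ennreal e" "x \<in> X" for X Y and x :: 'a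
  proof -
    have "pt_dist dist x Y \<le> semidist dist X Y"
      unfolding semidist_def using that(2) by (rule SUP_upper)
    then have "pt_dist dist x Y < ennreal e" using that(1) by (rule le_less_trans)
    then show ?thesis unfolding pt_dist_def INF_less_iff by (auto simp: ennreal_less_iff)
  qed
  show "x \<in> X \<Longrightarrow> \<exists>y\<in>Y. dist x y < e" "y \<in> Y \<Longrightarrow> \<exists>x\<in>X. dist y x < e"
    using pt assms unfolding hausdorff_dist_def by auto
qed

context attractor_setting
begin

lemma fiber_continuity_pointsE:
  assumes "\<omega>0 \<in> fiber_continuity_points fhat dOm A" "e > 0"
  obtains \<delta> where "\<delta> > 0" "\<omega>0 \<in> \<Omega>"
    "\<And>\<omega> x. dOm \<omega> \<omega>0 < \<delta> \<Longrightarrow> \<omega> \<in> \<Omega> \<Longrightarrow> x \<in> fiber A \<omega> \<Longrightarrow> \<exists>y\<in>fiber A \<omega>0. dist x y < e"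
    "\<And>\<omega> y. dOm \<omega> \<omega>0 < \<delta> \<Longrightarrow> \<omega> \<in> \<Omega> \<Longrightarrow> y \<in> fiber A \<omega>0 \<Longrightarrow> \<exists>x\<in>fiber A \<omega>. dist y x < e"
proof -
  have w0: "\<omega>0 \<in> \<Omega>" using assms(1) by (simp add: fiber_continuity_points_def)
  obtain \<delta> where \<delta>: "\<delta> > 0" "\<forall>\<omega>\<in>\<Omega>. dOm \<omega> \<omega>0 < \<delta> \<longrightarrow> hausdorff_dist dist (fiber A \<omega>) (fiber A \<omega>0) < ennreal e"
    using assms unfolding fiber_continuity_points_def by blast
  show thesis
    by (rule that[OF \<delta>(1) w0]) (use \<delta>(2) hausdorff_dist_lessD in blast)+
qed

text \<open>The solution is linked to the fibre over the current field by way of a nearby point of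
  \<open>A\<close> and a point of the fibre over \<open>\<omega>0\<close>. Each link costs
  \<open>\<sigma> / 3\<close>; the first two give the bound \<open>2 * \<sigma> / 3\<close>.\<close>

lemma tracking_at_continuity_point:
  assumes min: "minimal_hull fhat"
    and w0: "\<omega>0 \<in> fiber_continuity_points fhat dOm A" and \<sigma>: "\<sigma> > 0"
  shows "\<exists>\<epsilon>0>0. \<exists>D. D \<subseteq> {0..} \<and> relatively_dense D \<and> lower_density D > 0 \<and>
    (\<forall>\<epsilon>. 0 < \<epsilon> \<and> \<epsilon> < \<epsilon>0 \<longrightarrow> (\<forall>t\<in>D. t \<in> eps_dom f \<epsilon> 0 xhat \<and>
      infdist (eps_sol f \<epsilon> t 0 xhat) (fiber A \<omega>0) \<le> 2 * \<sigma> / 3 \<and>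
      infdist (eps_sol f \<epsilon> t 0 xhat) (fiber A (vf_shift fhat t)) \<le> \<sigma>))"
proof -
  have "\<sigma> / 3 > 0" using \<sigma> by simp
  from fiber_continuity_pointsE[OF w0 this] obtain \<delta> where \<delta>: "\<delta> > 0" "\<omega>0 \<in> \<Omega>"
    and to: "\<And>\<omega> x. dOm \<omega> \<omega>0 < \<delta> \<Longrightarrow> \<omega> \<in> \<Omega> \<Longrightarrow> x \<in> fiber A \<omega> \<Longrightarrow> \<exists>y\<in>fiber A \<omega>0. dist x y < \<sigma> / 3"
    and from_: "\<And>\<omega> y. dOm \<omega> \<omega>0 < \<delta> \<Longrightarrow> \<omega> \<in> \<Omega> \<Longrightarrow> y \<in> fiber A \<omega>0 \<Longrightarrow> \<exists>x\<in>fiber A \<omega>. dist y x < \<sigma> / 3"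
    by blast
  \<comment> \<open>The witness in \<open>A\<close> lies within \<open>\<delta> / 2\<close> of the
    current field, which lies within \<open>\<delta> / 2\<close> of \<open>\<omega>0\<close>; so
    continuity at \<open>\<omega>0\<close> applies to the witness too.\<close>
  have "min (\<delta> / 2) (\<sigma> / 3) > 0" using \<delta> \<sigma> by simp
  from tracking[OF this] obtain T1 \<epsilon>0 where T1: "T1 \<ge> 0" and \<epsilon>0: "\<epsilon>0 > 0"
    and track: "\<And>\<epsilon> t. 0 < \<epsilon> \<Longrightarrow> \<epsilon> < \<epsilon>0 \<Longrightarrow> t \<ge> T1 \<Longrightarrow> t \<in> eps_dom f \<epsilon> 0 xhat \<and>
      near (min (\<delta> / 2) (\<sigma> / 3)) (orbit t) (eps_sol f \<epsilon> t 0 xhat)" by blast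
  let ?V = "mball \<omega>0 (\<delta> / 2)"
  let ?D = "visits T1 ?V"
  have "\<omega>0 \<in> ?V" using \<delta> by simp
  then have V: "openin mtopology ?V" "?V \<noteq> {}" by - (rule openin_mball, blast)
  obtain c where c: "c > 0" "\<And>y. y < c \<Longrightarrow> eventually (\<lambda>t. y < occ orbit t ?V) at_top"
    using occ_orbit_lower_bound[OF min V] by blast
  have "0 < ereal c" using c(1) by simp
  also have "\<dots> \<le> lower_density ?D" by (rule lower_density_visits[OF V(1) T1 c(2)])
  finally have dens: "lower_density ?D > 0" .
  have est: "t \<in> eps_dom f \<epsilon> 0 xhat \<and>
      infdist (eps_sol f \<epsilon> t 0 xhat) (fiber A \<omega>0) \<le> 2 * \<sigma> / 3 \<and>
      infdist (eps_sol f \<epsilon> t 0 xhat) (fiber A (orbit t)) \<le> \<sigma>"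
    if \<epsilon>: "0 < \<epsilon>" "\<epsilon> < \<epsilon>0" and t: "t \<in> ?D" for \<epsilon> t
  proof -
    let ?y = "eps_sol f \<epsilon> t 0 xhat"
    have tT: "t \<ge> T1" and ot: "dOm (orbit t) \<omega>0 < \<delta> / 2" using t by (auto simp: visits_def commute)
    obtain \<omega>' x' where A: "(\<omega>', x') \<in> A" "dOm (orbit t) \<omega>' < \<delta> / 2" "norm (?y - x') < \<sigma> / 3"
      using track[OF \<epsilon> tT] unfolding near_def by force
    have w': "\<omega>' \<in> \<Omega>" using attractor_hull[OF A(1)] .
    have "dOm \<omega>' \<omega>0 < \<delta>"
      using triangle[OF w' orbit_in \<delta>(2), of t] A(2) ot by (simp add: commute)
    then obtain y0 where y0: "y0 \<in> fiber A \<omega>0" "dist x' y0 < \<sigma> / 3"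
      using to[OF _ w', of x'] A(1) by (auto simp: fiber_def)
    obtain y1 where y1: "y1 \<in> fiber A (orbit t)" "dist y0 y1 < \<sigma> / 3"
      using from_[OF _ orbit_in y0(1), of t] ot \<delta>(1) by auto
    have d0: "dist ?y y0 \<le> 2 * \<sigma> / 3"
      using dist_triangle[of ?y y0 x'] A(3) y0(2) by (simp add: dist_norm)
    have "dist ?y y1 \<le> \<sigma>" using dist_triangle[of ?y y1 y0] d0 y1(2) by simp
    then show ?thesis
      using track[OF \<epsilon> tT] infdist_le2[OF y0(1) d0] infdist_le2[OF y1(1)] by blast
  qed
  have "?D \<subseteq> {0..}" using T1 by (auto simp: visits_def)
  then show ?thesis
    using \<epsilon>0 dens relatively_dense_visits[OF min V T1] est
    by (intro exI[of _ \<epsilon>0] exI[of _ ?D] conjI) auto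
qed

text \<open>Oscillation of the fibre map below \<open>e\<close> at a definite scale. Comparing two
  arbitrary points of the ball, rather than one point with its centre, and leaving slack in the
  radius makes the set open; a single semidistance suffices as the two points may be
  exchanged.\<close>

definition uniform_fibers :: "real \<Rightarrow> nat \<Rightarrow> (real \<times> (real ^ 'n) \<Rightarrow> real ^ 'n) set" where
  "uniform_fibers e k = {\<omega> \<in> \<Omega>. \<exists>r>1 / (real k + 1).
     \<forall>\<omega>1\<in>mball \<omega> r. \<forall>\<omega>2\<in>mball \<omega> r. \<forall>x\<in>fiber A \<omega>1. \<exists>x'\<in>fiber A \<omega>2. dist x x' < e}"

lemma openin_uniform_fibers: "openin mtopology (uniform_fibers e k)"
  unfolding openin_mtopology
proof (intro conjI allI impI)
  fix \<omega> assume "\<omega> \<in> uniform_fibers e k"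
  then obtain r where w: "\<omega> \<in> \<Omega>" and r: "r > 1 / (real k + 1)"
    and P: "\<forall>\<omega>1\<in>mball \<omega> r. \<forall>\<omega>2\<in>mball \<omega> r. \<forall>x\<in>fiber A \<omega>1. \<exists>x'\<in>fiber A \<omega>2. dist x x' < e"
    unfolding uniform_fibers_def by blast
  define s where "s = (r + 1 / (real k + 1)) / 2"
  have s: "1 / (real k + 1) < s" "s < r" using r by (auto simp: s_def)
  have "\<omega>' \<in> uniform_fibers e k" if w': "\<omega>' \<in> mball \<omega> (r - s)" for \<omega>'
  proof -
    have "mball \<omega>' s \<subseteq> mball \<omega> r" using w' by (intro mball_subset) (auto simp: commute)
    then have "\<forall>\<omega>1\<in>mball \<omega>' s. \<forall>\<omega>2\<in>mball \<omega>' s. \<forall>x\<in>fiber A \<omega>1. \<exists>x'\<in>fiber A \<omega>2. dist x x' < e"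
      using P by blast
    moreover have "\<omega>' \<in> \<Omega>" using w' by simp
    ultimately show ?thesis using s(1) unfolding uniform_fibers_def by blast
  qed
  then show "\<exists>\<delta>>0. mball \<omega> \<delta> \<subseteq> uniform_fibers e k" using s by (intro exI[of _ "r - s"]) auto
qed (auto simp: uniform_fibers_def)

lemma uniform_fibers_mono: "j \<le> k \<Longrightarrow> uniform_fibers e j \<subseteq> uniform_fibers e k"
proof -
  assume "j \<le> k"
  then have "1 / (real k + 1) \<le> 1 / (real j + 1)" by (intro divide_left_mono) auto
  then show ?thesis unfolding uniform_fibers_def by (auto intro: le_less_trans)
qed

lemma continuity_points_uniform_fibers:
  assumes "e > 0"
  shows "fiber_continuity_points fhat dOm A \<subseteq> (\<Union>k. uniform_fibers e k)"
proof
  fix \<omega>0 assume w0: "\<omega>0 \<in> fiber_continuity_points fhat dOm A"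
  have "e / 2 > 0" using assms by simp
  from fiber_continuity_pointsE[OF w0 this] obtain \<delta> where \<delta>: "\<delta> > 0" "\<omega>0 \<in> \<Omega>"
    and to: "\<And>\<omega> x. dOm \<omega> \<omega>0 < \<delta> \<Longrightarrow> \<omega> \<in> \<Omega> \<Longrightarrow> x \<in> fiber A \<omega> \<Longrightarrow> \<exists>y\<in>fiber A \<omega>0. dist x y < e / 2"
    and from_: "\<And>\<omega> y. dOm \<omega> \<omega>0 < \<delta> \<Longrightarrow> \<omega> \<in> \<Omega> \<Longrightarrow> y \<in> fiber A \<omega>0 \<Longrightarrow> \<exists>x\<in>fiber A \<omega>. dist y x < e / 2"
    by blast
  obtain k where k: "inverse (real (Suc k)) < \<delta>" using reals_Archimedean[OF \<delta>(1)] by blast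
  have "\<exists>x'\<in>fiber A \<omega>2. dist x x' < e"
    if w: "\<omega>1 \<in> mball \<omega>0 \<delta>" "\<omega>2 \<in> mball \<omega>0 \<delta>" "x \<in> fiber A \<omega>1" for \<omega>1 \<omega>2 x
  proof -
    obtain y where y: "y \<in> fiber A \<omega>0" "dist x y < e / 2" using to[of \<omega>1 x] w by (auto simp: commute)
    obtain x' where x': "x' \<in> fiber A \<omega>2" "dist y x' < e / 2"
      using from_[of \<omega>2 y] w y(1) by (auto simp: commute)
    have "dist x x' < e" using dist_triangle[of x x' y] y(2) x'(2) by simp
    then show ?thesis using x'(1) by blast
  qed
  then have "\<omega>0 \<in> uniform_fibers e k"
    unfolding uniform_fibers_def using \<delta> k
    by (intro CollectI conjI exI[of _ \<delta>]) (auto simp: inverse_eq_divide add.commute)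
  then show "\<omega>0 \<in> (\<Union>k. uniform_fibers e k)" by blast
qed

text \<open>The times are chosen diagonally: \<open>T k\<close> is bad for the k-th set and hence,
  the sets being increasing, for every earlier one. A single sequence therefore bounds the limit
  measure of all of them.\<close>

lemma uniform_fibers_frequent:
  assumes full: "complete_measure_set fhat (fiber_continuity_points fhat dOm A)"
    and \<rho>: "0 < \<rho>" "\<rho> < 1" and e: "e > 0"
  shows "\<exists>k. \<forall>y<1 - \<rho>. eventually (\<lambda>t. y < occ orbit t (uniform_fibers e k)) at_top"
proof (rule ccontr)
  let ?G = "uniform_fibers e"
  assume neg: "\<not> ?thesis"
  have "\<exists>t\<ge>real k + 1. occ orbit t (?G k) \<le> 1 - \<rho>" for k
  proof -
    obtain y where y: "y < 1 - \<rho>" "\<not> eventually (\<lambda>t. y < occ orbit t (?G k)) at_top"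
      using neg by blast
    then have "\<exists>t\<ge>real k + 1. \<not> y < occ orbit t (?G k)"
      unfolding eventually_at_top_linorder by blast
    then show ?thesis using y(1) by (auto simp: not_less intro: order_trans less_imp_le)
  qed
  then obtain T where T: "\<And>k. T k \<ge> real k + 1" "\<And>k. occ orbit (T k) (?G k) \<le> 1 - \<rho>" by metis
  have Tpos: "0 < T k" for k using T(1)[of k] by linarith
  have Tlim: "filterlim T at_top sequentially"
  proof (rule filterlim_at_top_mono[OF filterlim_real_sequentially], rule always_eventually, rule allI)
    show "real k \<le> T k" for k using T(1)[of k] by linarith
  qed
  have "vf_shift (vf_shift \<omega> t) (- t) = \<omega>" "orbit (s + t) = vf_shift (orbit s) t" for \<omega> s t
    by (simp_all add: vf_shift_vf_shift)
  note inv = this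
  obtain m where m: "prob_space m" "complete_measure m" "space m = \<Omega>"
      "\<forall>U. openin mtopology U \<longrightarrow> U \<in> sets m"
      "\<forall>B\<in>sets m. emeasure m B = (INF U\<in>{U. openin mtopology U \<and> B \<subseteq> U}. emeasure m U) \<and>
        emeasure m B = (SUP K\<in>{K. compactin mtopology K \<and> K \<subseteq> B}. emeasure m K)"
      "\<forall>t. \<forall>B\<in>sets m. (\<lambda>\<omega>. vf_shift \<omega> t) ` B \<in> sets m \<and>
        emeasure m ((\<lambda>\<omega>. vf_shift \<omega> t) ` B) = emeasure m B"
      "\<forall>U c. openin mtopology U \<longrightarrow> eventually (\<lambda>k. occ orbit (T k) U \<le> c) sequentially \<longrightarrow>
        emeasure m U \<le> ennreal c"
    using krylov_bogoliubov[of orbit "\<lambda>t \<omega>. vf_shift \<omega> t" T,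
        OF hull_compact continuous_orbit continuous_shift inv(1) inv(2) Tpos Tlim]
    by (elim exE conjE) (rule that)
  have "invariant_hull_measure fhat m"
    unfolding invariant_hull_measure_def mtopology_eq[symmetric] using m(1-6) by (intro conjI)
  then have C: "fiber_continuity_points fhat dOm A \<in> sets m"
      "emeasure m (fiber_continuity_points fhat dOm A) = 1"
    using full unfolding complete_measure_set_def by auto
  have sets: "?G k \<in> sets m" for k using m(4) openin_uniform_fibers by blast
  have "emeasure m (?G j) \<le> ennreal (1 - \<rho>)" for j
  proof (rule m(7)[rule_format, OF openin_uniform_fibers])
    have "occ orbit (T k) (?G j) \<le> 1 - \<rho>" if "j \<le> k" for k
    proof -
      have "measure lebesgue ({0..T k} \<inter> orbit -` ?G j) \<le> measure lebesgue ({0..T k} \<inter> orbit -` ?G k)"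
        by (rule measure_mono_fmeasurable)
          (use uniform_fibers_mono[OF that] occ_lmeasurable[OF continuous_orbit openin_uniform_fibers] in auto)
      then have "occ orbit (T k) (?G j) \<le> occ orbit (T k) (?G k)"
        unfolding occ_def using Tpos[of k] by (intro divide_right_mono) auto
      with T(2)[of k] show ?thesis by linarith
    qed
    then show "eventually (\<lambda>k. occ orbit (T k) (?G j) \<le> 1 - \<rho>) sequentially"
      by (rule eventually_sequentiallyI)
  qed
  \<comment> \<open>The uniform bound passes to the union by continuity from below, which the
    countable additivity of \<open>m\<close> provides.\<close>
  moreover have "(SUP k. emeasure m (?G k)) = emeasure m (\<Union>k. ?G k)"
    using sets uniform_fibers_mono by (intro SUP_emeasure_incseq) (auto simp: incseq_def)
  ultimately have "emeasure m (\<Union>k. ?G k) \<le> ennreal (1 - \<rho>)" by (metis SUP_least)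
  moreover have "emeasure m (fiber_continuity_points fhat dOm A) \<le> emeasure m (\<Union>k. ?G k)"
    using sets by (intro emeasure_mono continuity_points_uniform_fibers[OF e]) auto
  ultimately have "1 \<le> ennreal (1 - \<rho>)" unfolding C(2) by (rule order_trans[rotated])
  then show False using \<rho> by simp
qed

lemma tracking_frequent:
  assumes min: "minimal_hull fhat"
    and full: "complete_measure_set fhat (fiber_continuity_points fhat dOm A)"
    and \<sigma>: "\<sigma> > 0" and \<rho>: "0 < \<rho>" "\<rho> < 1"
  shows "\<exists>\<epsilon>s>0. \<exists>D. D \<subseteq> {0..} \<and> relatively_dense D \<and> lower_density D \<ge> ereal (1 - \<rho>) \<and>
    (\<forall>\<epsilon>. 0 < \<epsilon> \<and> \<epsilon> < \<epsilon>s \<longrightarrow> (\<forall>t\<in>D. t \<in> eps_dom f \<epsilon> 0 xhat \<and>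
      infdist (eps_sol f \<epsilon> t 0 xhat) (fiber A (vf_shift fhat t)) \<le> \<sigma>))"
proof -
  have s2: "\<sigma> / 2 > 0" using \<sigma> by simp
  obtain k where k: "\<And>y. y < 1 - \<rho> \<Longrightarrow> eventually (\<lambda>t. y < occ orbit t (uniform_fibers (\<sigma> / 2) k)) at_top"
    using uniform_fibers_frequent[OF full \<rho> s2] by blast
  let ?G = "uniform_fibers (\<sigma> / 2) k"
  \<comment> \<open>The empty set has occupation fraction 0, whereas \<open>k\<close> gives positive
    fractions because \<open>0 < 1 - \<rho>\<close>.\<close>
  have "?G \<noteq> {}"
    using k[of 0] \<rho> by (auto simp: occ_def)
  \<comment> \<open>The first entry places the base point of the witness in the ball around the
    current field on which fibres vary by less than \<open>\<sigma> / 2\<close>; the second bounds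
    the distance of the solution to that witness.\<close>
  let ?\<delta> = "min (1 / (real k + 1)) (\<sigma> / 2)"
  have "?\<delta> > 0" using \<sigma> by simp
  from tracking[OF this] obtain T1 \<epsilon>0 where T1: "T1 \<ge> 0" and \<epsilon>0: "\<epsilon>0 > 0"
    and track: "\<And>\<epsilon> t. 0 < \<epsilon> \<Longrightarrow> \<epsilon> < \<epsilon>0 \<Longrightarrow> t \<ge> T1 \<Longrightarrow> t \<in> eps_dom f \<epsilon> 0 xhat \<and>
      near ?\<delta> (orbit t) (eps_sol f \<epsilon> t 0 xhat)" by blast
  let ?D = "visits T1 ?G"
  have est: "t \<in> eps_dom f \<epsilon> 0 xhat \<and> infdist (eps_sol f \<epsilon> t 0 xhat) (fiber A (orbit t)) \<le> \<sigma>"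
    if \<epsilon>: "0 < \<epsilon>" "\<epsilon> < \<epsilon>0" and t: "t \<in> ?D" for \<epsilon> t
  proof -
    let ?y = "eps_sol f \<epsilon> t 0 xhat"
    have tT: "t \<ge> T1" and "orbit t \<in> ?G" using t by (auto simp: visits_def)
    then obtain r where r: "r > 1 / (real k + 1)" and P: "\<forall>\<omega>1\<in>mball (orbit t) r. \<forall>\<omega>2\<in>mball (orbit t) r.
        \<forall>x\<in>fiber A \<omega>1. \<exists>x'\<in>fiber A \<omega>2. dist x x' < \<sigma> / 2"
      unfolding uniform_fibers_def by blast
    obtain \<omega>' x' where A: "(\<omega>', x') \<in> A" "dOm (orbit t) \<omega>' < 1 / (real k + 1)" "norm (?y - x') < \<sigma> / 2"
      using track[OF \<epsilon> tT] unfolding near_def by force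
    have "0 < r" using r by (meson less_trans divide_pos_pos zero_less_one of_nat_0_le_iff add_nonneg_pos)
    then have "\<omega>' \<in> mball (orbit t) r" "orbit t \<in> mball (orbit t) r"
      using A(2) r attractor_hull[OF A(1)] orbit_in by auto
    then obtain x where x: "x \<in> fiber A (orbit t)" "dist x' x < \<sigma> / 2"
      using P A(1) unfolding fiber_def by blast
    have "dist ?y x \<le> \<sigma>" using dist_triangle[of ?y x x'] A(3) x(2) by (simp add: dist_norm)
    then show ?thesis using track[OF \<epsilon> tT] infdist_le2[OF x(1)] by blast
  qed
  have "?D \<subseteq> {0..}" using T1 by (auto simp: visits_def)
  then show ?thesis
    using \<epsilon>0 est relatively_dense_visits[OF min openin_uniform_fibers \<open>?G \<noteq> {}\<close> T1]
      lower_density_visits[OF openin_uniform_fibers T1 k]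
    by (intro exI[of _ \<epsilon>0] exI[of _ ?D] conjI) auto
qed

end

theorem proposition4p3:
  fixes f :: "real \<Rightarrow> real \<Rightarrow> real ^ 'n \<Rightarrow> real ^ 'n"
    and fhat :: "real \<times> (real ^ 'n) \<Rightarrow> real ^ 'n"
    and dOm :: "(real \<times> (real ^ 'n) \<Rightarrow> real ^ 'n) \<Rightarrow> (real \<times> (real ^ 'n) \<Rightarrow> real ^ 'n) \<Rightarrow> real"
    and A :: "((real \<times> (real ^ 'n) \<Rightarrow> real ^ 'n) \<times> (real ^ 'n)) set"
    and xhat :: "real ^ 'n"
  assumes a_cont: "\<And>r. r > 0 \<Longrightarrow>
      continuous_on ({0..} \<times> UNIV \<times> cball 0 r) (\<lambda>(\<tau>, t, x). f \<tau> t x)"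
    and a_bdd: "\<And>r. r > 0 \<Longrightarrow>
      bounded ((\<lambda>(\<tau>, t, x). f \<tau> t x) ` ({0..} \<times> UNIV \<times> cball 0 r))"
    and b: "\<And>r. r > 0 \<Longrightarrow> \<exists>\<theta> L. modulus_of_continuity \<theta> \<and> L > 0 \<and>
      (\<forall>\<tau>\<ge>0. \<forall>t1 t2. \<forall>x1\<in>cball 0 r. \<forall>x2\<in>cball 0 r.
         ennreal (norm (f \<tau> t1 x1 - f \<tau> t2 x2))
           \<le> \<theta> \<bar>t1 - t2\<bar> + ennreal (L * norm (x1 - x2)))"
    and c: "\<And>t x. ((\<lambda>T. (1 / T) *\<^sub>R integral {0..T} (\<lambda>s. f s t x)) \<longlongrightarrow> fhat (t, x)) at_top"
    and d: "\<And>r. r > 0 \<Longrightarrow>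
      uniform_limit ({0..} \<times> UNIV \<times> cball 0 r)
        (\<lambda>T (\<tau>, t, x). (1 / T) *\<^sub>R integral {\<tau>..T + \<tau>} (\<lambda>s. f s t x))
        (\<lambda>(\<tau>, t, x). fhat (t, x)) at_top"
    and metric: "Metric_space (vf_hull fhat) dOm"
    and metric_topology: "Metric_space.mtopology (vf_hull fhat) dOm = hull_topology fhat"
    and attractor: "local_attractor fhat dOm A"
    and full_projection: "base_projection fhat A = vf_hull fhat"
    and in_basin: "(fhat, xhat) \<in> basin fhat dOm A"
    and minimal: "minimal_hull fhat"
  shows
    "(\<forall>\<omega>\<in>fiber_continuity_points fhat dOm A. \<forall>\<sigma>>0.
        \<exists>\<epsilon>0>0. \<exists>D. D \<subseteq> {0..} \<and> relatively_dense D \<and> lower_density D > 0 \<and>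
          (\<forall>\<epsilon>. 0 < \<epsilon> \<and> \<epsilon> < \<epsilon>0 \<longrightarrow>
            (\<forall>t\<in>D. t \<in> eps_dom f \<epsilon> 0 xhat \<and>
               infdist (eps_sol f \<epsilon> t 0 xhat) (fiber A \<omega>) \<le> 2 * \<sigma> / 3 \<and>
               infdist (eps_sol f \<epsilon> t 0 xhat) (fiber A (vf_shift fhat t)) \<le> \<sigma>)))
     \<and>
     (complete_measure_set fhat (fiber_continuity_points fhat dOm A) \<longrightarrow>
       (\<forall>\<sigma>>0. \<forall>\<rho>. 0 < \<rho> \<and> \<rho> < 1 \<longrightarrow>
        (\<exists>\<epsilon>s>0. \<exists>D. D \<subseteq> {0..} \<and> relatively_dense D \<and> lower_density D \<ge> ereal (1 - \<rho>) \<and>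
          (\<forall>\<epsilon>. 0 < \<epsilon> \<and> \<epsilon> < \<epsilon>s \<longrightarrow>
            (\<forall>t\<in>D. t \<in> eps_dom f \<epsilon> 0 xhat \<and>
               infdist (eps_sol f \<epsilon> t 0 xhat) (fiber A (vf_shift fhat t)) \<le> \<sigma>)))))"
proof -
  have topspace: "topspace (hull_topology fhat) = vf_hull fhat"
    using Metric_space.topspace_mtopology[OF metric] metric_topology by simp
  \<comment> \<open>The first projection of \<open>A\<close> is compact and, by
    \<open>full_projection\<close>, equal to the hull; this supplies the compactness required by
    \<open>averaged_hull\<close>.\<close>
  have "compactin (skew_topology fhat) A" using attractor by (simp add: local_attractor_def)
  then have "compactin (hull_topology fhat) (fst ` A)"
    unfolding skew_topology_def by (rule image_compactin) (rule continuous_map_fst)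
  moreover from this have "fst ` A \<subseteq> vf_hull fhat" using compactin_subset_topspace topspace by metis
  moreover have "vf_hull fhat \<subseteq> fst ` A"
    using full_projection by (force simp: base_projection_def fiber_def)
  ultimately have compact: "compact_space (hull_topology fhat)" by (simp add: compact_space_def topspace)
  have "averaging f fhat"
    by (rule averaging.intro[OF a_cont a_bdd b d])
  then interpret attractor_setting f fhat dOm A xhat
    using metric attractor in_basin
    by (intro attractor_setting.intro averaged_hull.intro averaged_hull_axioms.intro
        attractor_setting_axioms.intro; (assumption | simp only: metric_topology compact))
  show ?thesis
    by (intro conjI ballI allI impI tracking_at_continuity_point[OF minimal]
        tracking_frequent[OF minimal]) auto
qed

end
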